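(* Let $E$ be a sequentially complete locally convex space over $\mathbb{Q}_p$, $n\in\mathbb{N}$ and $\alpha\in\mathbb{N}_0^n$. Then the map \[ A^\alpha_E\colon C^\alpha(\mathbb{Z}_p^n,E)\to c_0(\mathbb{N}_0^n,w_\alpha,E) \] taking a function $f$ to the family $(a_\nu(f))_{\nu\in\mathbb{N}_0^n}$ of its Mahler coefficients is an isomorphism of topological vector spaces.
   Context: $p$ is a prime, $\mathbb{N}=\{1,2,\ldots\}$, $\mathbb{N}_0=\{0,1,2,\ldots\}$. All topological vector spaces are Hausdorff. A topological $\mathbb{Q}_p$-vector space $E$ is locally convex if its topology is defined by a set of ultrametric seminorms $q$ ($q(x+y)\le\max\{q(x),q(y)\}$). The $\nu$-th Mahler coefficient of $f\colon\mathbb{Z}_p^n\to E$ is $a_\nu(f)=\sum_{\mu\le\nu}(-1)^{|\nu|-|\mu|}\binom{\nu}{\mu}f(\mu)$, the sum being over $\mu\in\mathbb{N}_0^n$ with $\mu\le\nu$ componentwise, $|\nu|=\nu_1+\cdots+\nu_n$, $\binom{\nu}{\mu}=\prod_i\binom{\nu_i}{\mu_i}$. The weight $w_\alpha\colon\mathbb{N}_0^n\to\,]0,\infty[$ is defined via $w_\alpha(\nu):=\nu^\alpha:=\nu_1^{\alpha_1}\cdots\nu_n^{\alpha_n}$. For a set $X$ and $w\colon X\to\,]0,\infty[$, $c_0(X,w,E)$ is the space of all $g\colon X\to E$ such that for each continuous ultrametric seminorm $q$ on $E$ and $\varepsilon>0$ there is a finite set $\Phi\subseteq X$ with $w(x)q(g(x))<\varepsilon$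 for all $x\in X\setminus\Phi$; it carries the locally convex topology defined by the seminorms $\|g\|_{w,q}=\sup_{x\in X}w(x)q(g(x))$. A subset of $\mathbb{Q}_p^n$ is cartesian if it is of the form $V=V_1\times\cdots\times V_n$ with subsets $V_i\subseteq\mathbb{Q}_p$ without isolated points. For such $V$, $f\colon V\to E$ and $\beta\in\mathbb{N}_0^n$ put $V^{<\beta>}:=V_1^{1+\beta_1}\times\cdots\times V_n^{1+\beta_n}$, with elements $x=(x^{(1)},\ldots,x^{(n)})$, $x^{(i)}=(x^{(i)}_0,\ldots,x^{(i)}_{\beta_i})$; let $V^{>\beta<}$ be the (dense, open) set of $x\in V^{<\beta>}$ with $x^{(i)}_j\ne x^{(i)}_k$ for all $i$ and $0\le j<k\le\beta_i$, and \[ f^{>\beta<}(x)=\sum_{j_1=0}^{\beta_1}\cdots\sum_{j_n=0}^{\beta_n}\Big(\prod_{i=1}^n\ \prod_{k_i\in\{0,\ldots,\beta_i\}\setminus\{j_i\}}\frac{1}{x^{(i)}_{j_i}-x^{(i)}_{k_i}}\Big)f(x^{(1)}_{j_1},\ldots,x^{(n)}_{j_n}) \] for $x\in V^{>\beta<}$ (empty products are $1$). $f$ is $C^\alpha$ if for every $\beta\in\mathbb{N}_0^n$ with $\beta\le\alpha$ componentwise $f^{>\beta<}$ has a (unique) continuous extension $f^{<\beta>}\colon V^{<\beta>}\to E$. $C^\alpha(\mathbb{Z}_p^n,E)$ is the space of $C^\alpha$-maps $\mathbb{Z}_p^n\to E$ with the initial topology with respect to the maps $f\mapsto(f|_V)^{<\beta>}\in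 C(V^{<\beta>},E)$ (compact-open topology) for $\beta\le\alpha$ in $\mathbb{N}_0^n$ and cartesian relatively open $V\subseteq\mathbb{Z}_p^n$.
   Formalization: In the weight w_α(ν) = ν^α a factor 0^{α_i} with α_i > 0 is read as 1, since w_α must take values in ]0,∞[; with the literal value 0 the space c_0(N_0^n, w_α, E) would not be Hausdorff and the claim would fail. *)

theory Defs
  imports "HOL-Analysis.Analysis" "HOL-Library.Function_Algebras"
    "HOL-Computational_Algebra.Primes"
begin

section \<open>The field of p-adic numbers\<close>

subsection \<open>The p-adic absolute value on the rationals\<close>

definition padic_abs :: "nat \<Rightarrow> rat \<Rightarrow> real" where
  "padic_abs p r = (if r = 0 then 0 else
     real p powi (int (multiplicity (int p) (snd (quotient_of r))) -
                  int (multiplicity (int p) (fst (quotient_of r)))))"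

lemma padic_abs_0 [simp]: "padic_abs p 0 = 0"
  by (simp add: padic_abs_def)

lemma padic_abs_frac:
  assumes p: "prime p" and a: "a \<noteq> 0" and b: "b \<noteq> 0"
  shows "padic_abs p (of_int a / of_int b) =
    real p powi (int (multiplicity (int p) b) - int (multiplicity (int p) a))"
proof -
  define r :: rat where "r = of_int a / of_int b"
  obtain c d where cd: "quotient_of r = (c, d)" by force
  have d: "d > 0" using quotient_of_denom_pos[OF cd] .
  have r: "r = of_int c / of_int d" using quotient_of_div[OF cd] .
  have r0: "r \<noteq> 0" using a b by (simp add: r_def)
  then have c0: "c \<noteq> 0" using r by auto
  have "(of_int (a * d) :: rat) = of_int (c * b)"
    using r b d unfolding r_def by (simp add: field_simps)
  then have eq: "a * d = c * b" by (simp only: of_int_eq_iff)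
  have pe: "prime_elem (int p)" using p by simp
  have "multiplicity (int p) a + multiplicity (int p) d = multiplicity (int p) c + multiplicity (int p) b"
    using arg_cong[OF eq, of "multiplicity (int p)"] a b c0 d
    by (simp add: prime_elem_multiplicity_mult_distrib[OF pe])
  then have "int (multiplicity (int p) d) - int (multiplicity (int p) c) =
     int (multiplicity (int p) b) - int (multiplicity (int p) a)" by linarith
  then show ?thesis using r0 cd by (simp add: padic_abs_def flip: r_def)
qed

lemma rat_frac_cases:
  fixes r :: rat
  obtains a b :: int where "r = of_int a / of_int b" "b \<noteq> 0"
  by (metis quotient_of_div quotient_of_denom_pos less_irrefl surj_pair)

lemma padic_abs_nonneg [simp]: "padic_abs p r \<ge> 0"
  by (simp add: padic_abs_def)

lemma padic_abs_eq_0_iff [simp]: "prime p \<Longrightarrow> padic_abs p r = 0 \<longleftrightarrow> r = 0"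
  by (auto simp: padic_abs_def)

lemma padic_abs_minus [simp]: "padic_abs p (- r) = padic_abs p r"
proof -
  have "multiplicity (int p) (- a) = multiplicity (int p) a" for a
    using multiplicity_times_unit_right[of "-1" "int p" a] by simp
  then show ?thesis by (simp add: padic_abs_def rat_uminus_code Let_def case_prod_unfold)
qed

lemma padic_abs_1 [simp]: "padic_abs p 1 = 1"
  by (simp add: padic_abs_def)

lemma padic_abs_mult:
  assumes p: "prime p"
  shows "padic_abs p (r * s) = padic_abs p r * padic_abs p s"
proof (cases "r = 0 \<or> s = 0")
  case False
  obtain a b where r: "r = of_int a / of_int b" "b \<noteq> 0" by (rule rat_frac_cases)
  obtain c d where s: "s = of_int c / of_int d" "d \<noteq> 0" by (rule rat_frac_cases)
  have nz: "a \<noteq> 0" "c \<noteq> 0" using False r s by auto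
  have rs: "r * s = of_int (a * c) / of_int (b * d)" by (simp add: r s)
  have pe: "prime_elem (int p)" using p by simp
  have p0: "real p \<noteq> 0" using p by (auto simp: prime_gt_0_nat)
  show ?thesis
    unfolding rs
    apply (subst padic_abs_frac[OF p])
    subgoal using nz by simp
    subgoal using r s by simp
    unfolding r(1) s(1)
    apply (subst padic_abs_frac[OF p nz(1) r(2)])
    apply (subst padic_abs_frac[OF p nz(2) s(2)])
    using nz r(2) s(2) p0
    by (simp add: prime_elem_multiplicity_mult_distrib[OF pe] flip: power_int_add)
       (simp add: algebra_simps)
qed auto

lemma padic_abs_inverse:
  assumes p: "prime p"
  shows "padic_abs p (inverse r) = inverse (padic_abs p r)"
proof (cases "r = 0")
  case False
  then have "padic_abs p r * padic_abs p (inverse r) = 1"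
    by (simp flip: padic_abs_mult[OF p])
  then show ?thesis by (metis inverse_unique)
qed simp

lemma padic_abs_add:
  assumes p: "prime p"
  shows "padic_abs p (r + s) \<le> max (padic_abs p r) (padic_abs p s)"
proof (cases "r = 0 \<or> s = 0 \<or> r + s = 0")
  case False
  obtain a b where r: "r = of_int a / of_int b" "b \<noteq> 0" by (rule rat_frac_cases)
  obtain c d where s: "s = of_int c / of_int d" "d \<noteq> 0" by (rule rat_frac_cases)
  define e where "e = b * d"
  have e: "e \<noteq> 0" using r s by (simp add: e_def)
  have r': "r = of_int (a * d) / of_int e" and s': "s = of_int (c * b) / of_int e"
    using r s by (auto simp: e_def)
  have rs: "r + s = of_int (a * d + c * b) / of_int e"
    unfolding r' s' by (simp add: add_divide_distrib)
  have nz: "a * d \<noteq> 0" "c * b \<noteq> 0" "a * d + c * b \<noteq> 0"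
  proof -
    show "a * d \<noteq> 0" "c * b \<noteq> 0" using False r s by auto
    show "a * d + c * b \<noteq> 0" using False rs by (metis div_0 of_int_0)
  qed
  let ?m = "multiplicity (int p)"
  have np: "\<not> is_unit (int p)" using p prime_gt_1_nat[of p] by auto
  have "min (?m (a * d)) (?m (c * b)) \<le> ?m (a * d + c * b)"
    using nz np by (intro multiplicity_geI dvd_add) (auto intro: multiplicity_dvd')
  then have le: "?m (a * d + c * b) \<ge> ?m (a * d) \<or> ?m (a * d + c * b) \<ge> ?m (c * b)"
    by linarith
  have p1: "real p \<ge> 1" using p prime_ge_1_nat by auto
  have mono: "real p powi i \<le> real p powi j" if "i \<le> j" for i j
    using p1 that by (rule power_int_increasing[rotated])
  show ?thesis
    unfolding rs unfolding r' s'
    using le padic_abs_frac[OF p nz(1) e] padic_abs_frac[OF p nz(2) e] padic_abs_frac[OF p nz(3) e]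
    by (auto simp: le_max_iff_disj intro!: mono)
qed (auto simp: le_max_iff_disj add_eq_0_iff)

lemma padic_abs_triangle:
  assumes "prime p"
  shows "padic_abs p (r + s) \<le> padic_abs p r + padic_abs p s"
  using padic_abs_add[OF assms, of r s] padic_abs_nonneg[of p r] padic_abs_nonneg[of p s] by linarith

lemma padic_abs_minus_commute: "padic_abs p (r - s) = padic_abs p (s - r)"
  by (metis minus_diff_eq padic_abs_minus)

lemma padic_abs_diff:
  assumes "prime p"
  shows "\<bar>padic_abs p r - padic_abs p s\<bar> \<le> padic_abs p (r - s)"
  using padic_abs_triangle[OF assms, of "r - s" s] padic_abs_triangle[OF assms, of "s - r" r]
  by (simp add: padic_abs_minus_commute)


subsection \<open>Completion\<close>

text \<open>The prime is carried by the type: it is the cardinality of \<open>'p\<close>.\<close>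

class prime_card =
  assumes prime_card: "prime CARD('a)"

instance bool :: prime_card
  by standard simp

definition padic_cauchy :: "nat \<Rightarrow> (nat \<Rightarrow> rat) \<Rightarrow> bool" where
  "padic_cauchy p X \<longleftrightarrow> (\<forall>e>0. \<exists>N. \<forall>m\<ge>N. \<forall>n\<ge>N. padic_abs p (X m - X n) < e)"

definition padic_null :: "nat \<Rightarrow> (nat \<Rightarrow> rat) \<Rightarrow> bool" where
  "padic_null p X \<longleftrightarrow> (\<lambda>n. padic_abs p (X n)) \<longlonglongrightarrow> 0"

context
  fixes p :: nat
  assumes p: "prime p"
begin

lemma padic_cauchy_conv: "padic_cauchy p X \<Longrightarrow> convergent (\<lambda>n. padic_abs p (X n))"
proof (intro Cauchy_convergent CauchyI)
  fix e :: real assume X: "padic_cauchy p X" and e: "0 < e"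
  obtain N where N: "\<forall>m\<ge>N. \<forall>n\<ge>N. padic_abs p (X m - X n) < e"
    using X e unfolding padic_cauchy_def by blast
  have "norm (padic_abs p (X m) - padic_abs p (X n)) < e" if "m \<ge> N" "n \<ge> N" for m n
    using N that padic_abs_diff[OF p, of "X m" "X n"] by (auto intro: le_less_trans)
  then show "\<exists>N. \<forall>m\<ge>N. \<forall>n\<ge>N. norm (padic_abs p (X m) - padic_abs p (X n)) < e" by blast
qed

lemma padic_cauchy_bounded: 
  assumes "padic_cauchy p X"
  shows "\<exists>B>0. \<forall>n. padic_abs p (X n) \<le> B"
proof -
  have "Bseq (\<lambda>n. padic_abs p (X n))"
    using padic_cauchy_conv[OF assms] by (rule convergent_imp_Bseq)
  then show ?thesis unfolding Bseq_def by simp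
qed

lemma padic_null_add: 
  assumes "padic_null p X" "padic_null p Y" shows "padic_null p (\<lambda>n. X n + Y n)"
proof -
  have "(\<lambda>n. padic_abs p (X n) + padic_abs p (Y n)) \<longlonglongrightarrow> 0"
    using tendsto_add[OF assms[unfolded padic_null_def]] by simp
  then show ?thesis unfolding padic_null_def
    by (rule Lim_null_comparison[rotated]) (simp add: padic_abs_triangle[OF p])
qed

lemma padic_null_minus_iff [simp]: "padic_null p (\<lambda>n. - X n) \<longleftrightarrow> padic_null p X"
  by (simp add: padic_null_def)

lemma padic_null_0 [simp]: "padic_null p (\<lambda>n. 0)"
  by (simp add: padic_null_def)

lemma padic_null_const [simp]: "padic_null p (\<lambda>n. c) \<longleftrightarrow> c = 0"
  by (simp add: padic_null_def p LIMSEQ_const_iff)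

lemma padic_null_cauchy: assumes "padic_null p X" shows "padic_cauchy p X"
  unfolding padic_cauchy_def
proof (intro allI impI)
  fix e :: real assume "e > 0"
  then obtain N where N: "\<And>n. n \<ge> N \<Longrightarrow> padic_abs p (X n) < e"
    using assms unfolding padic_null_def LIMSEQ_def by (auto simp: dist_real_def)
  show "\<exists>N. \<forall>m\<ge>N. \<forall>n\<ge>N. padic_abs p (X m - X n) < e"
  proof (intro exI[of _ N] allI impI)
    fix m n assume "m \<ge> N" "n \<ge> N"
    then show "padic_abs p (X m - X n) < e"
      using N[of m] N[of n] padic_abs_add[OF p, of "X m" "- X n"] by simp
  qed
qed

lemma padic_cauchy_const [simp]: "padic_cauchy p (\<lambda>n. c)"
  by (auto simp: padic_cauchy_def)

lemma padic_cauchy_add: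
  assumes "padic_cauchy p X" "padic_cauchy p Y" shows "padic_cauchy p (\<lambda>n. X n + Y n)"
  unfolding padic_cauchy_def
proof (intro allI impI)
  fix e :: real assume e: "e > 0"
  obtain M where M: "\<forall>m\<ge>M. \<forall>n\<ge>M. padic_abs p (X m - X n) < e"
    using assms(1) e unfolding padic_cauchy_def by blast
  obtain N where N: "\<forall>m\<ge>N. \<forall>n\<ge>N. padic_abs p (Y m - Y n) < e"
    using assms(2) e unfolding padic_cauchy_def by blast
  show "\<exists>N. \<forall>m\<ge>N. \<forall>n\<ge>N. padic_abs p (X m + Y m - (X n + Y n)) < e"
  proof (intro exI[of _ "max M N"] allI impI)
    fix m n assume mn: "m \<ge> max M N" "n \<ge> max M N"
    have "padic_abs p ((X m - X n) + (Y m - Y n)) < e"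
      using padic_abs_add[OF p, of "X m - X n" "Y m - Y n"] M[rule_format, of m n] N[rule_format, of m n] mn
      by simp
    then show "padic_abs p (X m + Y m - (X n + Y n)) < e" by (simp add: algebra_simps)
  qed
qed

lemma padic_cauchy_minus [simp]: "padic_cauchy p (\<lambda>n. - X n) \<longleftrightarrow> padic_cauchy p X"
proof -
  have "- X m - - X n = X n - X m" for m n by simp
  then show ?thesis unfolding padic_cauchy_def by (metis padic_abs_minus_commute)
qed

lemma padic_null_mult:
  assumes X: "padic_cauchy p X" and Y: "padic_null p Y"
  shows "padic_null p (\<lambda>n. X n * Y n)"
proof -
  obtain B where B: "B > 0" "\<forall>n. padic_abs p (X n) \<le> B"
    using padic_cauchy_bounded[OF X] by auto
  have "(\<lambda>n. B * padic_abs p (Y n)) \<longlonglongrightarrow> 0"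
    using tendsto_mult_left[OF Y[unfolded padic_null_def], of B] by simp
  then show ?thesis unfolding padic_null_def
    by (rule Lim_null_comparison[rotated])
       (simp add: padic_abs_mult[OF p] B mult_right_mono)
qed

lemma padic_cauchy_mult:
  assumes X: "padic_cauchy p X" and Y: "padic_cauchy p Y"
  shows "padic_cauchy p (\<lambda>n. X n * Y n)"
  unfolding padic_cauchy_def
proof (intro allI impI)
  fix e :: real assume e: "e > 0"
  obtain A where A: "A > 0" "\<forall>n. padic_abs p (X n) \<le> A"
    using padic_cauchy_bounded[OF X] by auto
  obtain B where B: "B > 0" "\<forall>n. padic_abs p (Y n) \<le> B"
    using padic_cauchy_bounded[OF Y] by auto
  obtain M where M: "\<forall>m\<ge>M. \<forall>n\<ge>M. padic_abs p (X m - X n) < e / B"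
    using X e B unfolding padic_cauchy_def by (meson divide_pos_pos)
  obtain N where N: "\<forall>m\<ge>N. \<forall>n\<ge>N. padic_abs p (Y m - Y n) < e / A"
    using Y e A unfolding padic_cauchy_def by (meson divide_pos_pos)
  show "\<exists>N. \<forall>m\<ge>N. \<forall>n\<ge>N. padic_abs p (X m * Y m - X n * Y n) < e"
  proof (intro exI[of _ "max M N"] allI impI)
    fix m n assume mn: "m \<ge> max M N" "n \<ge> max M N"
    have "padic_abs p (X m * (Y m - Y n)) \<le> A * padic_abs p (Y m - Y n)"
      using A by (simp add: padic_abs_mult[OF p] mult_right_mono)
    also have "\<dots> < e" using N mn A by (simp add: field_simps)
    finally have 1: "padic_abs p (X m * (Y m - Y n)) < e" .
    have "padic_abs p ((X m - X n) * Y n) \<le> padic_abs p (X m - X n) * B"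
      using B by (simp add: padic_abs_mult[OF p] mult_left_mono)
    also have "\<dots> < e" using M mn B by (simp add: field_simps)
    finally have 2: "padic_abs p ((X m - X n) * Y n) < e" .
    have "X m * Y m - X n * Y n = X m * (Y m - Y n) + (X m - X n) * Y n"
      by (simp add: algebra_simps)
    then show "padic_abs p (X m * Y m - X n * Y n) < e"
      using padic_abs_add[OF p, of "X m * (Y m - Y n)" "(X m - X n) * Y n"] 1 2
      by simp
  qed
qed

lemma padic_not_null_bound:
  assumes X: "padic_cauchy p X" "\<not> padic_null p X"
  shows "\<exists>b>0. \<exists>N. \<forall>n\<ge>N. padic_abs p (X n) > b"
proof -
  obtain l where l: "(\<lambda>n. padic_abs p (X n)) \<longlonglongrightarrow> l"
    using padic_cauchy_conv[OF X(1)] unfolding convergent_def by blast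
  have "l \<ge> 0" using l by (rule LIMSEQ_le_const) auto
  moreover have "l \<noteq> 0" using l X(2) unfolding padic_null_def by blast
  ultimately have "l / 2 > 0" "l / 2 < l" by auto
  moreover have "eventually (\<lambda>n. l / 2 < padic_abs p (X n)) sequentially"
    using l \<open>l / 2 < l\<close> by (rule order_tendstoD)
  ultimately show ?thesis unfolding eventually_sequentially by (intro exI[of _ "l / 2"]) simp
qed

lemma padic_cauchy_inverse:
  assumes X: "padic_cauchy p X" "\<not> padic_null p X"
  shows "padic_cauchy p (\<lambda>n. inverse (X n))"
  unfolding padic_cauchy_def
proof (intro allI impI)
  fix e :: real assume e: "e > 0"
  obtain b N where b: "b > 0" "\<forall>n\<ge>N. padic_abs p (X n) > b"
    using padic_not_null_bound[OF X] by auto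
  obtain M where M: "\<forall>m\<ge>M. \<forall>n\<ge>M. padic_abs p (X m - X n) < b * e * b"
    using X(1) e b unfolding padic_cauchy_def by (meson mult_pos_pos)
  show "\<exists>N. \<forall>m\<ge>N. \<forall>n\<ge>N. padic_abs p (inverse (X m) - inverse (X n)) < e"
  proof (intro exI[of _ "max M N"] allI impI)
    fix m n assume mn: "m \<ge> max M N" "n \<ge> max M N"
    have bb: "padic_abs p (X m) > b" "padic_abs p (X n) > b" using b(2) mn by simp_all
    have nz: "X m \<noteq> 0" "X n \<noteq> 0" using bb b(1) by auto
    have "inverse (X m) - inverse (X n) = inverse (X m) * (X n - X m) * inverse (X n)"
      using nz by (simp add: field_simps)
    then have "padic_abs p (inverse (X m) - inverse (X n))
      = inverse (padic_abs p (X m)) * padic_abs p (X n - X m) * inverse (padic_abs p (X n))"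
      by (simp add: padic_abs_mult[OF p] padic_abs_inverse[OF p])
    also have "\<dots> \<le> inverse b * padic_abs p (X n - X m) * inverse b"
      using bb b(1) by (intro mult_mono le_imp_inverse_le) auto
    also have "\<dots> < e" using M mn b(1) by (simp add: field_simps)
    finally show "padic_abs p (inverse (X m) - inverse (X n)) < e" .
  qed
qed

end

definition padic_rel :: "'p::prime_card itself \<Rightarrow> (nat \<Rightarrow> rat) \<Rightarrow> (nat \<Rightarrow> rat) \<Rightarrow> bool" where
  "padic_rel _ X Y \<longleftrightarrow> padic_cauchy CARD('p) X \<and> padic_cauchy CARD('p) Y \<and>
     padic_null CARD('p) (\<lambda>n. X n - Y n)"

lemma padic_rel_sym: "padic_rel TYPE('p::prime_card) X Y \<Longrightarrow> padic_rel TYPE('p) Y X"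
  by (simp add: padic_rel_def padic_null_def padic_abs_minus_commute)

lemma padic_rel_trans:
  assumes XY: "padic_rel TYPE('p::prime_card) X Y" and YZ: "padic_rel TYPE('p) Y Z"
  shows "padic_rel TYPE('p) X Z"
proof -
  have "padic_null CARD('p) (\<lambda>n. (X n - Y n) + (Y n - Z n))"
    using XY YZ by (intro padic_null_add[OF prime_card]) (simp_all add: padic_rel_def)
  then show ?thesis using XY YZ by (simp add: padic_rel_def)
qed

typedef (overloaded) ('p::prime_card) padic =
  "{S. \<exists>X. padic_cauchy CARD('p) X \<and> S = Collect (padic_rel TYPE('p) X)}"
  by (rule exI, rule CollectI, rule exI[of _ "\<lambda>_. 0"]) (simp add: prime_card)

definition Padic :: "(nat \<Rightarrow> rat) \<Rightarrow> 'p::prime_card padic" where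
  "Padic X = Abs_padic (Collect (padic_rel TYPE('p) X))"

definition padic_rep :: "'p::prime_card padic \<Rightarrow> nat \<Rightarrow> rat" where
  "padic_rep x = (SOME X. X \<in> Rep_padic x)"

abbreviation "pcauchy (_ :: 'p::prime_card itself) \<equiv> padic_cauchy CARD('p)"
abbreviation "pnull (_ :: 'p::prime_card itself) \<equiv> padic_null CARD('p)"
abbreviation "pabs (_ :: 'p::prime_card itself) \<equiv> padic_abs CARD('p)"

lemma padic_rel_rep_Padic:
  assumes "pcauchy TYPE('p::prime_card) X"
  shows "padic_rel TYPE('p) X (padic_rep (Padic X :: 'p padic))"
proof -
  have R: "Rep_padic (Padic X :: 'p padic) = Collect (padic_rel TYPE('p) X)"
    unfolding Padic_def using assms by (intro Abs_padic_inverse) auto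
  then have "X \<in> Rep_padic (Padic X :: 'p padic)"
    using assms by (simp add: padic_rel_def padic_null_0[OF prime_card])
  then have "padic_rep (Padic X :: 'p padic) \<in> Rep_padic (Padic X :: 'p padic)"
    unfolding padic_rep_def by (rule someI[where P = "\<lambda>Z. Z \<in> Rep_padic (Padic X :: 'p padic)"])
  with R show ?thesis by simp
qed

lemma eq_Padic_iff:
  assumes "pcauchy TYPE('p::prime_card) X" "pcauchy TYPE('p) Y"
  shows "(Padic X :: 'p padic) = Padic Y \<longleftrightarrow> pnull TYPE('p) (\<lambda>n. X n - Y n)"
proof
  assume eq: "(Padic X :: 'p padic) = Padic Y"
  have "padic_rel TYPE('p) X (padic_rep (Padic X :: 'p padic))"
    by (rule padic_rel_rep_Padic[OF assms(1)])
  moreover have "padic_rel TYPE('p) (padic_rep (Padic X :: 'p padic)) Y"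
    unfolding eq by (rule padic_rel_sym[OF padic_rel_rep_Padic[OF assms(2)]])
  ultimately have "padic_rel TYPE('p) X Y" by (rule padic_rel_trans)
  then show "pnull TYPE('p) (\<lambda>n. X n - Y n)" by (simp add: padic_rel_def)
next
  assume "pnull TYPE('p) (\<lambda>n. X n - Y n)"
  then have XY: "padic_rel TYPE('p) X Y" using assms by (simp add: padic_rel_def)
  have "padic_rel TYPE('p) X Z \<longleftrightarrow> padic_rel TYPE('p) Y Z" for Z
    using padic_rel_trans[OF XY, of Z] padic_rel_trans[OF padic_rel_sym[OF XY], of Z] by iprover
  then have "padic_rel TYPE('p) X = padic_rel TYPE('p) Y" by (rule ext)
  then show "(Padic X :: 'p padic) = Padic Y" by (simp add: Padic_def)
qed

lemma Padic_cases [cases type: padic]: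
  fixes x :: "'p::prime_card padic"
  obtains X where "x = Padic X" "pcauchy TYPE('p) X"
  by (cases x) (auto simp: Padic_def)

lemma padic_rep_Padic:
  assumes "pcauchy TYPE('p::prime_card) X"
  shows "pcauchy TYPE('p) (padic_rep (Padic X :: 'p padic))"
    and "pnull TYPE('p) (\<lambda>n. padic_rep (Padic X :: 'p padic) n - X n)"
  using padic_rel_sym[OF padic_rel_rep_Padic[OF assms]] by (auto simp: padic_rel_def)

lemma padic_cauchy_rep: "pcauchy TYPE('p) (padic_rep (x :: 'p::prime_card padic))"
  using padic_rep_Padic(1) by (cases x) blast

lemma Padic_rep: "Padic (padic_rep x) = (x :: 'p::prime_card padic)"
proof -
  obtain X where X: "x = Padic X" "pcauchy TYPE('p) X" by (cases x)
  show ?thesis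
    unfolding X(1) by (subst eq_Padic_iff) (intro padic_rep_Padic X(2))+
qed

instantiation padic :: (prime_card) field
begin

definition "0 = Padic (\<lambda>_. 0)"
definition "1 = Padic (\<lambda>_. 1)"
definition "x + y = Padic (\<lambda>n. padic_rep x n + padic_rep y n)"
definition "- x = Padic (\<lambda>n. - padic_rep x n)"
definition "x * y = Padic (\<lambda>n. padic_rep x n * padic_rep y n)"
definition "inverse x = (if x = 0 then 0 else Padic (\<lambda>n. inverse (padic_rep x n)))"
definition "x - y = x + - y" for x y :: "'a padic"
definition "x div y = x * inverse y" for x y :: "'a padic"

lemmas padic_intros =
  padic_cauchy_add[OF prime_card] padic_cauchy_mult[OF prime_card]
  padic_cauchy_const[OF prime_card]

lemma add_Padic:
  assumes "pcauchy TYPE('a) X" "pcauchy TYPE('a) Y"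
  shows "(Padic X :: 'a padic) + Padic Y = Padic (\<lambda>n. X n + Y n)"
  unfolding plus_padic_def
  using padic_null_add[OF prime_card padic_rep_Padic(2)[OF assms(1)] padic_rep_Padic(2)[OF assms(2)]]
  by (subst eq_Padic_iff) (auto intro!: padic_intros padic_rep_Padic assms simp: algebra_simps)

lemma minus_Padic:
  assumes "pcauchy TYPE('a) X"
  shows "- (Padic X :: 'a padic) = Padic (\<lambda>n. - X n)"
proof -
  let ?Y = "padic_rep (Padic X :: 'a padic)"
  note Y = padic_rep_Padic[OF assms]
  have "- ?Y n - - X n = - (?Y n - X n)" for n by simp
  then have "pnull TYPE('a) (\<lambda>n. - ?Y n - - X n)"
    using Y(2) by (simp only: padic_null_minus_iff[OF prime_card])
  then show ?thesis
    unfolding uminus_padic_def using Y(1) assms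
    by (subst eq_Padic_iff) (simp_all only: padic_cauchy_minus[OF prime_card])
qed

lemma mult_Padic:
  assumes "pcauchy TYPE('a) X" "pcauchy TYPE('a) Y"
  shows "(Padic X :: 'a padic) * Padic Y = Padic (\<lambda>n. X n * Y n)"
proof -
  let ?X = "padic_rep (Padic X :: 'a padic)" and ?Y = "padic_rep (Padic Y :: 'a padic)"
  note * = padic_rep_Padic[OF assms(1)] padic_rep_Padic[OF assms(2)]
  have "pnull TYPE('a) (\<lambda>n. ?X n * (?Y n - Y n) + Y n * (?X n - X n))"
    by (intro padic_null_add[OF prime_card] padic_null_mult[OF prime_card] * assms)
  then have "pnull TYPE('a) (\<lambda>n. ?X n * ?Y n - X n * Y n)"
    by (simp add: algebra_simps)
  then show ?thesis
    unfolding times_padic_def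
    by (subst eq_Padic_iff) (auto intro!: padic_intros * assms)
qed

lemma Padic_eq_0_iff:
  assumes "pcauchy TYPE('a) X"
  shows "(Padic X :: 'a padic) = 0 \<longleftrightarrow> pnull TYPE('a) X"
  unfolding zero_padic_def using assms by (subst eq_Padic_iff) (auto simp: prime_card)

lemma inverse_Padic_mult:
  fixes x :: "'a padic"
  assumes "x \<noteq> 0"
  shows "inverse x * x = 1"
proof -
  define Y where "Y = padic_rep x"
  have Y: "pcauchy TYPE('a) Y" "x = Padic Y"
    unfolding Y_def by (simp_all only: padic_cauchy_rep Padic_rep)
  have nn: "\<not> pnull TYPE('a) Y" using assms unfolding Y(2) Padic_eq_0_iff[OF Y(1)] .
  have "inverse x * x = Padic (\<lambda>n. inverse (Y n)) * Padic Y"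
    unfolding inverse_padic_def if_not_P[OF assms] Y_def Padic_rep ..
  also have "\<dots> = Padic (\<lambda>n. inverse (Y n) * Y n)"
    by (intro mult_Padic padic_cauchy_inverse[OF prime_card] Y nn)
  also have "\<dots> = 1"
    unfolding one_padic_def
  proof (subst eq_Padic_iff)
    obtain b N where b: "b > 0" "\<forall>n\<ge>N. pabs TYPE('a) (Y n) > b"
      using padic_not_null_bound[OF prime_card Y(1) nn] by auto
    have "inverse (Y n) * Y n - 1 = 0" if "n \<ge> N" for n
    proof -
      have "Y n \<noteq> 0" using b(1) b(2)[rule_format, OF that] by auto
      then show ?thesis by simp
    qed
    then have "eventually (\<lambda>n. pabs TYPE('a) (inverse (Y n) * Y n - 1) = 0) sequentially"
      unfolding eventually_sequentially by (intro exI[of _ N]) auto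
    then show "pnull TYPE('a) (\<lambda>n. inverse (Y n) * Y n - 1)"
      unfolding padic_null_def by (rule tendsto_eventually)
  qed (auto intro!: padic_intros padic_cauchy_inverse[OF prime_card] Y nn)
  finally show ?thesis .
qed

instance
proof
  fix a b c :: "'a padic"
  obtain A where A: "a = Padic A" "pcauchy TYPE('a) A" by (cases a)
  obtain B where B: "b = Padic B" "pcauchy TYPE('a) B" by (cases b)
  obtain C where C: "c = Padic C" "pcauchy TYPE('a) C" by (cases c)
  note S = A B C add_Padic mult_Padic minus_Padic padic_intros zero_padic_def one_padic_def
  show "a + b + c = a + (b + c)" by (simp add: S add.assoc)
  show "a + b = b + a" by (simp add: S add.commute)
  show "0 + a = a" by (simp add: S)
  show "- a + a = 0" by (simp add: S prime_card)
  show "a - b = a + - b" by (rule minus_padic_def)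
  show "a * b * c = a * (b * c)" by (simp add: S mult.assoc)
  show "a * b = b * a" by (simp add: S mult.commute)
  show "1 * a = a" by (simp add: S)
  show "(a + b) * c = a * c + b * c" by (simp add: S distrib_right)
  show "(0 :: 'a padic) \<noteq> 1"
    using Padic_eq_0_iff[of "\<lambda>_. 1"] by (simp add: one_padic_def prime_card)
  show "a \<noteq> 0 \<Longrightarrow> inverse a * a = 1" by (rule inverse_Padic_mult)
  show "a div b = a * inverse b" by (rule divide_padic_def)
  show "inverse (0 :: 'a padic) = 0" by (simp add: inverse_padic_def)
qed

end

lemma of_nat_padic: "(of_nat n :: 'p::prime_card padic) = Padic (\<lambda>_. of_nat n)"
  by (induction n) (simp_all add: zero_padic_def one_padic_def add_Padic prime_card)

instance padic :: (prime_card) field_char_0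
proof
  show "inj (of_nat :: nat \<Rightarrow> 'a padic)"
    by (rule injI) (simp add: of_nat_padic eq_Padic_iff prime_card)
qed

lemma of_int_padic: "(of_int k :: 'p::prime_card padic) = Padic (\<lambda>_. of_int k)"
  by (cases k rule: int_cases2) (simp_all add: of_nat_padic minus_Padic prime_card)

lemma of_rat_padic: "(of_rat r :: 'p::prime_card padic) = Padic (\<lambda>_. r)"
proof -
  obtain a b where r: "r = of_int a / of_int b" "b \<noteq> 0" by (rule rat_frac_cases)
  have "(Padic (\<lambda>_. r) :: 'p padic) * of_int b = of_int a"
    using r by (simp add: of_int_padic mult_Padic prime_card)
  then have "Padic (\<lambda>_. r) = (of_int a / of_int b :: 'p padic)"
    using r(2) by (simp add: field_simps)
  then show ?thesis by (simp add: r(1) of_rat_divide)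
qed


subsection \<open>Absolute value, metric and completeness\<close>

definition padic_norm :: "'p::prime_card padic \<Rightarrow> real" where
  "padic_norm x = lim (\<lambda>n. pabs TYPE('p) (padic_rep x n))"

lemma padic_norm_Padic:
  assumes "pcauchy TYPE('p) X"
  shows "(\<lambda>n. pabs TYPE('p) (X n)) \<longlonglongrightarrow> padic_norm (Padic X :: 'p::prime_card padic)"
proof -
  let ?Y = "padic_rep (Padic X :: 'p::prime_card padic)"
  note Y = padic_rep_Padic[OF assms]
  have "(\<lambda>n. pabs TYPE('p) (?Y n)) \<longlonglongrightarrow> padic_norm (Padic X :: 'p::prime_card padic)"
    unfolding padic_norm_def
    using padic_cauchy_conv[OF prime_card Y(1)] by (simp add: convergent_LIMSEQ_iff)
  moreover have "(\<lambda>n. pabs TYPE('p) (?Y n) - pabs TYPE('p) (X n)) \<longlonglongrightarrow> 0"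
    using Y(2) unfolding padic_null_def
    by (rule Lim_null_comparison[rotated]) (simp add: padic_abs_diff prime_card)
  ultimately show ?thesis by (rule Lim_transform2)
qed

lemma padic_norm_eqI:
  "pcauchy TYPE('p) X \<Longrightarrow> (\<lambda>n. pabs TYPE('p) (X n)) \<longlonglongrightarrow> l \<Longrightarrow>
    padic_norm (Padic X :: 'p::prime_card padic) = l"
  using padic_norm_Padic LIMSEQ_unique by blast

lemma padic_norm_ultra: "padic_norm (x + y) \<le> max (padic_norm x) (padic_norm (y :: 'p::prime_card padic))"
proof -
  obtain X where X: "x = Padic X" "pcauchy TYPE('p) X" by (cases x)
  obtain Y where Y: "y = Padic Y" "pcauchy TYPE('p) Y" by (cases y)
  have "(\<lambda>n. pabs TYPE('p) (X n + Y n)) \<longlonglongrightarrow> padic_norm (x + y)"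
    unfolding X Y add_Padic[OF X(2) Y(2)] by (intro padic_norm_Padic padic_intros X Y)
  moreover have "(\<lambda>n. max (pabs TYPE('p) (X n)) (pabs TYPE('p) (Y n))) \<longlonglongrightarrow>
      max (padic_norm x) (padic_norm y)"
    unfolding X Y by (intro tendsto_max padic_norm_Padic X Y)
  ultimately show ?thesis
    by (rule LIMSEQ_le) (simp add: padic_abs_add prime_card)
qed

lemma padic_norm_nonneg: "padic_norm (x :: 'p::prime_card padic) \<ge> 0"
proof -
  obtain X where X: "x = Padic X" "pcauchy TYPE('p) X" by (cases x)
  show ?thesis unfolding X(1) using padic_norm_Padic[OF X(2)] by (rule LIMSEQ_le_const) auto
qed

lemma padic_norm_eq_0_iff: "padic_norm x = 0 \<longleftrightarrow> (x :: 'p::prime_card padic) = 0"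
proof -
  obtain X where X: "x = Padic X" "pcauchy TYPE('p) X" by (cases x)
  show ?thesis
    unfolding X(1) Padic_eq_0_iff[OF X(2)]
    unfolding padic_null_def using padic_norm_Padic[OF X(2)] padic_norm_eqI[OF X(2)] by metis
qed

lemma padic_norm_uminus: "padic_norm (- x) = padic_norm (x :: 'p::prime_card padic)"
proof -
  obtain X where X: "x = Padic X" "pcauchy TYPE('p) X" by (cases x)
  show ?thesis
    unfolding X(1) minus_Padic[OF X(2)] using padic_norm_Padic[OF X(2)] X(2)
    by (intro padic_norm_eqI) (auto simp: prime_card)
qed

instantiation padic :: (prime_card) metric_space
begin

definition dist_padic_def: "dist x y = padic_norm (x - y)" for x y :: "'a padic"

definition uniformity_padic_def:
  "(uniformity :: ('a padic \<times> 'a padic) filter) = (INF e\<in>{0 <..}. principal {(x, y). dist x y < e})"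

definition open_padic_def:
  "open U \<longleftrightarrow> (\<forall>x\<in>U. eventually (\<lambda>(x', y). x' = x \<longrightarrow> y \<in> U) uniformity)"
  for U :: "'a padic set"

instance
proof
  show "(uniformity :: ('a padic \<times> 'a padic) filter) = (INF e\<in>{0 <..}. principal {(x, y). dist x y < e})"
    by (rule uniformity_padic_def)
  show "open U \<longleftrightarrow> (\<forall>x\<in>U. eventually (\<lambda>(x', y). x' = x \<longrightarrow> y \<in> U) uniformity)"
    for U :: "'a padic set" by (rule open_padic_def)
  show "dist x y = 0 \<longleftrightarrow> x = y" for x y :: "'a padic"
    by (simp add: dist_padic_def padic_norm_eq_0_iff)
  show "dist x y \<le> dist x z + dist y z" for x y z :: "'a padic"
    using padic_norm_ultra[of "x - z" "z - y"] padic_norm_uminus[of "y - z"]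
      padic_norm_nonneg[of "x - z"] padic_norm_nonneg[of "y - z"]
    by (simp add: dist_padic_def)
qed

end

lemma padic_norm_mult: "padic_norm (x * y) = padic_norm x * padic_norm (y :: 'p::prime_card padic)"
proof -
  obtain X where X: "x = Padic X" "pcauchy TYPE('p) X" by (cases x)
  obtain Y where Y: "y = Padic Y" "pcauchy TYPE('p) Y" by (cases y)
  have "(\<lambda>n. pabs TYPE('p) (X n) * pabs TYPE('p) (Y n)) \<longlonglongrightarrow> padic_norm x * padic_norm y"
    unfolding X Y by (intro tendsto_mult padic_norm_Padic X Y)
  then have "(\<lambda>n. pabs TYPE('p) (X n * Y n)) \<longlonglongrightarrow> padic_norm x * padic_norm y"
    by (simp add: padic_abs_mult prime_card)
  then show ?thesis
    unfolding X(1) Y(1) mult_Padic[OF X(2) Y(2)]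
    by (intro padic_norm_eqI padic_intros X Y)
qed

text \<open>The next two facts and completeness identify the type as the completion of the rationals with
  respect to the p-adic absolute value.\<close>

lemma padic_norm_of_rat: "padic_norm (of_rat r :: 'p::prime_card padic) = pabs TYPE('p) r"
  unfolding of_rat_padic by (rule padic_norm_eqI) (simp_all add: prime_card)

lemma padic_rat_dense:
  fixes x :: "'p::prime_card padic"
  assumes "e > 0"
  shows "\<exists>r. dist x (of_rat r) < e"
proof -
  obtain X where X: "x = Padic X" "pcauchy TYPE('p) X" by (cases x)
  obtain N where N: "\<forall>m\<ge>N. \<forall>n\<ge>N. pabs TYPE('p) (X m - X n) < e / 2"
    using X(2) assms unfolding padic_cauchy_def by (meson half_gt_zero)
  have diff: "x - of_rat (X N) = Padic (\<lambda>n. X n + - X N)"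
    unfolding diff_conv_add_uminus of_rat_padic X(1)
    by (simp only: minus_Padic add_Padic X(2) padic_cauchy_const[OF prime_card])
  have "(\<lambda>n. pabs TYPE('p) (X n + - X N)) \<longlonglongrightarrow> dist x (of_rat (X N))"
    unfolding dist_padic_def diff
    by (intro padic_norm_Padic padic_intros X)
  then have "dist x (of_rat (X N)) \<le> e / 2"
    by (rule LIMSEQ_le_const2) (use N in \<open>auto intro!: exI[of _ N] less_imp_le\<close>)
  then show ?thesis using assms by (intro exI[of _ "X N"]) simp
qed

instance padic :: (prime_card) complete_space
proof
  fix x :: "nat \<Rightarrow> 'a padic"
  assume x: "Cauchy x"
  have "\<forall>n. \<exists>r. dist (x n) (of_rat r) < inverse (real (Suc n))"
    by (intro allI padic_rat_dense) simp
  then obtain r where r: "\<forall>n. dist (x n) (of_rat (r n)) < inverse (real (Suc n))"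
    unfolding choice_iff by (elim exE)
  have lim0: "(\<lambda>n. dist (x n) (of_rat (r n))) \<longlonglongrightarrow> 0"
  proof (rule Lim_null_comparison[OF _ LIMSEQ_inverse_real_of_nat], rule always_eventually, rule allI)
    show "norm (dist (x n) (of_rat (r n))) \<le> inverse (real (Suc n))" for n
      using r[rule_format, of n] by (simp del: of_nat_Suc)
  qed
  have C: "pcauchy TYPE('a) r"
    unfolding padic_cauchy_def
  proof (intro allI impI)
    fix e :: real assume e: "e > 0"
    have e3: "e / 3 > 0" using e by simp
    obtain M where M: "\<forall>m\<ge>M. \<forall>n\<ge>M. dist (x m) (x n) < e / 3"
      using metric_CauchyD[OF x e3] by blast
    obtain N where N: "\<forall>n\<ge>N. dist (x n) (of_rat (r n)) < e / 3"
      using order_tendstoD(2)[OF lim0 e3] unfolding eventually_sequentially by blast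
    show "\<exists>N. \<forall>m\<ge>N. \<forall>n\<ge>N. pabs TYPE('a) (r m - r n) < e"
    proof (intro exI[of _ "max M N"] allI impI)
      fix m n assume mn: "m \<ge> max M N" "n \<ge> max M N"
      have "pabs TYPE('a) (r m - r n) = dist (of_rat (r m)) (of_rat (r n) :: 'a padic)"
        by (simp add: dist_padic_def padic_norm_of_rat flip: of_rat_diff)
      also have "\<dots> \<le> dist (x m) (of_rat (r m)) + dist (x m) (x n) + dist (x n) (of_rat (r n))"
        using dist_triangle[of "of_rat (r m)" "of_rat (r n)" "x m"]
          dist_triangle[of "x m" "of_rat (r n)" "x n"] by (simp add: dist_commute)
      also have "\<dots> < e / 3 + e / 3 + e / 3"
        using M[rule_format, of m n] N[rule_format, of m] N[rule_format, of n] mn by simp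
      finally show "pabs TYPE('a) (r m - r n) < e" by simp
    qed
  qed
  define L :: "'a padic" where "L = Padic r"
  have limL: "(\<lambda>n. dist (of_rat (r n)) L) \<longlonglongrightarrow> 0"
    unfolding LIMSEQ_def
  proof (intro allI impI)
    fix e :: real assume e: "e > 0"
    obtain N where N: "\<forall>m\<ge>N. \<forall>n\<ge>N. pabs TYPE('a) (r m - r n) < e / 2"
      using C half_gt_zero[OF e] unfolding padic_cauchy_def by blast
    have "dist (dist (of_rat (r n)) L) 0 < e" if n: "n \<ge> N" for n
    proof -
      have diff: "L - of_rat (r n) = Padic (\<lambda>k. r k + - r n)"
        unfolding diff_conv_add_uminus of_rat_padic L_def
        by (simp only: minus_Padic add_Padic C padic_cauchy_const[OF prime_card])
      have "(\<lambda>k. pabs TYPE('a) (r k + - r n)) \<longlonglongrightarrow> dist L (of_rat (r n))"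
        unfolding dist_padic_def diff by (intro padic_norm_Padic padic_intros C)
      moreover have "\<forall>k\<ge>N. pabs TYPE('a) (r k + - r n) \<le> e / 2"
        using N n by (simp add: less_imp_le)
      ultimately have "dist L (of_rat (r n)) \<le> e / 2"
        by (intro LIMSEQ_le_const2 exI[of _ N])
      then have "dist L (of_rat (r n)) < e" using e by linarith
      then show ?thesis by (simp add: dist_real_def dist_commute[of L])
    qed
    then show "\<exists>N. \<forall>n\<ge>N. dist (dist (of_rat (r n)) L) 0 < e" by iprover
  qed
  have sum0: "(\<lambda>n. dist (x n) (of_rat (r n)) + dist (of_rat (r n)) L) \<longlonglongrightarrow> 0"
    using tendsto_add[OF lim0 limL] by (simp only: add_0_right)
  have le: "\<forall>n. norm (dist (x n) L) \<le> dist (x n) (of_rat (r n)) + dist (of_rat (r n)) L"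
    by (simp only: real_norm_def abs_of_nonneg zero_le_dist dist_triangle simp_thms)
  have "(\<lambda>n. dist (x n) L) \<longlonglongrightarrow> 0"
    by (rule Lim_null_comparison[OF always_eventually[OF le] sum0])
  then have "x \<longlonglongrightarrow> L" by (rule iffD2[OF tendsto_dist_iff])
  then show "convergent x" by (rule convergentI)
qed

definition padic_integers :: "'p::prime_card padic set" where
  "padic_integers = {x. padic_norm x \<le> 1}"


section \<open>Locally convex spaces over the p-adic numbers\<close>

text \<open>A topological vector space is a Hausdorff vector topology on a linear subspace of an
  ambient vector space.  The ambient space lets function spaces on a subset be treated as
  spaces of functions vanishing off that subset, with pointwise operations.\<close>

definition tvs_on :: "('p::prime_card padic \<Rightarrow> 'v::ab_group_add \<Rightarrow> 'v) \<Rightarrow> 'v topology \<Rightarrow> bool" where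
  "tvs_on sc T \<longleftrightarrow>
     vector_space sc \<and> module.subspace sc (topspace T) \<and> Hausdorff_space T \<and>
     continuous_map (prod_topology T T) T (\<lambda>(x, y). x + y) \<and>
     continuous_map (prod_topology euclidean T) T (\<lambda>(c, x). sc c x)"

definition tvs_isomorphism ::
  "('p::prime_card padic \<Rightarrow> 'v::ab_group_add \<Rightarrow> 'v) \<Rightarrow> 'v topology \<Rightarrow>
   ('p padic \<Rightarrow> 'w::ab_group_add \<Rightarrow> 'w) \<Rightarrow> 'w topology \<Rightarrow> ('v \<Rightarrow> 'w) \<Rightarrow> bool" where
  "tvs_isomorphism sc\<^sub>1 T\<^sub>1 sc\<^sub>2 T\<^sub>2 A \<longleftrightarrow>
     tvs_on sc\<^sub>1 T\<^sub>1 \<and> tvs_on sc\<^sub>2 T\<^sub>2 \<and> homeomorphic_map T\<^sub>1 T\<^sub>2 A \<and>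
     (\<forall>x\<in>topspace T\<^sub>1. \<forall>y\<in>topspace T\<^sub>1. A (x + y) = A x + A y) \<and>
     (\<forall>c. \<forall>x\<in>topspace T\<^sub>1. A (sc\<^sub>1 c x) = sc\<^sub>2 c (A x))"

definition ultrametric_seminorm ::
  "('p::prime_card padic \<Rightarrow> 'v::ab_group_add \<Rightarrow> 'v) \<Rightarrow> ('v \<Rightarrow> real) \<Rightarrow> bool" where
  "ultrametric_seminorm sc q \<longleftrightarrow>
     (\<forall>x. 0 \<le> q x) \<and> (\<forall>c x. q (sc c x) = padic_norm c * q x) \<and>
     (\<forall>x y. q (x + y) \<le> max (q x) (q y))"

definition seminorm_topology :: "'v::ab_group_add set \<Rightarrow> ('v \<Rightarrow> real) set \<Rightarrow> 'v topology" where
  "seminorm_topology S Q = topology_generated_by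
     (insert S {{y \<in> S. q (y - x) < \<epsilon>} | q x \<epsilon>. q \<in> Q \<and> x \<in> S \<and> 0 < \<epsilon>})"

definition locally_convex ::
  "('p::prime_card padic \<Rightarrow> 'e::{ab_group_add, topological_space} \<Rightarrow> 'e) \<Rightarrow> bool" where
  "locally_convex sc \<longleftrightarrow> tvs_on sc euclidean \<and>
     (\<exists>Q. (\<forall>q\<in>Q. ultrametric_seminorm sc q) \<and> euclidean = seminorm_topology UNIV Q)"

definition sequentially_complete :: "'e::{ab_group_add, topological_space} itself \<Rightarrow> bool" where
  "sequentially_complete _ \<longleftrightarrow>
     (\<forall>X :: nat \<Rightarrow> 'e.
        (\<forall>U. open U \<and> 0 \<in> U \<longrightarrow> (\<exists>N. \<forall>m\<ge>N. \<forall>n\<ge>N. X m - X n \<in> U)) \<longrightarrow> convergent X)"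

definition continuous_seminorms ::
  "('p::prime_card padic \<Rightarrow> 'e::{ab_group_add, topological_space} \<Rightarrow> 'e) \<Rightarrow> ('e \<Rightarrow> real) set" where
  "continuous_seminorms sc = {q. ultrametric_seminorm sc q \<and> continuous_on UNIV q}"

definition pointwise :: "('c \<Rightarrow> 'e \<Rightarrow> 'e) \<Rightarrow> 'c \<Rightarrow> ('x \<Rightarrow> 'e) \<Rightarrow> 'x \<Rightarrow> 'e" where
  "pointwise sc c f = (\<lambda>x. sc c (f x))"


section \<open>Weighted null families\<close>

definition c0_space ::
  "('p::prime_card padic \<Rightarrow> 'e::{ab_group_add, topological_space} \<Rightarrow> 'e) \<Rightarrow> ('x \<Rightarrow> real) \<Rightarrow> ('x \<Rightarrow> 'e) set"
where
  "c0_space sc w = {g. \<forall>q\<in>continuous_seminorms sc. \<forall>\<epsilon>>0.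
     \<exists>\<Phi>. finite \<Phi> \<and> (\<forall>x. x \<notin> \<Phi> \<longrightarrow> w x * q (g x) < \<epsilon>)}"

text \<open>The supremum is over a bounded set whenever \<open>g\<close> lies in the above space.\<close>

definition weighted_seminorm :: "('x \<Rightarrow> real) \<Rightarrow> ('e \<Rightarrow> real) \<Rightarrow> ('x \<Rightarrow> 'e) \<Rightarrow> real" where
  "weighted_seminorm w q g = (SUP x. w x * q (g x))"

definition c0_topology ::
  "('p::prime_card padic \<Rightarrow> 'e::{ab_group_add, topological_space} \<Rightarrow> 'e) \<Rightarrow> ('x \<Rightarrow> real) \<Rightarrow> ('x \<Rightarrow> 'e) topology"
where
  "c0_topology sc w =
     seminorm_topology (c0_space sc w) (weighted_seminorm w ` continuous_seminorms sc)"

text \<open>The weight \<open>\<nu>\<^sup>\<alpha>\<close> has to be positive, so a factor \<open>0\<^sup>a\<close> is read as \<open>1\<close> also for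
  \<open>a > 0\<close>; with the value \<open>0\<close> the seminorms would not see all coefficients.\<close>

definition weight :: "('n::finite \<Rightarrow> nat) \<Rightarrow> ('n \<Rightarrow> nat) \<Rightarrow> real" where
  "weight \<alpha> \<nu> = (\<Prod>i\<in>UNIV. (if \<nu> i = 0 then 1 else real (\<nu> i) ^ \<alpha> i))"


section \<open>Partially differentiable functions\<close>

text \<open>Points of \<open>\<rat>\<^sub>p\<^sup>n\<close> are functions on an index type \<open>'n\<close> with \<open>n\<close> elements.  A cartesian
  set is given by the family \<open>V\<close> of its factors and is \<open>Pi UNIV V\<close>.\<close>

definition cartesian :: "('n \<Rightarrow> 'a::topological_space set) \<Rightarrow> bool" where
  "cartesian V \<longleftrightarrow> (\<forall>i x. \<not> x isolated_in V i)"

text \<open>\<open>x i j\<close> is the \<open>j\<close>-th entry of the \<open>i\<close>-th block.  Entries with \<open>j > \<beta> i\<close> are pinned to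
  \<open>undefined\<close>, so that the product topology restricts to that of
  \<open>V\<^sub>1\<^bsup>1+\<beta>\<^sub>1\<^esup> \<times> \<dots> \<times> V\<^sub>n\<^bsup>1+\<beta>\<^sub>n\<^esup>\<close>.\<close>

definition blocks :: "('n \<Rightarrow> 'a set) \<Rightarrow> ('n \<Rightarrow> nat) \<Rightarrow> ('n \<Rightarrow> nat \<Rightarrow> 'a) set" where
  "blocks V \<beta> = {x. \<forall>i. x i \<in> {..\<beta> i} \<rightarrow>\<^sub>E V i}"

definition distinct_blocks :: "('n \<Rightarrow> 'a set) \<Rightarrow> ('n \<Rightarrow> nat) \<Rightarrow> ('n \<Rightarrow> nat \<Rightarrow> 'a) set" where
  "distinct_blocks V \<beta> = {x \<in> blocks V \<beta>. \<forall>i. inj_on (x i) {..\<beta> i}}"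

lemma finite_multiindices_le: "finite {\<mu>. \<mu> \<le> (\<nu> :: 'n::finite \<Rightarrow> nat)}"
proof -
  have "{\<mu>. \<mu> \<le> \<nu>} = Pi\<^sub>E UNIV (\<lambda>i. {..\<nu> i})" by (auto simp: le_fun_def)
  then show ?thesis by (simp add: finite_PiE)
qed

definition divided_difference ::
  "('k::field \<Rightarrow> 'e::ab_group_add \<Rightarrow> 'e) \<Rightarrow> ('n::finite \<Rightarrow> nat) \<Rightarrow> (('n \<Rightarrow> 'k) \<Rightarrow> 'e) \<Rightarrow> ('n \<Rightarrow> nat \<Rightarrow> 'k) \<Rightarrow> 'e"
where
  "divided_difference sc \<beta> f x =
     (\<Sum>j | j \<le> \<beta>. sc (\<Prod>i\<in>UNIV. \<Prod>k\<in>{..\<beta> i} - {j i}. 1 / (x i (j i) - x i k)) (f (\<lambda>i. x i (j i))))"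

definition extends_divided_difference ::
  "('k::{field, topological_space} \<Rightarrow> 'e::{ab_group_add, topological_space} \<Rightarrow> 'e) \<Rightarrow> ('n::finite \<Rightarrow> 'k set) \<Rightarrow>
   ('n \<Rightarrow> nat) \<Rightarrow> (('n \<Rightarrow> 'k) \<Rightarrow> 'e) \<Rightarrow> (('n \<Rightarrow> nat \<Rightarrow> 'k) \<Rightarrow> 'e) \<Rightarrow> bool"
where
  "extends_divided_difference sc V \<beta> f g \<longleftrightarrow>
     continuous_on (blocks V \<beta>) g \<and> (\<forall>x\<in>distinct_blocks V \<beta>. g x = divided_difference sc \<beta> f x)"

definition C_alpha ::
  "('k::{field, topological_space} \<Rightarrow> 'e::{ab_group_add, topological_space} \<Rightarrow> 'e) \<Rightarrow> ('n::finite \<Rightarrow> 'k set) \<Rightarrow>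
   ('n \<Rightarrow> nat) \<Rightarrow> (('n \<Rightarrow> 'k) \<Rightarrow> 'e) \<Rightarrow> bool"
where
  "C_alpha sc V \<alpha> f \<longleftrightarrow> (\<forall>\<beta>\<le>\<alpha>. \<exists>g. extends_divided_difference sc V \<beta> f g)"

text \<open>The continuous extension is unique on \<open>blocks V \<beta>\<close>; it is made total by \<open>0\<close>.\<close>

definition extended_difference ::
  "('k::{field, topological_space} \<Rightarrow> 'e::{ab_group_add, topological_space} \<Rightarrow> 'e) \<Rightarrow> ('n::finite \<Rightarrow> 'k set) \<Rightarrow>
   ('n \<Rightarrow> nat) \<Rightarrow> (('n \<Rightarrow> 'k) \<Rightarrow> 'e) \<Rightarrow> ('n \<Rightarrow> nat \<Rightarrow> 'k) \<Rightarrow> 'e"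
where
  "extended_difference sc V \<beta> f =
     (THE g. extends_divided_difference sc V \<beta> f g \<and> (\<forall>x. x \<notin> blocks V \<beta> \<longrightarrow> g x = 0))"

definition continuous_maps :: "'x::topological_space set \<Rightarrow> ('x \<Rightarrow> 'e::{zero, topological_space}) set" where
  "continuous_maps X = {g. continuous_on X g \<and> (\<forall>x. x \<notin> X \<longrightarrow> g x = 0)}"

definition compact_open_topology ::
  "'x::topological_space set \<Rightarrow> ('x \<Rightarrow> 'e::{zero, topological_space}) topology" where
  "compact_open_topology X = topology_generated_by
     {{g \<in> continuous_maps X. g ` K \<subseteq> U} | K U. compact K \<and> K \<subseteq> X \<and> open U}"

definition C_alpha_space ::
  "('p::prime_card padic \<Rightarrow> 'e::{ab_group_add, topological_space} \<Rightarrow> 'e) \<Rightarrow> ('n::finite \<Rightarrow> nat) \<Rightarrow> (('n \<Rightarrow> 'p padic) \<Rightarrow> 'e) set"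
where
  "C_alpha_space sc \<alpha> = {f. C_alpha sc (\<lambda>_. padic_integers) \<alpha> f \<and>
     (\<forall>x. x \<notin> Pi UNIV (\<lambda>_. padic_integers) \<longrightarrow> f x = 0)}"

definition restriction :: "('n \<Rightarrow> 'k set) \<Rightarrow> (('n \<Rightarrow> 'k) \<Rightarrow> 'e::zero) \<Rightarrow> ('n \<Rightarrow> 'k) \<Rightarrow> 'e" where
  "restriction V f = (\<lambda>x. if x \<in> Pi UNIV V then f x else 0)"

definition C_alpha_topology ::
  "('p::prime_card padic \<Rightarrow> 'e::{ab_group_add, topological_space} \<Rightarrow> 'e) \<Rightarrow> ('n::finite \<Rightarrow> nat) \<Rightarrow>
   (('n \<Rightarrow> 'p padic) \<Rightarrow> 'e) topology"
where
  "C_alpha_topology sc \<alpha> = topology_generated_by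
     {{f \<in> C_alpha_space sc \<alpha>. extended_difference sc V \<beta> (restriction V f) \<in> W} | V \<beta> W.
        \<beta> \<le> \<alpha> \<and> cartesian V \<and>
        openin (top_of_set (Pi UNIV (\<lambda>_. padic_integers))) (Pi UNIV V) \<and>
        openin (compact_open_topology (blocks V \<beta>)) W}"


section \<open>Mahler coefficients\<close>

definition mahler_coeff ::
  "('k::field \<Rightarrow> 'e::ab_group_add \<Rightarrow> 'e) \<Rightarrow> (('n::finite \<Rightarrow> 'k) \<Rightarrow> 'e) \<Rightarrow> ('n \<Rightarrow> nat) \<Rightarrow> 'e" where
  "mahler_coeff sc f \<nu> =
     (\<Sum>\<mu> | \<mu> \<le> \<nu>. sc ((-1) ^ (sum \<nu> UNIV - sum \<mu> UNIV) * of_nat (\<Prod>i\<in>UNIV. \<nu> i choose \<mu> i))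
        (f (\<lambda>i. of_nat (\<mu> i))))"

end

theory Submission
  imports Defs
begin

text \<open>A difference quotient of \<open>x \<mapsto> x gchoose n\<close> is, by the Vandermonde identity, an explicit combination of
  products of binomial coefficients with coefficients \<open>1/j\<close>, \<open>j \<le> n\<close>. Iterating, all divided differences of
  order \<open>k\<close> extend to polynomials that are bounded by \<open>n\<^sup>k\<close> on the p-adic integers, so a weighted null
  family \<open>b\<close> is summed by its Mahler series to a \<open>C\<^sup>\<alpha>\<close> function whose extended difference quotients are
  bounded by the weighted norm of \<open>b\<close>.

  Conversely, write the \<open>n\<close>-th Mahler coefficient as the polynomial \<open>(T - 1)\<^sup>n\<close> in the shift \<open>T\<close>, and let
  \<open>L\<^sub>k\<close> be the integral span of the divided differences of order \<open>k\<close> at distinct natural numbers. Moving the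
  points one at a time shows that \<open>(T\<^sup>h - 1) L\<^sub>k\<close> lies in \<open>h L\<^sub>k\<^sub>+\<^sub>1\<close>, whence
  \<open>(T - 1)\<^sup>n L\<^sub>k\<close> lies in \<open>n L\<^sub>k\<^sub>+\<^sub>1\<close>. With \<open>n\<close> a power of \<open>p\<close> this bounds
  \<open>\<nu>\<^sup>\<alpha> a\<^sub>\<nu>(f)\<close> by the difference quotients of \<open>f\<close>. Since \<open>(T - 1)\<^sup>q\<close> is congruent to
  \<open>T\<^sup>q - 1\<close> modulo \<open>p\<close> for \<open>q\<close> a power of \<open>p\<close>, uniform continuity of the difference quotients improves
  this bound to convergence to zero.\<close>

text \<open>The weight measures \<nu> in the real absolute value, whereas the factor n gained from
  (T - 1)^n is small only p-adically, and not at all if p does not divide n. The factor q^a has norm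
  q^-a, and n^a q^-a is bounded independently of n. Several variables need no further idea. A family
  of polynomials, one per coordinate, acts on f through a tensor product functional that is linear
  in each slot, and an ultrametric seminorm carries a bound from generators to integral combinations
  without any constant. Sequential completeness enters through the limits of Mahler series. As to
  topologies, the one on the C^\<alpha> maps is shown to be defined by the weighted seminorms of the
  coefficients; the homeomorphism is then formal, because the seminorms correspond under the
  bijection.\<close>

subsection \<open>Topology of the p-adic field\<close>

lemma padic_norm_0 [simp]: "padic_norm (0 :: 'p::prime_card padic) = 0"
  by (simp add: padic_norm_eq_0_iff)

lemma padic_norm_1 [simp]: "padic_norm (1 :: 'p::prime_card padic) = 1"
  using padic_norm_of_rat[of 1, where ?'p = 'p] by simp

lemma padic_norm_diff_ultra:
  "padic_norm (x - y) \<le> max (padic_norm x) (padic_norm (y :: 'p::prime_card padic))"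
  using padic_norm_ultra[of x "- y"] by (simp add: padic_norm_uminus)

lemma padic_norm_minus_commute: "padic_norm (x - y) = padic_norm (y - x :: 'p::prime_card padic)"
  by (metis minus_diff_eq padic_norm_uminus)

lemma tendsto_padic_iff:
  "(f \<longlongrightarrow> (a :: 'p::prime_card padic)) F \<longleftrightarrow> ((\<lambda>x. padic_norm (f x - a)) \<longlongrightarrow> 0) F"
  by (subst tendsto_dist_iff) (simp add: dist_padic_def)

instance padic :: (prime_card) topological_ab_group_add
proof
  fix a b :: "'a padic"
  have lim: "((\<lambda>x. padic_norm (fst x - a) + padic_norm (snd x - b)) \<longlongrightarrow> 0) (nhds a \<times>\<^sub>F nhds b)"
    by (intro tendsto_add_zero tendsto_padic_iff[THEN iffD1] filterlim_fst filterlim_snd)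
  have le: "norm (padic_norm (fst x + snd x - (a + b))) \<le> padic_norm (fst x - a) + padic_norm (snd x - b)" for x
  proof -
    have "padic_norm (fst x + snd x - (a + b)) = padic_norm ((fst x - a) + (snd x - b))"
      by (rule arg_cong[of _ _ padic_norm]) simp
    then show ?thesis
      using padic_norm_ultra[of "fst x - a" "snd x - b"] padic_norm_nonneg[of "fst x - a"]
        padic_norm_nonneg[of "snd x - b"] padic_norm_nonneg[of "fst x + snd x - (a + b)"]
      by simp
  qed
  show "LIM x (nhds a \<times>\<^sub>F nhds b). fst x + snd x :> nhds (a + b)"
    unfolding tendsto_padic_iff by (rule Lim_null_comparison[OF always_eventually lim]) (use le in blast)
  have "((\<lambda>x. x) \<longlongrightarrow> a) (nhds a)" by (rule filterlim_ident)
  then show "(uminus \<longlongrightarrow> - a) (nhds a)"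
    unfolding tendsto_padic_iff by (simp add: padic_norm_minus_commute)
qed

instance padic :: (prime_card) topological_comm_monoid_mult
proof
  fix a b :: "'a padic"
  have F: "((\<lambda>x. padic_norm (fst x - a)) \<longlongrightarrow> 0) (nhds a \<times>\<^sub>F nhds b)"
    and G: "((\<lambda>x. padic_norm (snd x - b)) \<longlongrightarrow> 0) (nhds a \<times>\<^sub>F nhds b)"
    by (intro tendsto_padic_iff[THEN iffD1] filterlim_fst filterlim_snd)+
  have lim: "((\<lambda>x. padic_norm (fst x - a) * padic_norm (snd x - b) + padic_norm (fst x - a) * padic_norm b
      + padic_norm a * padic_norm (snd x - b)) \<longlongrightarrow> 0) (nhds a \<times>\<^sub>F nhds b)"
    using F G by (intro tendsto_add_zero tendsto_mult_zero tendsto_mult_left_zero tendsto_mult_right_zero)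
  have le: "norm (padic_norm (fst z * snd z - a * b)) \<le> padic_norm (fst z - a) * padic_norm (snd z - b)
        + padic_norm (fst z - a) * padic_norm b + padic_norm a * padic_norm (snd z - b)" for z
  proof -
    obtain x y where z: "z = (x, y)" by force
    have "x * y - a * b = ((x - a) * (y - b) + (x - a) * b) + a * (y - b)" by (simp add: algebra_simps)
    then have "padic_norm (x * y - a * b) = padic_norm ((x - a) * (y - b) + (x - a) * b + a * (y - b))"
      by (rule arg_cong)
    then have "padic_norm (x * y - a * b) \<le>
        max (max (padic_norm ((x - a) * (y - b))) (padic_norm ((x - a) * b))) (padic_norm (a * (y - b)))"
      using padic_norm_ultra[of "(x - a) * (y - b) + (x - a) * b" "a * (y - b)"]
        padic_norm_ultra[of "(x - a) * (y - b)" "(x - a) * b"] by linarith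
    then show ?thesis
      using padic_norm_nonneg[of "x * y - a * b"]
        mult_nonneg_nonneg[OF padic_norm_nonneg[of "x - a"] padic_norm_nonneg[of "y - b"]]
        mult_nonneg_nonneg[OF padic_norm_nonneg[of "x - a"] padic_norm_nonneg[of "b"]]
        mult_nonneg_nonneg[OF padic_norm_nonneg[of a] padic_norm_nonneg[of "y - b"]]
      by (simp add: padic_norm_mult z)
  qed
  show "LIM x (nhds a \<times>\<^sub>F nhds b). fst x * snd x :> nhds (a * b)"
    unfolding tendsto_padic_iff by (rule Lim_null_comparison[OF always_eventually lim]) (use le in blast)
qed

lemma continuous_on_padic_norm: "continuous_on A (padic_norm :: 'p::prime_card padic \<Rightarrow> real)"
proof -
  have "continuous_on A (\<lambda>x :: 'p padic. dist x 0)" by (intro continuous_intros)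
  then show ?thesis by (simp add: dist_padic_def)
qed

lemma padic_norm_of_int_eq:
  "m \<noteq> 0 \<Longrightarrow> padic_norm (of_int m :: 'p::prime_card padic) = 1 / real CARD('p) ^ multiplicity (int CARD('p)) m"
  using padic_norm_of_rat[of "of_int m", where ?'p = 'p] padic_abs_frac[of "CARD('p)" m 1]
  by (simp add: prime_card power_int_minus field_simps)

lemma CARD_gt_1: "CARD('p::prime_card) > 1"
  using prime_card prime_gt_1_nat by blast

lemma padic_norm_of_int_le_1: "padic_norm (of_int m :: 'p::prime_card padic) \<le> 1"
  using CARD_gt_1[where ?'p = 'p]
  by (cases "m = 0") (simp_all add: padic_norm_of_int_eq)

lemma padic_norm_of_nat_le_1: "padic_norm (of_nat m :: 'p::prime_card padic) \<le> 1"
  using padic_norm_of_int_le_1[of "int m", where ?'p = 'p] by simp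

lemma padic_norm_of_int_dvd:
  assumes "int CARD('p) ^ k dvd m"
  shows "padic_norm (of_int m :: 'p::prime_card padic) \<le> 1 / real CARD('p) ^ k"
proof (cases "m = 0")
  case False
  have "k \<le> multiplicity (int CARD('p)) m"
    using assms False CARD_gt_1[where ?'p = 'p] by (intro multiplicity_geI) auto
  then have "real CARD('p) ^ k \<le> real CARD('p) ^ multiplicity (int CARD('p)) m"
    using CARD_gt_1[where ?'p = 'p] by (intro power_increasing) auto
  then show ?thesis
    using False CARD_gt_1[where ?'p = 'p] by (simp add: padic_norm_of_int_eq frac_le)
qed simp

text \<open>The p-part of n divides n and hence is at most n. This turns the denominators j of the
  difference quotients into real factors of size at most j.\<close>

lemma padic_norm_of_nat_ge:
  assumes "n > 0"
  shows "1 / real n \<le> padic_norm (of_nat n :: 'p::prime_card padic)"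
proof -
  have "int CARD('p) ^ multiplicity (int CARD('p)) (int n) dvd int n" by (rule multiplicity_dvd)
  then have "int (CARD('p) ^ multiplicity (int CARD('p)) (int n)) dvd int n" by simp
  then have "CARD('p) ^ multiplicity (int CARD('p)) (int n) \<le> n"
    using assms by (meson dvd_imp_le int_dvd_int_iff)
  then have "real CARD('p) ^ multiplicity (int CARD('p)) (int n) \<le> real n"
    by (metis of_nat_le_iff of_nat_power)
  then show ?thesis
    using padic_norm_of_int_eq[of "int n", where ?'p = 'p] assms CARD_gt_1[where ?'p = 'p]
    by (simp add: frac_le)
qed

lemma padic_norm_inverse: "padic_norm (inverse x) = inverse (padic_norm (x :: 'p::prime_card padic))"
proof (cases "x = 0")
  case False
  then have "padic_norm x * padic_norm (inverse x) = 1" by (simp flip: padic_norm_mult)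
  then show ?thesis by (metis inverse_unique)
qed simp

lemma padic_norm_prod: "padic_norm (prod f A) = (\<Prod>a\<in>A. padic_norm (f a :: 'p::prime_card padic))"
  by (induction A rule: infinite_finite_induct) (simp_all add: padic_norm_mult)

lemma padic_norm_sum_le:
  assumes "\<And>a. a \<in> A \<Longrightarrow> padic_norm (f a :: 'p::prime_card padic) \<le> B" "B \<ge> 0"
  shows "padic_norm (sum f A) \<le> B"
  using assms(1)
proof (induction A rule: infinite_finite_induct)
  case (insert x F)
  then show ?case using padic_norm_ultra[of "f x" "sum f F"] by fastforce
qed (use assms(2) in auto)

lemma padic_norm_p_power: "padic_norm (of_nat CARD('p) ^ k :: 'p::prime_card padic) = 1 / real CARD('p) ^ k"
proof -
  have "multiplicity (int CARD('p)) (int CARD('p) ^ k) = k"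
    using prime_card[where ?'a = 'p] CARD_gt_1[where ?'p = 'p] by (intro multiplicity_same_power) auto
  then show ?thesis
    using padic_norm_of_int_eq[of "int CARD('p) ^ k", where ?'p = 'p] CARD_gt_1[where ?'p = 'p] by simp
qed

lemma inverse_p_power_tendsto_0: "(\<lambda>k. 1 / real CARD('p::prime_card) ^ k) \<longlonglongrightarrow> 0"
  using LIMSEQ_inverse_realpow_zero[of "real CARD('p)"] CARD_gt_1[where ?'p = 'p]
  by (simp add: divide_inverse)

lemma p_power_tendsto_0: "(\<lambda>k. of_nat CARD('p) ^ k :: 'p::prime_card padic) \<longlonglongrightarrow> 0"
  unfolding tendsto_padic_iff by (simp add: padic_norm_p_power inverse_p_power_tendsto_0)

subsection \<open>The ring of p-adic integers\<close>

lemma padic_integers_add: "x \<in> padic_integers \<Longrightarrow> y \<in> padic_integers \<Longrightarrow> x + y \<in> padic_integers"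
  unfolding padic_integers_def using padic_norm_ultra[of x y] by auto

lemma padic_integers_minus: "x \<in> padic_integers \<Longrightarrow> - x \<in> padic_integers"
  unfolding padic_integers_def by (simp add: padic_norm_uminus)

lemma padic_integers_diff: "x \<in> padic_integers \<Longrightarrow> y \<in> padic_integers \<Longrightarrow> x - y \<in> padic_integers"
  unfolding padic_integers_def using padic_norm_diff_ultra[of x y] by auto

lemma of_nat_integer [simp]: "of_nat n \<in> padic_integers"
  unfolding padic_integers_def by (simp add: padic_norm_of_nat_le_1)

lemma of_int_integer [simp]: "of_int n \<in> padic_integers"
  unfolding padic_integers_def by (simp add: padic_norm_of_int_le_1)

lemma padic_integers_1 [simp]: "1 \<in> padic_integers"
  unfolding padic_integers_def by simp

abbreviation padic_cube :: "'n \<Rightarrow> 'p::prime_card padic set" where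
  "padic_cube \<equiv> \<lambda>_. padic_integers"

lemma closed_padic_integers: "closed (padic_integers :: 'p::prime_card padic set)"
  unfolding padic_integers_def
  by (intro closed_Collect_le continuous_on_const continuous_on_padic_norm)

text \<open>A rational number near x has norm at most 1, so p does not divide its reduced
  denominator \<open>b\<close>, and \<open>b\<close> can be inverted modulo p^k. The residue
  \<open>m\<close> is the value of that fraction modulo p^k.\<close>

lemma of_nat_approx_padic_integer:
  fixes x :: "'p::prime_card padic"
  assumes x: "x \<in> padic_integers"
  shows "\<exists>m<CARD('p) ^ k. padic_norm (x - of_nat m) \<le> 1 / real CARD('p) ^ k"
proof -
  let ?p = "int CARD('p)"
  define e where "e = 1 / real CARD('p) ^ k"
  have p0: "e > 0" "e \<le> 1" using CARD_gt_1[where ?'p = 'p] by (simp_all add: e_def)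
  have pp: "prime ?p" using prime_card[where ?'a = 'p] by simp
  obtain r where r: "padic_norm (x - of_rat r) < e"
    using padic_rat_dense[OF p0(1)] by (auto simp: dist_padic_def)
  have "padic_norm (of_rat r :: 'p padic) \<le> max (padic_norm x) (padic_norm (x - of_rat r))"
    using padic_norm_diff_ultra[of x "x - of_rat r"] by simp
  also have "\<dots> \<le> 1" using x r p0 by (simp add: padic_integers_def)
  finally have r1: "padic_norm (of_rat r :: 'p padic) \<le> 1" .
  obtain a b where ab: "quotient_of r = (a, b)" by force
  have b: "b > 0" "coprime a b" "r = of_int a / of_int b"
    using quotient_of_denom_pos[OF ab] quotient_of_coprime[OF ab] quotient_of_div[OF ab] by auto
  have nb: "\<not> ?p dvd b"
  proof
    assume d: "?p dvd b"
    then have na: "\<not> ?p dvd a" using b(2) pp by (meson coprime_common_divisor not_prime_unit)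
    then have a0: "a \<noteq> 0" by auto
    have "multiplicity ?p a = 0" using na by (rule not_dvd_imp_multiplicity_0)
    moreover have "multiplicity ?p b \<ge> 1" using d b(1) pp CARD_gt_1[where ?'p = 'p]
      by (intro multiplicity_geI) (auto simp: prime_gt_1_int)
    moreover have "padic_norm (of_rat r :: 'p padic) = real CARD('p) powi (int (multiplicity ?p b) - int (multiplicity ?p a))"
      unfolding padic_norm_of_rat b(3) using a0 b(1) by (intro padic_abs_frac prime_card) auto
    ultimately have "padic_norm (of_rat r :: 'p padic) = real CARD('p) ^ multiplicity ?p b" "multiplicity ?p b \<ge> 1" by simp_all
    then show False using r1 CARD_gt_1[where ?'p = 'p]
      by (metis not_le of_nat_1 of_nat_less_iff one_less_power zero_less_one less_le_trans)
  qed
  have "coprime b (?p ^ k)" using nb pp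
    by (meson coprime_commute coprime_power_left_iff prime_imp_coprime)
  then obtain c v where "c * b + v * ?p ^ k = 1" using bezout_int[of b "?p ^ k"] by auto
  then have c: "a - b * (a * c) = a * v * ?p ^ k"
    by (metis (no_types, opaque_lifting) add_diff_cancel_left' mult.assoc mult.commute mult.right_neutral right_diff_distrib')
  define m where "m = nat ((a * c) mod ?p ^ k)"
  have pk: "?p ^ k > 0" using CARD_gt_1[where ?'p = 'p] by simp
  have m: "int m = (a * c) mod ?p ^ k" using pk by (simp add: m_def)
  have "m < CARD('p) ^ k" using pk pos_mod_bound[OF pk, of "a * c"] m by (metis of_nat_less_iff of_nat_power)
  moreover have "padic_norm (x - of_nat m) \<le> e"
  proof -
    have "a - b * int m = (a - b * (a * c)) + b * (a * c - int m)" by (simp add: algebra_simps)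
    moreover have "?p ^ k dvd a * c - int m" unfolding m by (simp add: minus_mod_eq_mult_div)
    ultimately have "?p ^ k dvd a - b * int m" unfolding c by simp
    then have 1: "padic_norm (of_int (a - b * int m) :: 'p padic) \<le> e" unfolding e_def by (rule padic_norm_of_int_dvd)
    have nb1: "padic_norm (of_int b :: 'p padic) = 1"
      using b(1) by (simp add: padic_norm_of_int_eq not_dvd_imp_multiplicity_0[OF nb])
    have "(of_rat r - of_nat m) * of_int b = (of_int (a - b * int m) :: 'p padic)"
      using b(1) by (simp add: b(3) of_rat_divide field_simps)
    then have "padic_norm (of_rat r - of_nat m :: 'p padic) \<le> e"
      using 1 nb1 by (metis mult.right_neutral padic_norm_mult)
    then show ?thesis
      using padic_norm_ultra[of "x - of_rat r" "of_rat r - of_nat m"] r by simp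
  qed
  ultimately show ?thesis unfolding e_def by blast
qed

text \<open>The natural numbers below p^k come within p^-k of every p-adic integer, which gives
  total boundedness; completeness comes from closedness.\<close>

lemma compact_padic_integers: "compact (padic_integers :: 'p::prime_card padic set)"
  unfolding compact_eq_totally_bounded
proof (intro conjI allI impI)
  show "complete (padic_integers :: 'p padic set)"
    using closed_padic_integers by (simp add: complete_eq_closed)
  fix e :: real assume "e > 0"
  then obtain k where k: "1 / real CARD('p) ^ k < e"
    using order_tendstoD(2)[OF inverse_p_power_tendsto_0[where ?'p = 'p]] unfolding eventually_sequentially by blast
  have "padic_integers \<subseteq> (\<Union>x\<in>of_nat ` {..<CARD('p) ^ k}. ball x e :: 'p padic set)"
  proof
    fix x :: "'p padic" assume "x \<in> padic_integers"
    then obtain m where "m < CARD('p) ^ k" "padic_norm (x - of_nat m) \<le> 1 / real CARD('p) ^ k"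
      using of_nat_approx_padic_integer by blast
    then show "x \<in> (\<Union>x\<in>of_nat ` {..<CARD('p) ^ k}. ball x e)"
      using k by (auto simp: dist_padic_def padic_norm_minus_commute intro!: bexI[of _ m])
  qed
  then show "\<exists>K. finite K \<and> padic_integers \<subseteq> (\<Union>x\<in>K. ball x e :: 'p padic set)" by blast
qed

lemma padic_integer_limit_of_nat:
  fixes x :: "'p::prime_card padic"
  assumes "x \<in> padic_integers"
  obtains m where "(\<lambda>k. of_nat (m k)) \<longlonglongrightarrow> x"
proof -
  obtain m where m: "\<And>k. padic_norm (x - of_nat (m k)) \<le> 1 / real CARD('p) ^ k"
    using of_nat_approx_padic_integer[OF assms] by metis
  have "(\<lambda>k. padic_norm (of_nat (m k) - x)) \<longlonglongrightarrow> 0"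
    by (rule Lim_null_comparison[OF _ inverse_p_power_tendsto_0[where ?'p = 'p]])
       (simp add: m padic_norm_nonneg padic_norm_minus_commute[of _ x])
  then show ?thesis using that by (simp add: tendsto_padic_iff)
qed

text \<open>The points x + p^k converge to x without reaching it. The absence of isolated points is
  what makes the extended difference quotients on the cube unique.\<close>

lemma cartesian_padic_integers: "cartesian (\<lambda>_. padic_integers :: 'p::prime_card padic set)"
  unfolding cartesian_def
proof (intro allI notI)
  fix x :: "'p padic" assume "x isolated_in padic_integers"
  then obtain T where x: "x \<in> padic_integers" and T: "open T" "T \<inter> padic_integers = {x}"
    by (auto simp: isolated_in_def)
  have "(\<lambda>k. x + of_nat CARD('p) ^ k) \<longlonglongrightarrow> x + 0" by (intro tendsto_intros p_power_tendsto_0)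
  then have "eventually (\<lambda>k. x + of_nat CARD('p) ^ k \<in> T) sequentially"
    using T by (intro topological_tendstoD) auto
  then obtain k where "x + of_nat CARD('p) ^ k \<in> T" unfolding eventually_sequentially by blast
  moreover have "x + of_nat (CARD('p) ^ k) \<in> padic_integers" by (intro padic_integers_add x of_nat_integer)
  ultimately have "x + of_nat CARD('p) ^ k \<in> T \<inter> padic_integers" by simp
  then have "x + of_nat CARD('p) ^ k = x" unfolding T(2) by simp
  then have "of_nat CARD('p) ^ k = (0 :: 'p padic)" by (metis add_cancel_left_right)
  then show False using CARD_gt_1[where ?'p = 'p] by simp
qed

text \<open>Binomial coefficients of natural numbers are natural numbers; these are dense in the
  p-adic integers, and the closed unit ball keeps limits.\<close>

lemma gbinomial_padic_integer:
  fixes x :: "'p::prime_card padic"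
  assumes "x \<in> padic_integers"
  shows "x gchoose n \<in> padic_integers"
proof -
  obtain m where m: "(\<lambda>k. of_nat (m k)) \<longlonglongrightarrow> x" using padic_integer_limit_of_nat[OF assms] .
  have "(\<lambda>k. inverse (fact n) * (\<Prod>i = 0..<n. of_nat (m k) - of_nat i)) \<longlonglongrightarrow> inverse (fact n) * (\<Prod>i = 0..<n. x - of_nat i)"
    by (intro tendsto_intros tendsto_prod' m)
  then have "(\<lambda>k. of_nat (m k choose n)) \<longlonglongrightarrow> x gchoose n"
    by (simp add: gbinomial_prod_rev binomial_gbinomial divide_inverse mult.commute)
  then show ?thesis
    by (rule closed_sequentially[OF closed_padic_integers, rotated]) simp
qed

lemma continuous_on_gbinomial [continuous_intros]:
  assumes "continuous_on A f"
  shows "continuous_on A (\<lambda>x. (f x :: 'p::prime_card padic) gchoose n)"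
proof -
  have "continuous_on A (\<lambda>x. inverse (fact n) * (\<Prod>i = 0..<n. f x - of_nat i))"
    by (intro continuous_intros continuous_on_prod' assms)
  then show ?thesis by (simp add: gbinomial_prod_rev divide_inverse mult.commute)
qed

subsection \<open>Divided differences in one variable\<close>

text \<open>The Lagrange weight of the node \<open>x a\<close> in the divided difference over the
  nodes indexed by \<open>S\<close>. An arbitrary index set, instead of an initial segment, allows
  single nodes to be exchanged.\<close>

definition dcoef :: "('i \<Rightarrow> 'k::field) \<Rightarrow> 'i set \<Rightarrow> 'i \<Rightarrow> 'k" where
  "dcoef x S a = (\<Prod>b\<in>S - {a}. 1 / (x a - x b))"

lemma dcoef_insert:
  assumes "finite S" "b \<notin> S" "a \<noteq> b"
  shows "dcoef x (insert b S) a = dcoef x S a / (x a - x b)"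
proof -
  have "insert b S - {a} = insert b (S - {a})" using assms by auto
  then show ?thesis using assms by (simp add: dcoef_def)
qed

text \<open>Coefficient by coefficient, this is the recursion f[S,a] - f[S,b] = (x a - x b) f[S,a,b]
  of divided differences. The form without f serves both the sum of the weights and the polynomials
  \<open>nat_difference\<close>.\<close>

lemma dcoef_exchange:
  assumes S: "finite S" "a \<notin> S" "b \<notin> S" "a \<noteq> b" and inj: "inj_on x (insert a (insert b S))"
    and m: "m \<in> insert a (insert b S)"
  shows "(if m \<in> insert a S then dcoef x (insert a S) m else 0) - (if m \<in> insert b S then dcoef x (insert b S) m else 0)
    = (x a - x b) * dcoef x (insert a (insert b S)) m"
proof -
  have ne: "x u \<noteq> x v" if "u \<in> insert a (insert b S)" "v \<in> insert a (insert b S)" "u \<noteq> v" for u v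
    using inj that by (meson inj_onD)
  consider "m = a" | "m = b" | "m \<in> S" using m by auto
  then show ?thesis
  proof cases
    case 1
    have "dcoef x (insert b (insert a S)) a = dcoef x (insert a S) a / (x a - x b)"
      using S by (intro dcoef_insert) auto
    then show ?thesis using 1 S ne[of a b] by (simp add: insert_commute[of a b])
  next
    case 2
    have "dcoef x (insert a (insert b S)) b = dcoef x (insert b S) b / (x b - x a)"
      using S by (intro dcoef_insert) auto
    then show ?thesis using 2 S ne[of a b] by (simp add: field_simps)
  next
    case 3
    have 1: "dcoef x (insert a S) m = dcoef x S m / (x m - x a)"
      and 2: "dcoef x (insert b S) m = dcoef x S m / (x m - x b)"
      and 4: "dcoef x (insert a (insert b S)) m = dcoef x (insert b S) m / (x m - x a)"
      using 3 S by (intro dcoef_insert; auto)+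
    have "x m - x a \<noteq> 0" "x m - x b \<noteq> 0" using ne[of m a] ne[of m b] S 3 by auto
    then have "c / (x m - x a) - c / (x m - x b) = (x a - x b) * (c / (x m - x b) / (x m - x a))" for c
      by (simp add: divide_simps) (simp add: algebra_simps)
    then show ?thesis using 3 by (simp add: 1 2 4)
  qed
qed

lemma sum_dcoef_exchange:
  assumes S: "finite S" "a \<notin> S" "b \<notin> S" "a \<noteq> b" and inj: "inj_on x (insert a (insert b S))"
  shows "(\<Sum>m\<in>insert a S. dcoef x (insert a S) m) - (\<Sum>m\<in>insert b S. dcoef x (insert b S) m)
    = (x a - x b) * (\<Sum>m\<in>insert a (insert b S). dcoef x (insert a (insert b S)) m)"
proof -
  let ?T = "insert a (insert b S)"
  have "(\<Sum>m\<in>insert a S. dcoef x (insert a S) m) = (\<Sum>m\<in>?T. if m \<in> insert a S then dcoef x (insert a S) m else 0)"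
    using S by (intro sum.mono_neutral_cong_left) auto
  moreover have "(\<Sum>m\<in>insert b S. dcoef x (insert b S) m) = (\<Sum>m\<in>?T. if m \<in> insert b S then dcoef x (insert b S) m else 0)"
    using S by (intro sum.mono_neutral_cong_left) auto
  ultimately show ?thesis
    by (simp only: sum_subtractf[symmetric] sum_distrib_left) (intro sum.cong refl dcoef_exchange assms)
qed

text \<open>The sum is the divided difference of the constant 1. Dropping either of two nodes leaves
  equal sums: both vanish by induction, or both are 1 if there is no further node. The exchange
  identity then forces the full sum to be 0.\<close>

lemma sum_dcoef_eq_0:
  assumes "finite S" "inj_on x S" "card S \<ge> 2"
  shows "(\<Sum>m\<in>S. dcoef x S m) = 0"
  using assms
proof (induction "card S" arbitrary: S rule: less_induct)
  case less
  obtain a b where ab: "a \<in> S" "b \<in> S" "a \<noteq> b"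
    using less.prems(3) by (meson card_2_iff' obtain_subset_with_card_n subsetD)
  define R where "R = S - {a, b}"
  have R: "finite R" "a \<notin> R" "b \<notin> R" "S = insert a (insert b R)" using less.prems ab by (auto simp: R_def)
  have "(\<Sum>m\<in>insert a R. dcoef x (insert a R) m) = (\<Sum>m\<in>insert b R. dcoef x (insert b R) m)"
  proof (cases "R = {}")
    case False
    have "card R \<noteq> 0" using False R(1) by simp
    have z: "(\<Sum>m\<in>insert c R. dcoef x (insert c R) m) = 0" if c: "c \<in> {a, b}" for c
    proof (rule less.hyps)
      show "card (insert c R) < card S" "finite (insert c R)" "2 \<le> card (insert c R)"
        using c R ab(3) \<open>card R \<noteq> 0\<close>
        by (auto simp: Suc_le_eq card_gt_0_iff)
      show "inj_on x (insert c R)" using less.prems(2) by (rule inj_on_subset) (use c R(4) in auto)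
    qed
    show ?thesis using z[of a] z[of b] by simp
  qed (simp add: dcoef_def)
  then have "(x a - x b) * (\<Sum>m\<in>S. dcoef x S m) = 0"
    using sum_dcoef_exchange[OF R(1,2,3) ab(3), of x] less.prems(2) unfolding R(4) by simp
  moreover have "x a \<noteq> x b" using less.prems(2) ab by (meson inj_onD)
  ultimately show ?case by simp
qed

text \<open>The factor of the weight of node j + 1 that involves node 0 becomes the denominator of
  the difference quotient. The weights of the nodes other than 0 add up to minus the weight of node
  0, which accounts for the value f (x 0).\<close>

lemma divided_difference_rec:
  fixes x :: "nat \<Rightarrow> 'k::field"
  assumes inj: "inj_on x {..Suc k}"
  shows "(\<Sum>j\<le>Suc k. dcoef x {..Suc k} j * f (x j)) =
    (\<Sum>j\<le>k. dcoef (\<lambda>i. x (Suc i)) {..k} j * ((f (x (Suc j)) - f (x 0)) / (x (Suc j) - x 0)))"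
proof -
  have c: "dcoef (\<lambda>i. x (Suc i)) {..k} j / (x (Suc j) - x 0) = dcoef x {..Suc k} (Suc j)" if "j \<le> k" for j
  proof -
    have "{..Suc k} = insert 0 (Suc ` {..k})" by (metis atMost_Suc_eq_insert_0)
    then have "dcoef x {..Suc k} (Suc j) = dcoef x (Suc ` {..k}) (Suc j) / (x (Suc j) - x 0)"
      using dcoef_insert[of "Suc ` {..k}" 0 "Suc j" x] by auto
    also have "dcoef x (Suc ` {..k}) (Suc j) = dcoef (\<lambda>i. x (Suc i)) {..k} j"
      unfolding dcoef_def by (rule prod.reindex_cong[of Suc]) auto
    finally show ?thesis ..
  qed
  have "(\<Sum>j\<le>k. dcoef x {..Suc k} (Suc j)) = - dcoef x {..Suc k} 0"
    using sum_dcoef_eq_0[of "{..Suc k}" x] inj unfolding sum.atMost_Suc_shift by (simp add: eq_neg_iff_add_eq_0 add.commute)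
  then have "(\<Sum>j\<le>k. dcoef x {..Suc k} (Suc j) * (f (x (Suc j)) - f (x 0))) =
     (\<Sum>j\<le>Suc k. dcoef x {..Suc k} j * f (x j))"
    unfolding sum.atMost_Suc_shift by (simp add: right_diff_distrib sum_subtractf flip: sum_distrib_right)
  moreover have "(\<Sum>j\<le>k. dcoef (\<lambda>i. x (Suc i)) {..k} j * ((f (x (Suc j)) - f (x 0)) / (x (Suc j) - x 0)))
     = (\<Sum>j\<le>k. dcoef x {..Suc k} (Suc j) * (f (x (Suc j)) - f (x 0)))"
    by (intro sum.cong refl) (simp flip: c)
  ultimately show ?thesis by simp
qed

subsection \<open>Divided differences of binomial coefficients\<close>

text \<open>The continuous extension of the divided difference of order \<open>k\<close> of \<open>x \<mapsto> x gchoose n\<close>.\<close>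

fun binomial_diff :: "nat \<Rightarrow> nat \<Rightarrow> (nat \<Rightarrow> 'k) \<Rightarrow> 'k::field_char_0" where
  "binomial_diff 0 n x = x 0 gchoose n"
| "binomial_diff (Suc k) n x = (\<Sum>j=1..n. inverse (of_nat j) * (x 0 gchoose (n - j)) *
     binomial_diff k (j - 1) (\<lambda>i. x (Suc i) - x 0 - 1))"

text \<open>In the Vandermonde sum for y = (y - x) + x the term j = 0 is the value at x, and
  absorption extracts (y - x)/j from every other term. This is the source of the
  denominators.\<close>

lemma gbinomial_difference_quotient:
  fixes x y :: "'k::field_char_0"
  assumes "x \<noteq> y"
  shows "((y gchoose n) - (x gchoose n)) / (y - x) =
    (\<Sum>j=1..n. inverse (of_nat j) * (x gchoose (n - j)) * ((y - x - 1) gchoose (j - 1)))"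
proof -
  have "y gchoose n = ((y - x) + x) gchoose n" by simp
  also have "\<dots> = (\<Sum>j=0..n. ((y - x) gchoose j) * (x gchoose (n - j)))"
    by (rule gbinomial_Vandermonde[symmetric])
  also have "\<dots> = (x gchoose n) + (\<Sum>j=1..n. ((y - x) gchoose j) * (x gchoose (n - j)))"
    by (subst sum.atLeast_Suc_atMost) auto
  also have "(\<Sum>j=1..n. ((y - x) gchoose j) * (x gchoose (n - j))) =
      (y - x) * (\<Sum>j=1..n. inverse (of_nat j) * (x gchoose (n - j)) * ((y - x - 1) gchoose (j - 1)))"
    unfolding sum_distrib_left
    by (intro sum.cong refl) (subst gbinomial_absorption', auto simp: divide_inverse)
  finally show ?thesis using assms by simp
qed

lemma binomial_diff_eq:
  fixes x :: "nat \<Rightarrow> 'k::field_char_0"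
  assumes "inj_on x {..k}"
  shows "(\<Sum>j\<le>k. dcoef x {..k} j * (x j gchoose n)) = binomial_diff k n x"
  using assms
proof (induction k arbitrary: n x)
  case 0
  then show ?case by (simp add: dcoef_def)
next
  case (Suc k)
  let ?y = "\<lambda>i. x (Suc i) - x 0 - 1"
  \<comment> \<open>The weights depend on differences of nodes only, so the translation by x 0 + 1
    does not change them.\<close>
  have d: "dcoef (\<lambda>i. x (Suc i)) {..k} j = dcoef ?y {..k} j" for j by (simp add: dcoef_def)
  have inj: "inj_on ?y {..k}" using Suc.prems by (auto simp: inj_on_def)
  have ne: "x (Suc j) \<noteq> x 0" if "j \<le> k" for j
    using inj_onD[OF Suc.prems, of "Suc j" 0] that by auto
  have "(\<Sum>j\<le>Suc k. dcoef x {..Suc k} j * (x j gchoose n)) =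
     (\<Sum>j\<le>k. dcoef ?y {..k} j * (\<Sum>i=1..n. inverse (of_nat i) * (x 0 gchoose (n - i)) * (?y j gchoose (i - 1))))"
    unfolding divided_difference_rec[OF Suc.prems, of "\<lambda>x. x gchoose n"] d
    by (intro sum.cong refl) (subst gbinomial_difference_quotient, use ne[symmetric] in auto)
  also have "\<dots> = (\<Sum>i=1..n. inverse (of_nat i) * (x 0 gchoose (n - i)) * (\<Sum>j\<le>k. dcoef ?y {..k} j * (?y j gchoose (i - 1))))"
    unfolding sum_distrib_left by (subst sum.swap) (simp add: mult_ac)
  also have "\<dots> = binomial_diff (Suc k) n x"
    using Suc.IH[OF inj] by simp
  finally show ?case .
qed

text \<open>Each of the k recursion steps contributes one \<open>inverse (of_nat j)\<close>, of norm
  at most j \<le> n, and lowers the degree to j - 1; the binomial coefficients themselves are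
  integral.\<close>

lemma padic_norm_binomial_diff_le:
  fixes x :: "nat \<Rightarrow> 'p::prime_card padic"
  assumes "\<And>j. j \<le> k \<Longrightarrow> x j \<in> padic_integers"
  shows "padic_norm (binomial_diff k n x) \<le> real n ^ k"
  using assms
proof (induction k arbitrary: n x)
  case 0
  then have "x 0 gchoose n \<in> padic_integers" by (intro gbinomial_padic_integer) simp
  then show ?case by (simp add: padic_integers_def)
next
  case (Suc k)
  have "padic_norm (inverse (of_nat j) * (x 0 gchoose (n - j)) * binomial_diff k (j - 1) (\<lambda>i. x (Suc i) - x 0 - 1))
    \<le> real n ^ Suc k" if j: "j \<in> {1..n}" for j
  proof -
    have "padic_norm (binomial_diff k (j - 1) (\<lambda>i. x (Suc i) - x 0 - 1)) \<le> real (j - 1) ^ k"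
      by (intro Suc.IH padic_integers_diff padic_integers_1 Suc.prems) auto
    also have "\<dots> \<le> real n ^ k" using j by (intro power_mono) auto
    finally have 1: "padic_norm (binomial_diff k (j - 1) (\<lambda>i. x (Suc i) - x 0 - 1)) \<le> real n ^ k" .
    have 2: "padic_norm (x 0 gchoose (n - j)) \<le> 1"
      using gbinomial_padic_integer[of "x 0" "n - j"] Suc.prems[of 0] by (simp add: padic_integers_def)
    have "inverse (padic_norm (of_nat j :: 'p padic)) \<le> inverse (1 / real j)"
      using j by (intro le_imp_inverse_le padic_norm_of_nat_ge) auto
    also have "\<dots> \<le> real n" using j by simp
    finally have 3: "padic_norm (inverse (of_nat j :: 'p padic)) \<le> real n" by (simp add: padic_norm_inverse)
    have "padic_norm (inverse (of_nat j :: 'p padic)) * padic_norm (x 0 gchoose (n - j)) \<le> real n * 1"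
      using 2 3 by (intro mult_mono) (auto simp: padic_norm_nonneg)
    then have "padic_norm (inverse (of_nat j :: 'p padic)) * padic_norm (x 0 gchoose (n - j)) *
       padic_norm (binomial_diff k (j - 1) (\<lambda>i. x (Suc i) - x 0 - 1)) \<le> (real n * 1) * real n ^ k"
      using 1 by (intro mult_mono[of _ "real n * 1"] padic_norm_nonneg) auto
    then show ?thesis by (simp add: padic_norm_mult)
  qed
  then show ?case by (simp only: binomial_diff.simps) (intro padic_norm_sum_le, auto)
qed

lemma continuous_on_binomial_diff:
  fixes x :: "'a::topological_space \<Rightarrow> nat \<Rightarrow> 'p::prime_card padic"
  assumes "\<And>j. continuous_on A (\<lambda>z. x z j)"
  shows "continuous_on A (\<lambda>z. binomial_diff k n (x z))"
  using assms
proof (induction k arbitrary: n x)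
  case 0
  then show ?case by (auto intro!: continuous_intros)
next
  case (Suc k)
  show ?case unfolding binomial_diff.simps
    by (intro continuous_intros continuous_on_mult' Suc)
qed

subsection \<open>Integral combinations of divided differences at natural numbers\<close>

text \<open>A polynomial \<open>\<Sum>m. c\<^sub>m T\<^sup>m\<close> stands for the functional \<open>f \<mapsto> \<Sum>m. c\<^sub>m f(m)\<close>, so that multiplication
  by \<open>T\<close> is a shift and \<open>(T - 1)\<^sup>n\<close> is the \<open>n\<close>-th Mahler coefficient.\<close>

inductive_set integral_span :: "'p::prime_card padic poly set \<Rightarrow> 'p padic poly set"
  for G where
  zero: "0 \<in> integral_span G"
| base: "P \<in> G \<Longrightarrow> P \<in> integral_span G"
| add: "P \<in> integral_span G \<Longrightarrow> Q \<in> integral_span G \<Longrightarrow> P + Q \<in> integral_span G"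
| smult: "P \<in> integral_span G \<Longrightarrow> c \<in> padic_integers \<Longrightarrow> smult c P \<in> integral_span G"

lemma integral_span_sum:
  "(\<And>a. a \<in> A \<Longrightarrow> f a \<in> integral_span G) \<Longrightarrow> sum f A \<in> integral_span G"
  by (induction A rule: infinite_finite_induct) (auto intro: integral_span.intros)

lemma integral_span_minus: "P \<in> integral_span G \<Longrightarrow> - P \<in> integral_span G"
  using integral_span.smult[of P G "- 1"] padic_integers_minus[OF padic_integers_1] by simp

lemma integral_span_diff: "P \<in> integral_span G \<Longrightarrow> Q \<in> integral_span G \<Longrightarrow> P - Q \<in> integral_span G"
  using integral_span.add[OF _ integral_span_minus, of P G Q] by simp

lemma scaled_span_sum:
  assumes "\<And>a. a \<in> A \<Longrightarrow> f a \<in> smult d ` integral_span G"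
  shows "sum f A \<in> smult d ` integral_span G"
proof -
  have "\<forall>a\<in>A. \<exists>P. P \<in> integral_span G \<and> f a = smult d P" using assms by blast
  then obtain P where P: "\<And>a. a \<in> A \<Longrightarrow> P a \<in> integral_span G" "\<And>a. a \<in> A \<Longrightarrow> f a = smult d (P a)"
    by metis
  have "smult d (sum P B) = (\<Sum>a\<in>B. smult d (P a))" for B
    by (induction B rule: infinite_finite_induct) (simp_all add: smult_add_right)
  then have "sum f A = smult d (sum P A)" using P(2) by simp
  then show ?thesis using P(1) integral_span_sum by blast
qed

lemma scaled_span_add:
  assumes "P \<in> smult d ` integral_span G" "Q \<in> smult d ` integral_span G"
  shows "P + Q \<in> smult d ` integral_span G"
proof -
  obtain P' Q' where "P' \<in> integral_span G" "Q' \<in> integral_span G" "P = smult d P'" "Q = smult d Q'"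
    using assms by blast
  then show ?thesis by (intro image_eqI[of _ _ "P' + Q'"]) (auto intro: integral_span.add simp: smult_add_right)
qed

lemma scaled_span_smult:
  assumes "P \<in> smult d ` integral_span G" "c \<in> padic_integers"
  shows "smult c P \<in> smult d ` integral_span G"
proof -
  obtain P' where "P' \<in> integral_span G" "P = smult d P'" using assms by blast
  then show ?thesis using assms(2)
    by (intro image_eqI[of _ _ "smult c P'"]) (auto intro: integral_span.smult simp: mult.commute)
qed

text \<open>Multiplication by \<open>A\<close> is linear, and the multiples of \<open>d\<close> in
  the span of \<open>H\<close> form a module over the p-adic integers, so generators decide.\<close>

lemma integral_span_mult_closed:
  assumes "P \<in> integral_span G" and "\<And>Q. Q \<in> G \<Longrightarrow> A * Q \<in> smult d ` integral_span H"
  shows "A * P \<in> smult d ` integral_span H"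
  using assms(1)
proof induction
  case zero
  show ?case by (intro image_eqI[of _ _ 0]) (auto intro: integral_span.zero)
next
  case (smult P c)
  then show ?case by (simp add: scaled_span_smult)
qed (auto simp: distrib_left intro: scaled_span_add assms(2))

text \<open>The polynomial that encodes the functional taking f to its divided difference at the
  points of S; a set with \<open>Suc k\<close> points gives order k.\<close>

definition nat_difference :: "nat set \<Rightarrow> 'p::prime_card padic poly" where
  "nat_difference S = (\<Sum>a\<in>S. monom (dcoef of_nat S a) a)"

abbreviation nat_differences :: "nat \<Rightarrow> 'p::prime_card padic poly set" where
  "nat_differences k \<equiv> nat_difference ` {S. finite S \<and> card S = Suc k}"

abbreviation difference_span :: "nat \<Rightarrow> 'p::prime_card padic poly set" where
  "difference_span k \<equiv> integral_span (nat_differences k)"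

lemma coeff_nat_difference:
  "finite S \<Longrightarrow> coeff (nat_difference S) m = (if m \<in> S then dcoef of_nat S m else 0)"
  by (simp add: nat_difference_def coeff_sum coeff_monom)

lemma nat_difference_exchange:
  fixes S :: "nat set"
  assumes "finite S" "a \<notin> S" "b \<notin> S" "a \<noteq> b"
  shows "nat_difference (insert a S) - nat_difference (insert b S) =
    smult (of_nat a - of_nat b) (nat_difference (insert a (insert b S)) :: 'p::prime_card padic poly)"
proof (rule poly_eqI)
  fix m
  show "coeff (nat_difference (insert a S) - nat_difference (insert b S)) m =
    coeff (smult (of_nat a - of_nat b) (nat_difference (insert a (insert b S)) :: 'p padic poly)) m"
  proof (cases "m \<in> insert a (insert b S)")
    case True
    have "inj_on (of_nat :: nat \<Rightarrow> 'p padic) (insert a (insert b S))" by (simp add: inj_on_def)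
    then show ?thesis
      using dcoef_exchange[of S a b "of_nat :: nat \<Rightarrow> 'p padic" m] assms True by (simp add: coeff_nat_difference)
  qed (use assms in \<open>auto simp: coeff_nat_difference\<close>)
qed

lemma nat_difference_shift:
  "monom 1 h * nat_difference S = (nat_difference ((+) h ` S) :: 'p::prime_card padic poly)"
proof -
  have d: "dcoef of_nat ((+) h ` S) (h + a) = (dcoef of_nat S a :: 'p padic)" for a
  proof -
    have "(+) h ` S - {h + a} = (+) h ` (S - {a})" by auto
    then show ?thesis
      unfolding dcoef_def by (intro prod.reindex_cong[of "(+) h"]) auto
  qed
  have "(nat_difference ((+) h ` S) :: 'p padic poly) = (\<Sum>a\<in>S. monom (dcoef of_nat ((+) h ` S) (h + a)) (h + a))"
    unfolding nat_difference_def by (intro sum.reindex_cong[of "(+) h"]) auto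
  then show ?thesis by (simp add: nat_difference_def sum_distrib_left mult_monom d)
qed

text \<open>Shifting the points one at a time, starting with the largest, keeps them distinct.\<close>

lemma shift_nat_difference:
  assumes S: "finite S" "card S = Suc k" and h: "h > 0"
  shows "(monom 1 h - 1) * (nat_difference S :: 'p::prime_card padic poly)
    \<in> smult (of_nat h) ` difference_span (Suc k)"
proof -
  let ?d = "nat_difference :: nat set \<Rightarrow> 'p padic poly"
  \<comment> \<open>\<open>U c\<close> is the stage at which exactly the points from c on have been
    moved by h. The steps telescope from \<open>U 0\<close>, the shifted set, to S itself, which is
    reached once c exceeds all points.\<close>
  define U where "U c = (+) h ` {x\<in>S. c \<le> x} \<union> {x\<in>S. x < c}" for c
  have step: "?d (U c) - ?d (U (Suc c)) \<in> smult (of_nat h) ` difference_span (Suc k)" for c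
  proof (cases "c \<in> S")
    case False
    then have "{x\<in>S. c \<le> x} = {x\<in>S. Suc c \<le> x}" "{x\<in>S. x < c} = {x\<in>S. x < Suc c}"
      by (auto simp: Suc_le_eq less_Suc_eq order_le_less)
    then have "U c = U (Suc c)" by (simp add: U_def)
    then show ?thesis by (intro image_eqI[of _ _ 0]) (auto intro: integral_span.zero)
  next
    case True
    define R where "R = (+) h ` {x\<in>S. c < x} \<union> {x\<in>S. x < c}"
    have U: "U c = insert (h + c) R" "U (Suc c) = insert c R"
      using True unfolding U_def R_def by (auto simp: order_le_less less_Suc_eq Suc_le_eq)
    \<comment> \<open>The points above c have already moved beyond h + c and those below c have not
      moved, so neither h + c nor c collides with another point.\<close>
    have R: "finite R" "h + c \<notin> R" "c \<notin> R" using S h by (auto simp: R_def)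
    have "card R = card ((+) h ` {x\<in>S. c < x}) + card {x\<in>S. x < c}"
      unfolding R_def using S by (intro card_Un_disjoint) auto
    also have "card ((+) h ` {x\<in>S. c < x}) = card {x\<in>S. c < x}" by (intro card_image) simp
    also have "card {x\<in>S. c < x} + card {x\<in>S. x < c} = card ({x\<in>S. c < x} \<union> {x\<in>S. x < c})"
      using S by (intro card_Un_disjoint[symmetric]) auto
    also have "{x\<in>S. c < x} \<union> {x\<in>S. x < c} = S - {c}" by auto
    finally have "card R = k" using S True by simp
    then have "insert (h + c) (insert c R) \<in> {S. finite S \<and> card S = Suc (Suc k)}" using R h by auto
    then have "?d (insert (h + c) (insert c R)) \<in> difference_span (Suc k)"
      by (intro integral_span.base imageI)
    moreover have "?d (U c) - ?d (U (Suc c)) = smult (of_nat h) (?d (insert (h + c) (insert c R)))"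
      unfolding U using nat_difference_exchange[OF R(1,2,3)] h by simp
    ultimately show ?thesis by blast
  qed
  have "(\<Sum>c<n. ?d (U c) - ?d (U (Suc c))) = ?d (U 0) - ?d (U n)" for n
    by (induction n) auto
  then have "?d (U 0) - ?d (U (Suc (Max S))) \<in> smult (of_nat h) ` difference_span (Suc k)"
    by (metis (no_types, lifting) scaled_span_sum step)
  moreover have "U (Suc (Max S)) = S"
  proof -
    have "x < Suc (Max S)" if "x \<in> S" for x using Max_ge[OF S(1) that] by simp
    then have "{x\<in>S. Suc (Max S) \<le> x} = {}" "{x\<in>S. x < Suc (Max S)} = S" by fastforce+
    then show ?thesis unfolding U_def by blast
  qed
  moreover have "U 0 = (+) h ` S" by (simp add: U_def)
  ultimately show ?thesis by (simp add: left_diff_distrib nat_difference_shift)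
qed

lemma shift_integral_span:
  fixes P :: "'p::prime_card padic poly"
  assumes "P \<in> difference_span k"
  shows "(monom 1 h - 1) * P \<in> smult (of_nat h) ` difference_span (Suc k)"
proof (cases "h = 0")
  case True
  then show ?thesis by (intro image_eqI[of _ _ 0]) (auto intro: integral_span.zero simp: monom_0 one_pCons)
next
  case False
  then show ?thesis using assms by (intro integral_span_mult_closed[of P]) (auto intro: shift_nat_difference)
qed

lemma monom_mult_integral_span:
  fixes P :: "'p::prime_card padic poly"
  assumes "P \<in> difference_span k"
  shows "monom 1 h * P \<in> difference_span k"
proof -
  have "monom 1 h * P \<in> smult 1 ` difference_span k"
  proof (rule integral_span_mult_closed[OF assms], safe)
    fix S :: "nat set" assume S: "finite S" "card S = Suc k"
    have "card ((+) h ` S) = card S" by (intro card_image) simp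
    then show "monom 1 h * nat_difference S \<in> smult 1 ` difference_span k"
      using S unfolding nat_difference_shift by (auto intro!: integral_span.base image_eqI)
  qed
  then show ?thesis by simp
qed

abbreviation delta :: "'p::prime_card padic poly" where "delta \<equiv> [:- 1, 1:]"

lemma delta_eq: "delta = monom 1 1 - 1"
  by (simp add: monom_altdef one_pCons)

lemma delta_power_mult_integral_span:
  fixes P :: "'p::prime_card padic poly"
  assumes "P \<in> difference_span k"
  shows "delta ^ n * P \<in> difference_span k"
proof (induction n)
  case (Suc n)
  then show ?case
    using integral_span_diff[OF monom_mult_integral_span[OF Suc, of 1] Suc]
    by (simp only: power_Suc mult.assoc delta_eq left_diff_distrib mult_1)
qed (simp add: assms)

lemma delta_power_expand:
  "delta ^ n = (\<Sum>j\<le>n. smult (of_nat (n choose j) * (- 1) ^ (n - j)) (monom 1 j :: 'p::prime_card padic poly))"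
proof -
  have "(delta :: 'p padic poly) ^ n = (monom 1 1 + (- 1)) ^ n" by (simp add: delta_eq)
  also have "\<dots> = (\<Sum>j\<le>n. of_nat (n choose j) * monom 1 1 ^ j * (- 1) ^ (n - j))" by (rule binomial_ring)
  also have "\<dots> = (\<Sum>j\<le>n. smult (of_nat (n choose j) * (- 1) ^ (n - j)) (monom 1 j))"
  proof (intro sum.cong refl)
    fix j
    have "(- 1) ^ (n - j) = ([:(- 1) ^ (n - j):] :: 'p padic poly)"
      by (simp add: one_pCons minus_pCons poly_const_pow)
    then show "of_nat (n choose j) * monom 1 1 ^ j * (- 1) ^ (n - j) =
        smult (of_nat (n choose j) * (- 1) ^ (n - j)) (monom 1 j :: 'p padic poly)"
      by (simp add: of_nat_poly monom_power mult_ac)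
  qed
  finally show ?thesis .
qed

lemma signed_binomial_padic_integer: "of_nat m * (- 1) ^ j \<in> padic_integers"
proof -
  have "of_int (int m * (- 1) ^ j) \<in> padic_integers" by (rule of_int_integer)
  then show ?thesis by simp
qed

text \<open>The factor \<open>n\<close> comes from \<open>(n choose j) * j = n * ((n - 1) choose (j - 1))\<close>.\<close>

lemma delta_power_gain:
  fixes P :: "'p::prime_card padic poly"
  assumes "P \<in> difference_span k" and n: "n > 0"
  shows "delta ^ n * P \<in> smult (of_nat n) ` difference_span (Suc k)"
proof -
  let ?c = "\<lambda>j. of_nat (n choose j) * (- 1) ^ (n - j) :: 'p padic"
  \<comment> \<open>Since the coefficients of (T - 1)^n sum to 0 for n > 0, each T^j may be replaced
    by T^j - 1, which yields a factor j.\<close>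
  have "(\<Sum>j\<le>n. ?c j) = (1 + - 1) ^ n" by (subst binomial_ring) simp
  then have c0: "(\<Sum>j\<le>n. ?c j) = 0" using n by simp
  have "delta ^ n * P = (\<Sum>j\<le>n. smult (?c j) (monom 1 j * P))"
    by (simp add: delta_power_expand sum_distrib_right)
  also have "\<dots> = (\<Sum>j\<le>n. smult (?c j) ((monom 1 j - 1) * P)) + smult (\<Sum>j\<le>n. ?c j) P"
    by (simp add: left_diff_distrib smult_diff_right sum_subtractf smult_sum)
  also have "\<dots> = (\<Sum>j\<le>n. smult (?c j) ((monom 1 j - 1) * P))" by (simp add: c0)
  also have "\<dots> \<in> smult (of_nat n) ` difference_span (Suc k)"
  proof (rule scaled_span_sum)
    fix j assume j: "j \<in> {..n}"
    obtain Q where Q: "(monom 1 j - 1) * P = smult (of_nat j) Q" "Q \<in> difference_span (Suc k)"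
      using shift_integral_span[OF assms(1), of j] by blast
    show "smult (?c j) ((monom 1 j - 1) * P) \<in> smult (of_nat n) ` difference_span (Suc k)"
    proof (cases "j = 0")
      case True
      then show ?thesis using Q by (intro image_eqI[of _ _ 0]) (auto intro: integral_span.zero)
    next
      case False
      have "j * (n choose j) = n * ((n - 1) choose (j - 1))"
        using binomial_absorption[of "j - 1" "n"] False by simp
      then have "of_nat j * of_nat (n choose j) = (of_nat n * of_nat ((n - 1) choose (j - 1)) :: 'p padic)"
        by (metis of_nat_mult)
      then have "smult (?c j) (smult (of_nat j) Q) =
          smult (of_nat n) (smult (of_nat ((n - 1) choose (j - 1)) * (- 1) ^ (n - j)) Q)"
        by (simp add: algebra_simps flip: mult.assoc)
      then show ?thesis unfolding Q(1)
        using integral_span.smult[OF Q(2) signed_binomial_padic_integer[of "(n - 1) choose (j - 1)" "n - j"]] by blast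
    qed
  qed
  finally show ?thesis .
qed

lemma one_in_integral_span: "1 \<in> difference_span 0"
proof -
  have "nat_difference {0} = (1 :: 'a padic poly)" by (simp add: nat_difference_def dcoef_def monom_0 one_pCons)
  then show ?thesis by (auto intro!: integral_span.base image_eqI[of _ _ "{0}"])
qed

text \<open>Each of k blocks (T - 1)^n raises the order by one and contributes a factor n; the
  surplus power of T - 1 maps the span of order k into itself.\<close>

lemma delta_power_integral_span:
  assumes n: "n > 0" and m: "k * n \<le> m"
  shows "(delta :: 'p::prime_card padic poly) ^ m \<in> smult (of_nat n ^ k) ` difference_span k"
proof -
  let ?delta = "delta :: 'p padic poly"
  have *: "?delta ^ (k * n) \<in> smult (of_nat n ^ k) ` difference_span k"
  proof (induction k)
    case 0
    then show ?case by (simp add: one_in_integral_span)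
  next
    case (Suc k)
    then obtain P where P: "P \<in> difference_span k" "?delta ^ (k * n) = smult (of_nat n ^ k) P" by blast
    obtain Q where Q: "Q \<in> difference_span (Suc k)" "?delta ^ n * P = smult (of_nat n) Q"
      using delta_power_gain[OF P(1) n] by blast
    have "?delta ^ (Suc k * n) = smult (of_nat n ^ Suc k) Q"
      using P(2) Q(2) by (simp add: power_add mult_ac)
    then show ?case using Q(1) by blast
  qed
  obtain P where P: "P \<in> difference_span k" "?delta ^ (k * n) = smult (of_nat n ^ k) P" using * by blast
  have "?delta ^ m = ?delta ^ (m - k * n) * ?delta ^ (k * n)" using m by (simp flip: power_add)
  then have "?delta ^ m = smult (of_nat n ^ k) (?delta ^ (m - k * n) * P)" by (simp add: P(2))
  then show ?thesis using delta_power_mult_integral_span[OF P(1)] by blast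
qed

text \<open>Generators on which a functional becomes small: increments of divided differences under
  the shift by p^r, controlled by uniform continuity, and p^t times divided differences, controlled
  by boundedness.\<close>

abbreviation small_differences :: "nat \<Rightarrow> nat \<Rightarrow> nat \<Rightarrow> 'p::prime_card padic poly set" where
  "small_differences r t k \<equiv>
     (\<lambda>S. (monom 1 (CARD('p) ^ r) - 1) * nat_difference S) ` {S. finite S \<and> card S = Suc k} \<union>
     smult (of_nat CARD('p) ^ t) ` nat_differences k"

lemma mult_small_differences:
  fixes P :: "'p::prime_card padic poly"
  assumes "P \<in> difference_span k"
  shows "(monom 1 (CARD('p) ^ r) - 1) * P \<in> integral_span (small_differences r t k)"
    and "smult (of_nat CARD('p) ^ t) P \<in> integral_span (small_differences r t k)"
proof -
  have "(monom 1 (CARD('p) ^ r) - 1) * P \<in> smult 1 ` integral_span (small_differences r t k)"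
    by (rule integral_span_mult_closed[OF assms]) (auto intro!: integral_span.base)
  then show "(monom 1 (CARD('p) ^ r) - 1) * P \<in> integral_span (small_differences r t k)" by simp
  have "[:of_nat CARD('p) ^ t:] * P \<in> smult 1 ` integral_span (small_differences r t k)"
    by (rule integral_span_mult_closed[OF assms]) (auto intro!: integral_span.base)
  then show "smult (of_nat CARD('p) ^ t) P \<in> integral_span (small_differences r t k)" by simp
qed

text \<open>By absorption, p^r divides j (p^r choose j). If p did not divide the binomial
  coefficient, p^r would divide j < p^r.\<close>

lemma prime_dvd_prime_power_choose:
  assumes "prime (p :: nat)" "0 < j" "j < p ^ r"
  shows "p dvd (p ^ r choose j)"
proof (rule ccontr)
  assume "\<not> p dvd (p ^ r choose j)"
  then have "coprime (p ^ r) (p ^ r choose j)" using assms(1) by (simp add: prime_imp_coprime)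
  moreover have "p ^ r dvd j * (p ^ r choose j)"
    using binomial_absorption[of "j - 1" "p ^ r"] assms(2) by simp
  ultimately have "p ^ r dvd j" by (simp add: coprime_dvd_mult_left_iff)
  then show False using assms by (simp add: dvd_imp_le leD)
qed

text \<open>With q = p^r, the inner binomial coefficients are divisible by p, and so is the
  discrepancy between the constant terms (-1)^q and -1. \<open>Q\<close> stays in the same span
  because shifts preserve it.\<close>

lemma delta_prime_power:
  fixes P :: "'p::prime_card padic poly"
  assumes "P \<in> difference_span k"
  obtains Q where "Q \<in> difference_span k"
    "delta ^ (CARD('p) ^ r) * P = (monom 1 (CARD('p) ^ r) - 1) * P + smult (of_nat CARD('p)) Q"
proof -
  let ?n = "CARD('p) ^ r"
  let ?c = "\<lambda>j. of_nat (?n choose j) * (- 1) ^ (?n - j) :: 'p padic"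
  have n: "?n > 0" using CARD_gt_1[where ?'p = 'p] by simp
  define S where "S = smult (?c 0 + 1) P + (\<Sum>j\<in>{0<..<?n}. smult (?c j) (monom 1 j * P))"
  have "delta ^ ?n * P = (\<Sum>j\<le>?n. smult (?c j) (monom 1 j * P))"
    by (simp add: delta_power_expand sum_distrib_right)
  also have "{..?n} = insert 0 (insert ?n {0<..<?n})" using n by auto
  also have "(\<Sum>j\<in>insert 0 (insert ?n {0<..<?n}). smult (?c j) (monom 1 j * P)) =
     smult (?c 0) P + monom 1 ?n * P + (\<Sum>j\<in>{0<..<?n}. smult (?c j) (monom 1 j * P))"
    using n by (simp add: monom_0)
  also have "\<dots> = (monom 1 ?n - 1) * P + S" by (simp add: S_def algebra_simps smult_add_left)
  finally have 1: "delta ^ ?n * P = (monom 1 ?n - 1) * P + S" .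
  have c: "\<exists>e. int (CARD('p)) * e = int (?n choose j) * (- 1) ^ (?n - j)" if "j \<in> {0<..<?n}" for j
    using prime_dvd_prime_power_choose[OF prime_card, of j r, where ?'a1 = 'p] that by (metis dvdE dvd_mult2 greaterThanLessThan_iff int_dvd_int_iff)
  \<comment> \<open>For odd p the sum is 0; for p = 2 it is 2, or 0 if r = 0.\<close>
  have c0: "\<exists>e. int (CARD('p)) * e = int (?n choose 0) * (- 1) ^ (?n - 0) + 1"
  proof (cases "CARD('p) = 2")
    case True
    then show ?thesis by (cases r) (auto intro: exI[of _ 1] exI[of _ 0])
  next
    case False
    then have "odd ?n" using prime_card[where ?'a = 'p] by (metis even_power prime_odd_nat prime_ge_2_nat le_neq_implies_less)
    then show ?thesis by (intro exI[of _ 0]) simp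
  qed
  have toQ: "smult (of_int c) R \<in> smult (of_nat CARD('p)) ` difference_span k"
    if e: "int (CARD('p)) * e = c" and R: "R \<in> difference_span k" for e c and R :: "'p padic poly"
    using R by (intro image_eqI[of _ _ "smult (of_int e) R"]) (auto intro: integral_span.smult simp flip: e)
  have "smult (of_int (int (?n choose j) * (- 1) ^ (?n - j))) (monom 1 j * P) \<in> smult (of_nat CARD('p)) ` difference_span k"
    if "j \<in> {0<..<?n}" for j
    using c[OF that] toQ monom_mult_integral_span[OF assms] by blast
  then have "(\<Sum>j\<in>{0<..<?n}. smult (?c j) (monom 1 j * P)) \<in> smult (of_nat CARD('p)) ` difference_span k"
    by (intro scaled_span_sum) simp
  moreover have "smult (of_int (int (?n choose 0) * (- 1) ^ (?n - 0) + 1)) P \<in> smult (of_nat CARD('p)) ` difference_span k"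
    using c0 toQ assms by blast
  ultimately have "S \<in> smult (of_nat CARD('p)) ` difference_span k"
    unfolding S_def by (intro scaled_span_add) simp_all
  then show ?thesis using that 1 by blast
qed

text \<open>With q = p^r, each further factor (T - 1)^q preserves the multiples of T^q - 1 and
  splits the remainder into such a multiple and a part with one more factor p.\<close>

lemma delta_power_small:
  fixes P :: "'p::prime_card padic poly"
  assumes "P \<in> difference_span k"
  shows "delta ^ (CARD('p) ^ r * t) * P \<in> integral_span (small_differences r t k)"
proof -
  let ?n = "CARD('p) ^ r"
  have "\<exists>A\<in>difference_span k. \<exists>B\<in>difference_span k.
      delta ^ (?n * t) * P = (monom 1 ?n - 1) * A + smult (of_nat CARD('p) ^ t) B"
  proof (induction t)
    case 0
    show ?case
      by (rule bexI[of _ 0], rule bexI[of _ P]) (simp_all add: assms integral_span.zero)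
  next
    case (Suc t)
    then obtain A B where A: "A \<in> difference_span k" and B: "B \<in> difference_span k"
      and e: "delta ^ (?n * t) * P = (monom 1 ?n - 1) * A + smult (of_nat CARD('p) ^ t) B" by blast
    obtain Q where Q: "Q \<in> difference_span k"
      "delta ^ ?n * B = (monom 1 ?n - 1) * B + smult (of_nat CARD('p)) Q" by (rule delta_prime_power[OF B, of r])
    have pint: "of_nat CARD('p) ^ t \<in> (padic_integers :: 'p padic set)"
      using of_nat_integer[of "CARD('p) ^ t"] by simp
    have "delta ^ (?n * Suc t) * P = delta ^ ?n * (delta ^ (?n * t) * P)"
      by (simp add: power_add mult.assoc)
    also have "\<dots> = (monom 1 ?n - 1) * (delta ^ ?n * A) + smult (of_nat CARD('p) ^ t) (delta ^ ?n * B)"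
      unfolding e by (simp add: distrib_left mult.left_commute)
    also have "\<dots> = (monom 1 ?n - 1) * (delta ^ ?n * A + smult (of_nat CARD('p) ^ t) B) + smult (of_nat CARD('p) ^ Suc t) Q"
      unfolding Q(2) by (simp add: distrib_left smult_add_right mult.commute)
    finally show ?case
      using integral_span.add[OF delta_power_mult_integral_span[OF A] integral_span.smult[OF B pint]] Q(1) by blast
  qed
  then obtain A B where "A \<in> difference_span k" "B \<in> difference_span k"
    "delta ^ (?n * t) * P = (monom 1 ?n - 1) * A + smult (of_nat CARD('p) ^ t) B" by blast
  then show ?thesis by (simp only:) (intro integral_span.add mult_small_differences)
qed

subsection \<open>Topologies defined by ultrametric seminorms\<close>

text \<open>The laws are required on \<open>S\<close> only, because a weighted supremum is
  meaningful only for bounded families. The predicate \<open>ultrametric_seminorm\<close> would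
  impose them on the whole ambient space.\<close>

locale seminormed = vector_space sc
  for sc :: "'p::prime_card padic \<Rightarrow> 'v::ab_group_add \<Rightarrow> 'v" +
  fixes S :: "'v set" and Q :: "('v \<Rightarrow> real) set"
  assumes subspace_S: "subspace S"
    and nonneg: "q \<in> Q \<Longrightarrow> x \<in> S \<Longrightarrow> 0 \<le> q x"
    and scale_eq: "q \<in> Q \<Longrightarrow> x \<in> S \<Longrightarrow> q (sc c x) = padic_norm c * q x"
    and ultra: "q \<in> Q \<Longrightarrow> x \<in> S \<Longrightarrow> y \<in> S \<Longrightarrow> q (x + y) \<le> max (q x) (q y)"
begin

lemma S_closed: "0 \<in> S" "x \<in> S \<Longrightarrow> y \<in> S \<Longrightarrow> x + y \<in> S" "x \<in> S \<Longrightarrow> y \<in> S \<Longrightarrow> x - y \<in> S"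
  "x \<in> S \<Longrightarrow> sc c x \<in> S"
  using subspace_0 subspace_add subspace_diff subspace_scale subspace_S by auto

lemma seminorm_0: "q \<in> Q \<Longrightarrow> q 0 = 0"
  using scale_eq[of q 0 0] S_closed(1) by simp

lemma seminorm_minus: "q \<in> Q \<Longrightarrow> x \<in> S \<Longrightarrow> q (- x) = q x"
  using scale_eq[of q x "- 1"] by (simp add: padic_norm_uminus)

lemma seminorm_minus_commute: "q \<in> Q \<Longrightarrow> x \<in> S \<Longrightarrow> y \<in> S \<Longrightarrow> q (x - y) = q (y - x)"
  using seminorm_minus[of q "y - x"] S_closed(3) by simp

lemma seminorm_diff_ultra: "q \<in> Q \<Longrightarrow> x \<in> S \<Longrightarrow> y \<in> S \<Longrightarrow> z \<in> S \<Longrightarrow> q (x - z) \<le> max (q (x - y)) (q (y - z))"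
  using ultra[of q "x - y" "y - z"] S_closed(3) by simp

definition seminorm_ball :: "('v \<Rightarrow> real) set \<Rightarrow> 'v \<Rightarrow> real \<Rightarrow> 'v set" where
  "seminorm_ball F x \<epsilon> = {y \<in> S. \<forall>q\<in>F. q (y - x) < \<epsilon>}"

abbreviation contains_ball :: "'v \<Rightarrow> 'v set \<Rightarrow> bool" where
  "contains_ball x U \<equiv> \<exists>F \<epsilon>. finite F \<and> F \<subseteq> Q \<and> \<epsilon> > 0 \<and> seminorm_ball F x \<epsilon> \<subseteq> U"

lemma openin_seminorm_ball:
  assumes "finite F" "F \<subseteq> Q" "x \<in> S" "\<epsilon> > 0"
  shows "openin (seminorm_topology S Q) (seminorm_ball F x \<epsilon>)"
  using assms
proof (induction F)
  case empty
  then show ?case unfolding seminorm_topology_def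
    by (simp add: seminorm_ball_def topology_generated_by_Basis)
next
  case (insert q F)
  have "openin (seminorm_topology S Q) {y \<in> S. q (y - x) < \<epsilon>}"
    unfolding seminorm_topology_def using insert.prems by (intro topology_generated_by_Basis) auto
  moreover have "seminorm_ball (insert q F) x \<epsilon> = {y \<in> S. q (y - x) < \<epsilon>} \<inter> seminorm_ball F x \<epsilon>"
    by (auto simp: seminorm_ball_def)
  ultimately show ?case using insert by (metis insert_subset openin_Int)
qed

lemma in_seminorm_ball: "F \<subseteq> Q \<Longrightarrow> x \<in> S \<Longrightarrow> \<epsilon> > 0 \<Longrightarrow> x \<in> seminorm_ball F x \<epsilon>"
  by (auto simp: seminorm_ball_def subset_iff seminorm_0)

lemma topspace_seminorm_topology: "topspace (seminorm_topology S Q) = S"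
  unfolding seminorm_topology_def topology_generated_by_topspace by auto

text \<open>By the ultrametric inequality every point of a subbasic ball is again a centre of it
  with the same radius. So finite intersections of balls about a point form a neighbourhood basis
  there.\<close>

lemma openin_seminorm_topology:
  "openin (seminorm_topology S Q) U \<longleftrightarrow>
    U \<subseteq> S \<and> (\<forall>x\<in>U. contains_ball x U)"
proof
  assume U: "openin (seminorm_topology S Q) U"
  then have "generate_topology_on (insert S {{y \<in> S. q (y - x) < \<epsilon>} | q x \<epsilon>. q \<in> Q \<and> x \<in> S \<and> 0 < \<epsilon>}) U"
    by (simp add: seminorm_topology_def openin_topology_generated_by)
  then have "\<forall>x\<in>U. contains_ball x U"
  proof induction
    case (Int A B)
    show ?case
    proof
      fix x assume "x \<in> A \<inter> B"
      then obtain F G \<delta> \<epsilon> where "finite F" "F \<subseteq> Q" "\<delta> > 0" "seminorm_ball F x \<delta> \<subseteq> A"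
        "finite G" "G \<subseteq> Q" "\<epsilon> > 0" "seminorm_ball G x \<epsilon> \<subseteq> B" using Int.IH by (meson IntD1 IntD2)
      moreover have "seminorm_ball (F \<union> G) x (min \<delta> \<epsilon>) \<subseteq> seminorm_ball F x \<delta> \<inter> seminorm_ball G x \<epsilon>"
        by (auto simp: seminorm_ball_def)
      ultimately show "contains_ball x (A \<inter> B)"
        by (intro exI[of _ "F \<union> G"] exI[of _ "min \<delta> \<epsilon>"]) auto
    qed
  next
    case (UN K)
    show ?case
    proof
      fix x assume "x \<in> \<Union>K"
      then obtain k where k: "k \<in> K" "x \<in> k" by blast
      then obtain F \<epsilon> where "finite F \<and> F \<subseteq> Q \<and> \<epsilon> > 0 \<and> seminorm_ball F x \<epsilon> \<subseteq> k" using UN.IH by meson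
      then show "contains_ball x (\<Union>K)" using k by blast
    qed
  next
    case (Basis s)
    show ?case
    proof
      fix x assume x: "x \<in> s"
      consider "s = S" | q z \<epsilon> where "s = {y \<in> S. q (y - z) < \<epsilon>}" "q \<in> Q" "z \<in> S" "0 < \<epsilon>"
        using Basis by auto
      then show "contains_ball x s"
      proof cases
        case 1
        then show ?thesis by (intro exI[of _ "{}"] exI[of _ 1]) (auto simp: seminorm_ball_def)
      next
        case 2
        have "q (y - z) < \<epsilon>" if "y \<in> S" "q (y - x) < \<epsilon>" for y
          using seminorm_diff_ultra[of q y x z] 2 x that by auto
        then show ?thesis using 2 by (intro exI[of _ "{q}"] exI[of _ \<epsilon>]) (auto simp: seminorm_ball_def)
      qed
    qed
  qed auto
  then show "U \<subseteq> S \<and> (\<forall>x\<in>U. contains_ball x U)"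
    using openin_subset[OF U] topspace_seminorm_topology by auto
next
  assume U: "U \<subseteq> S \<and> (\<forall>x\<in>U. contains_ball x U)"
  show "openin (seminorm_topology S Q) U"
  proof (subst openin_subopen, intro ballI)
    fix x assume x: "x \<in> U"
    then obtain F \<epsilon> where F: "finite F" "F \<subseteq> Q" "\<epsilon> > 0" "seminorm_ball F x \<epsilon> \<subseteq> U" using U by meson
    have "x \<in> S" using x U by blast
    then show "\<exists>T. openin (seminorm_topology S Q) T \<and> x \<in> T \<and> T \<subseteq> U"
      using F openin_seminorm_ball[of F x \<epsilon>] in_seminorm_ball[of F x \<epsilon>] by blast
  qed
qed

lemma tvs_on_seminorm_topology:
  assumes separated: "\<And>x. x \<in> S \<Longrightarrow> x \<noteq> 0 \<Longrightarrow> \<exists>q\<in>Q. q x > 0"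
  shows "tvs_on sc (seminorm_topology S Q)"
  unfolding tvs_on_def topspace_seminorm_topology
proof (intro conjI)
  let ?T = "seminorm_topology S Q"
  show "vector_space sc" by (rule vector_space_axioms)
  show "subspace S" by (rule subspace_S)
  show "Hausdorff_space ?T"
    unfolding Hausdorff_space_def topspace_seminorm_topology
  proof (intro allI impI, elim conjE)
    fix x y assume xy: "x \<in> S" "y \<in> S" "x \<noteq> y"
    then obtain q where q: "q \<in> Q" "q (x - y) > 0" using separated[of "x - y"] S_closed(3) by auto
    let ?B = "\<lambda>z. seminorm_ball {q} z (q (x - y))"
    have "disjnt (?B x) (?B y)"
    proof (unfold disjnt_iff, intro allI notI, elim conjE)
      fix z assume "z \<in> ?B x" "z \<in> ?B y"
      then have "q (x - z) < q (x - y)" "q (z - y) < q (x - y)" "z \<in> S"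
        using q(1) xy seminorm_minus_commute[of q x z] by (auto simp: seminorm_ball_def)
      then show False using seminorm_diff_ultra[of q x z y] q xy by simp
    qed
    then show "\<exists>U V. openin ?T U \<and> openin ?T V \<and> x \<in> U \<and> y \<in> V \<and> disjnt U V"
      using q xy openin_seminorm_ball[of "{q}"] in_seminorm_ball[of "{q}"]
      by (intro exI[of _ "?B x"] exI[of _ "?B y"]) auto
  qed
  show "continuous_map (prod_topology ?T ?T) ?T (\<lambda>(x, y). x + y)"
    unfolding continuous_map_def openin_prod_topology_alt topspace_prod_topology topspace_seminorm_topology
  proof (intro conjI allI impI)
    show "(\<lambda>(x, y). x + y) \<in> S \<times> S \<rightarrow> S" by (auto intro: S_closed)
    fix U x y assume U: "openin ?T U" and xy: "(x, y) \<in> {x \<in> S \<times> S. (case x of (x, y) \<Rightarrow> x + y) \<in> U}"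
    then have S: "x \<in> S" "y \<in> S" "x + y \<in> U" by auto
    then obtain F \<epsilon> where F: "finite F" "F \<subseteq> Q" "\<epsilon> > 0" "seminorm_ball F (x + y) \<epsilon> \<subseteq> U"
      using U unfolding openin_seminorm_topology by meson
    have "u + v \<in> seminorm_ball F (x + y) \<epsilon>" if "u \<in> seminorm_ball F x \<epsilon>" "v \<in> seminorm_ball F y \<epsilon>" for u v
      using that S F(2) ultra[of _ "u - x" "v - y"] S_closed
      by (fastforce simp: seminorm_ball_def add_diff_add)
    then show "\<exists>A B. openin ?T A \<and> openin ?T B \<and> x \<in> A \<and> y \<in> B \<and> A \<times> B \<subseteq> {x \<in> S \<times> S. (case x of (x, y) \<Rightarrow> x + y) \<in> U}"
      using F S openin_seminorm_ball in_seminorm_ball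
      by (intro exI[of _ "seminorm_ball F x \<epsilon>"] exI[of _ "seminorm_ball F y \<epsilon>"]) (auto simp: seminorm_ball_def)
  qed
  show "continuous_map (prod_topology euclidean ?T) ?T (\<lambda>(c, x). sc c x)"
    unfolding continuous_map_def openin_prod_topology_alt topspace_prod_topology topspace_seminorm_topology
      topspace_euclidean
  proof (intro conjI allI impI)
    show "(\<lambda>(c, x). sc c x) \<in> UNIV \<times> S \<rightarrow> S" by (auto intro: S_closed)
    fix U c x assume U: "openin ?T U" and cx: "(c, x) \<in> {x \<in> UNIV \<times> S. (case x of (c, x) \<Rightarrow> sc c x) \<in> U}"
    then have S: "x \<in> S" "sc c x \<in> U" by auto
    then obtain F \<epsilon> where F: "finite F" "F \<subseteq> Q" "\<epsilon> > 0" "seminorm_ball F (sc c x) \<epsilon> \<subseteq> U"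
      using U unfolding openin_seminorm_topology by meson
    \<comment> \<open>The estimate rests on d y - c x = d (y - x) + (d - c) x: \<open>K\<close>
      bounds the norm of every d near c, and \<open>M\<close> exceeds all the values q x with q in
      F.\<close>
    define M where "M = 1 + (\<Sum>q\<in>F. q x)"
    have pos: "0 \<le> q x" if "q \<in> F" for q using that F S nonneg by auto
    have M: "q x < M" if "q \<in> F" for q using member_le_sum[of q F "\<lambda>q. q x"] that F(1) pos by (simp add: M_def)
    have M0: "M > 0" unfolding M_def using sum_nonneg[of F "\<lambda>q. q x"] pos by simp
    define K where "K = max (padic_norm c) 1"
    define \<delta> where "\<delta> = min 1 (\<epsilon> / M)"
    have K: "K > 0" "\<delta> > 0" using F(3) M0 by (auto simp: K_def \<delta>_def)
    have "sc d y \<in> seminorm_ball F (sc c x) \<epsilon>" if d: "d \<in> ball c \<delta>" and y: "y \<in> seminorm_ball F x (\<epsilon> / K)" for d y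
      unfolding seminorm_ball_def
    proof (safe)
      show "sc d y \<in> S" using y by (auto simp: seminorm_ball_def intro: S_closed)
      fix q assume q: "q \<in> F"
      then have qQ: "q \<in> Q" using F by auto
      have yS: "y \<in> S" "q (y - x) < \<epsilon> / K" using y q by (auto simp: seminorm_ball_def)
      have d': "padic_norm (d - c) < \<delta>" using d by (simp add: dist_padic_def padic_norm_minus_commute)
      have "padic_norm d \<le> max (padic_norm c) (padic_norm (d - c))" using padic_norm_ultra[of c "d - c"] by simp
      also have "\<dots> \<le> K" using d' by (auto simp: K_def \<delta>_def)
      finally have "padic_norm d * q (y - x) \<le> K * q (y - x)" using nonneg[OF qQ S_closed(3)[OF yS(1) S(1)]] by (rule mult_right_mono)
      also have "\<dots> < \<epsilon>" using yS(2) K by (simp add: field_simps)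
      finally have 1: "padic_norm d * q (y - x) < \<epsilon>" .
      have "padic_norm (d - c) * q x \<le> padic_norm (d - c) * M" using M[OF q] by (intro mult_left_mono) (auto simp: padic_norm_nonneg)
      also have "\<dots> < \<delta> * M" using d' M0 by simp
      also have "\<dots> \<le> \<epsilon>" using M0 by (simp add: \<delta>_def min_def field_simps)
      finally have 2: "padic_norm (d - c) * q x < \<epsilon>" .
      have "sc d y - sc c x = sc d (y - x) + sc (d - c) x" by (simp add: scale_right_diff_distrib scale_left_diff_distrib)
      then show "q (sc d y - sc c x) < \<epsilon>"
        using ultra[OF qQ, of "sc d (y - x)" "sc (d - c) x"] 1 2 S_closed yS S scale_eq[OF qQ] by auto
    qed
    then show "\<exists>A B. openin euclidean A \<and> openin ?T B \<and> c \<in> A \<and> x \<in> B \<and>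
        A \<times> B \<subseteq> {x \<in> UNIV \<times> S. (case x of (c, x) \<Rightarrow> sc c x) \<in> U}"
      using F S K openin_seminorm_ball in_seminorm_ball
      by (intro exI[of _ "ball c \<delta>"] exI[of _ "seminorm_ball F x (\<epsilon> / K)"]) (auto simp: seminorm_ball_def)
  qed
qed

end

text \<open>As the seminorms of the source are those of the target composed with \<open>A\<close>,
  the bijection carries balls exactly onto balls, and openness is transported in both
  directions.\<close>

lemma tvs_isomorphism_seminorm_topology:
  assumes 1: "seminormed sc\<^sub>1 S\<^sub>1 Q\<^sub>1" and 2: "seminormed sc\<^sub>2 S\<^sub>2 Q\<^sub>2"
    and sep: "\<And>y. y \<in> S\<^sub>2 \<Longrightarrow> y \<noteq> 0 \<Longrightarrow> \<exists>q\<in>Q\<^sub>2. q y > 0"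
    and bij: "bij_betw A S\<^sub>1 S\<^sub>2" and Q: "Q\<^sub>1 = (\<lambda>q x. q (A x)) ` Q\<^sub>2"
    and add: "\<And>x y. x \<in> S\<^sub>1 \<Longrightarrow> y \<in> S\<^sub>1 \<Longrightarrow> A (x + y) = A x + A y"
    and scale: "\<And>c x. x \<in> S\<^sub>1 \<Longrightarrow> A (sc\<^sub>1 c x) = sc\<^sub>2 c (A x)"
  shows "tvs_isomorphism sc\<^sub>1 (seminorm_topology S\<^sub>1 Q\<^sub>1) sc\<^sub>2 (seminorm_topology S\<^sub>2 Q\<^sub>2) A"
proof -
  interpret S1: seminormed sc\<^sub>1 S\<^sub>1 Q\<^sub>1 by (rule 1)
  interpret S2: seminormed sc\<^sub>2 S\<^sub>2 Q\<^sub>2 by (rule 2)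
  let ?T1 = "seminorm_topology S\<^sub>1 Q\<^sub>1" and ?T2 = "seminorm_topology S\<^sub>2 Q\<^sub>2"
  have A_in: "A x \<in> S\<^sub>2" if "x \<in> S\<^sub>1" for x using bij that by (auto simp: bij_betw_def)
  have inj: "inj_on A S\<^sub>1" and im: "A ` S\<^sub>1 = S\<^sub>2" using bij by (auto simp: bij_betw_def)
  have A0: "A 0 = 0" using scale[of 0 0] S1.S_closed(1) by simp
  have diff: "A (x - y) = A x - A y" if "x \<in> S\<^sub>1" "y \<in> S\<^sub>1" for x y
    using add[of "x - y" y] that S1.S_closed(3) by (simp add: eq_diff_eq)
  have "\<exists>q\<in>Q\<^sub>1. q x > 0" if x: "x \<in> S\<^sub>1" "x \<noteq> 0" for x
  proof -
    have "A x \<noteq> 0" using inj x A0 S1.S_closed(1) by (metis inj_onD)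
    then show ?thesis using sep[OF A_in[OF x(1)]] by (auto simp: Q)
  qed
  then have tvs: "tvs_on sc\<^sub>1 ?T1" "tvs_on sc\<^sub>2 ?T2"
    using S1.tvs_on_seminorm_topology S2.tvs_on_seminorm_topology sep by auto
  have ball: "A ` S1.seminorm_ball ((\<lambda>q x. q (A x)) ` F) x \<epsilon> = S2.seminorm_ball F (A x) \<epsilon>" if "x \<in> S\<^sub>1" for F x \<epsilon>
    unfolding S1.seminorm_ball_def S2.seminorm_ball_def using that diff im[symmetric] by (auto simp: A_in)
  have op: "openin ?T2 (A ` U) \<longleftrightarrow> openin ?T1 U" if U: "U \<subseteq> S\<^sub>1" for U
  proof
    assume o: "openin ?T2 (A ` U)"
    show "openin ?T1 U"
      unfolding S1.openin_seminorm_topology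
    proof (intro conjI ballI U)
      fix x assume x: "x \<in> U"
      then obtain F \<epsilon> where F: "finite F" "F \<subseteq> Q\<^sub>2" "\<epsilon> > 0" "S2.seminorm_ball F (A x) \<epsilon> \<subseteq> A ` U"
        using o unfolding S2.openin_seminorm_topology by (meson imageI)
      let ?F = "(\<lambda>q x. q (A x)) ` F"
      have "A ` S1.seminorm_ball ?F x \<epsilon> \<subseteq> A ` U" using F ball x U by blast
      then have "S1.seminorm_ball ?F x \<epsilon> \<subseteq> U"
        using inj U by (subst (asm) inj_on_image_subset_iff[OF inj]) (auto simp: S1.seminorm_ball_def)
      then show "\<exists>F \<epsilon>. finite F \<and> F \<subseteq> Q\<^sub>1 \<and> \<epsilon> > 0 \<and> S1.seminorm_ball F x \<epsilon> \<subseteq> U"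
        using F Q by (intro exI[of _ ?F] exI[of _ \<epsilon>]) auto
    qed
  next
    assume o: "openin ?T1 U"
    show "openin ?T2 (A ` U)"
      unfolding S2.openin_seminorm_topology
    proof (intro conjI ballI)
      show "A ` U \<subseteq> S\<^sub>2" using U im by auto
      fix y assume "y \<in> A ` U"
      then obtain x where x: "x \<in> U" "y = A x" by auto
      then obtain F \<epsilon> where F: "finite F" "F \<subseteq> Q\<^sub>1" "\<epsilon> > 0" "S1.seminorm_ball F x \<epsilon> \<subseteq> U"
        using o unfolding S1.openin_seminorm_topology by meson
      obtain G where G: "finite G" "G \<subseteq> Q\<^sub>2" "F = (\<lambda>q x. q (A x)) ` G"
        using F(1,2) unfolding Q by (meson finite_subset_image)
      have "S2.seminorm_ball G y \<epsilon> \<subseteq> A ` U" using F(4) ball[of x G \<epsilon>] x U unfolding G(3) by blast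
      then show "\<exists>F \<epsilon>. finite F \<and> F \<subseteq> Q\<^sub>2 \<and> \<epsilon> > 0 \<and> S2.seminorm_ball F y \<epsilon> \<subseteq> A ` U"
        using F G by blast
    qed
  qed
  have "homeomorphic_map ?T1 ?T2 A"
    unfolding homeomorphic_map_def quotient_map_def S1.topspace_seminorm_topology S2.topspace_seminorm_topology
  proof (intro conjI allI impI im inj)
    fix V assume V: "V \<subseteq> S\<^sub>2"
    have "A ` {x \<in> S\<^sub>1. A x \<in> V} = V" using V im by auto
    then show "openin ?T1 {x \<in> S\<^sub>1. A x \<in> V} = openin ?T2 V" using op[of "{x \<in> S\<^sub>1. A x \<in> V}"] by auto
  qed
  then show ?thesis
    unfolding tvs_isomorphism_def S1.topspace_seminorm_topology using tvs add scale by blast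
qed

subsection \<open>Locally convex spaces\<close>

locale lcs =
  fixes sc :: "'p::prime_card padic \<Rightarrow> 'e::{topological_ab_group_add, t2_space} \<Rightarrow> 'e"
  assumes locally_convex: "locally_convex sc"
begin

abbreviation "cs \<equiv> continuous_seminorms sc"

sublocale vector_space sc
  using locally_convex by (simp add: locally_convex_def tvs_on_def)

lemma cs_nonneg: "q \<in> cs \<Longrightarrow> 0 \<le> q x"
  and cs_scale: "q \<in> cs \<Longrightarrow> q (sc c x) = padic_norm c * q x"
  and cs_ultra: "q \<in> cs \<Longrightarrow> q (x + y) \<le> max (q x) (q y)"
  and cs_continuous: "q \<in> cs \<Longrightarrow> continuous_on UNIV q"
  by (auto simp: continuous_seminorms_def ultrametric_seminorm_def)

sublocale seminormed sc UNIV cs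
  by unfold_locales (simp_all add: cs_nonneg cs_scale cs_ultra)

lemma zero_in_cs: "(\<lambda>_. 0) \<in> cs"
  by (simp add: continuous_seminorms_def ultrametric_seminorm_def)

lemma max_in_cs:
  assumes "q \<in> cs" "r \<in> cs"
  shows "(\<lambda>x. max (q x) (r x)) \<in> cs"
  unfolding continuous_seminorms_def ultrametric_seminorm_def mem_Collect_eq
proof (intro conjI allI)
  fix x y
  show "max (q (x + y)) (r (x + y)) \<le> max (max (q x) (r x)) (max (q y) (r y))"
    using cs_ultra[OF assms(1), of x y] cs_ultra[OF assms(2), of x y] by linarith
next
  show "max (q (sc c x)) (r (sc c x)) = padic_norm c * max (q x) (r x)" for c x
    using assms by (simp add: cs_scale max_mult_distrib_left padic_norm_nonneg)
qed (use assms cs_nonneg cs_continuous in \<open>auto intro!: continuous_intros simp: le_max_iff_disj\<close>)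

lemma finite_le_cs:
  assumes "finite F" "F \<subseteq> cs"
  shows "\<exists>q\<in>cs. \<forall>r\<in>F. \<forall>x. r x \<le> q x"
  using assms
proof (induction F)
  case empty
  then show ?case using zero_in_cs by auto
next
  case (insert r F)
  then obtain q where "q \<in> cs" "\<forall>r\<in>F. \<forall>x. r x \<le> q x" by auto
  then show ?case using insert.prems max_in_cs[of r q]
    by (intro bexI[of _ "\<lambda>x. max (r x) (q x)"]) (auto simp: le_max_iff_disj)
qed

text \<open>Every seminorm of a defining family is continuous since |q x - q y| \<le> q (y - x).
  Thus the set of all continuous seminorms can take the place of such a family.\<close>

lemma defining_seminorms:
  obtains Q where "Q \<subseteq> cs" "euclidean = seminorm_topology UNIV Q" "seminormed sc UNIV Q"
proof -
  obtain Q where Q: "\<forall>q\<in>Q. ultrametric_seminorm sc q" "euclidean = seminorm_topology (UNIV :: 'e set) Q"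
    using locally_convex by (auto simp: locally_convex_def)
  have sn: "seminormed sc UNIV Q"
    using Q(1) by unfold_locales (auto simp: ultrametric_seminorm_def)
  interpret E: seminormed sc UNIV Q by (rule sn)
  have "q \<in> cs" if q: "q \<in> Q" for q
    unfolding continuous_seminorms_def mem_Collect_eq
  proof (intro conjI)
    show "ultrametric_seminorm sc q" using Q q by blast
    show "continuous_on UNIV q"
      unfolding continuous_on_topological
    proof (intro ballI allI impI)
      fix x B assume "open B" "q x \<in> B"
      then obtain \<epsilon> where \<epsilon>: "\<epsilon> > 0" "ball (q x) \<epsilon> \<subseteq> B" by (meson openE)
      let ?A = "E.seminorm_ball {q} x \<epsilon>"
      have "openin euclidean ?A" unfolding Q(2) using q \<epsilon> by (intro E.openin_seminorm_ball) auto
      moreover have "x \<in> ?A" using q \<epsilon> by (intro E.in_seminorm_ball) auto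
      moreover have "q y \<in> B" if y: "y \<in> ?A" for y
      proof -
        have "q (y - x) < \<epsilon>" using y by (simp add: E.seminorm_ball_def)
        moreover have "q y \<le> q (y - x) + q x"
          using E.ultra[OF q, of "y - x" x] E.nonneg[OF q, of "y - x"] E.nonneg[OF q, of x] by simp
        moreover have "q x \<le> q (y - x) + q y"
          using E.ultra[OF q, of "x - y" y] E.nonneg[OF q, of "x - y"] E.nonneg[OF q, of y]
            E.seminorm_minus_commute[OF q, of x y] by simp
        ultimately have "dist (q x) (q y) < \<epsilon>" by (simp add: dist_real_def abs_if)
        then show ?thesis using \<epsilon> by auto
      qed
      ultimately show "\<exists>A. open A \<and> x \<in> A \<and> (\<forall>y\<in>UNIV. y \<in> A \<longrightarrow> q y \<in> B)" by auto
    qed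
  qed
  then show ?thesis using that Q(2) sn by blast
qed

lemma open_contains_cs_ball:
  assumes "open U" "x \<in> U"
  shows "\<exists>q\<in>cs. \<exists>\<epsilon>>0. \<forall>y. q (y - x) < \<epsilon> \<longrightarrow> y \<in> U"
proof -
  obtain Q where Q: "Q \<subseteq> cs" "euclidean = seminorm_topology (UNIV :: 'e set) Q" "seminormed sc UNIV Q"
    by (rule defining_seminorms)
  interpret E: seminormed sc UNIV Q by (rule Q)
  have "openin (seminorm_topology UNIV Q) U" using assms(1) by (simp flip: Q(2))
  then obtain F \<epsilon> where F: "finite F" "F \<subseteq> Q" "\<epsilon> > 0" "E.seminorm_ball F x \<epsilon> \<subseteq> U"
    using assms(2) unfolding E.openin_seminorm_topology by meson
  obtain q where q: "q \<in> cs" "\<forall>r\<in>F. \<forall>x. r x \<le> q x" using finite_le_cs[of F] F Q by auto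
  have "y \<in> U" if "q (y - x) < \<epsilon>" for y
  proof -
    have "y \<in> E.seminorm_ball F x \<epsilon>"
      unfolding E.seminorm_ball_def using q(2) that by (auto intro: le_less_trans)
    then show ?thesis using F(4) by blast
  qed
  then show ?thesis using q F by blast
qed

lemma open_cs_ball: "q \<in> cs \<Longrightarrow> open {y. q (y - x) < \<epsilon>}"
  by (intro open_Collect_less continuous_on_compose2[OF cs_continuous] continuous_intros) auto

lemma cs_separated:
  assumes "x \<noteq> 0"
  shows "\<exists>q\<in>cs. q x > 0"
proof -
  have "open (- {x})" by (simp add: open_Compl)
  then obtain q \<epsilon> where q: "q \<in> cs" "\<epsilon> > 0" "\<forall>y. q (y - 0) < \<epsilon> \<longrightarrow> y \<in> - {x}"
    using open_contains_cs_ball[of "- {x}" 0] assms by blast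
  then have "q x \<ge> \<epsilon>" using q(3) by force
  then show ?thesis using q by (intro bexI[of _ q]) auto
qed

lemma tendsto_cs_iff: "(f \<longlongrightarrow> l) F \<longleftrightarrow> (\<forall>q\<in>cs. \<forall>\<epsilon>>0. eventually (\<lambda>x. q (f x - l) < \<epsilon>) F)"
proof
  assume f: "(f \<longlongrightarrow> l) F"
  show "\<forall>q\<in>cs. \<forall>\<epsilon>>0. eventually (\<lambda>x. q (f x - l) < \<epsilon>) F"
  proof (intro ballI allI impI)
    fix q and \<epsilon> :: real assume "q \<in> cs" "\<epsilon> > 0"
    then show "eventually (\<lambda>x. q (f x - l) < \<epsilon>) F"
      using topological_tendstoD[OF f open_cs_ball, of q l \<epsilon>] by (simp add: seminorm_0)
  qed
next
  assume *: "\<forall>q\<in>cs. \<forall>\<epsilon>>0. eventually (\<lambda>x. q (f x - l) < \<epsilon>) F"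
  show "(f \<longlongrightarrow> l) F"
  proof (rule topological_tendstoI)
    fix U assume "open U" "l \<in> U"
    then obtain q \<epsilon> where q: "q \<in> cs" "\<epsilon> > 0" "\<forall>y. q (y - l) < \<epsilon> \<longrightarrow> y \<in> U"
      using open_contains_cs_ball by blast
    show "eventually (\<lambda>x. f x \<in> U) F" using *[rule_format, OF q(1,2)] by eventually_elim (use q(3) in blast)
  qed
qed

lemma tendsto_scale:
  assumes "(f \<longlongrightarrow> c) F" "(g \<longlongrightarrow> x) F"
  shows "((\<lambda>z. sc (f z) (g z)) \<longlongrightarrow> sc c x) F"
proof -
  have "continuous_map (prod_topology euclidean euclidean) euclidean (\<lambda>(c, x). sc c x)"
    using locally_convex by (simp add: locally_convex_def tvs_on_def)
  then have "continuous_on UNIV (\<lambda>(c, x). sc c x)" by simp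
  then have "isCont (\<lambda>(c, x). sc c x) (c, x)" by (simp add: continuous_on_eq_continuous_at)
  then show ?thesis
    using isCont_tendsto_compose[of "(c, x)" "\<lambda>(c, x). sc c x" "\<lambda>z. (f z, g z)" F] tendsto_Pair[OF assms] by simp
qed

lemma continuous_on_scale:
  "continuous_on A f \<Longrightarrow> continuous_on A g \<Longrightarrow> continuous_on A (\<lambda>z. sc (f z) (g z))"
  by (simp add: continuous_on_def tendsto_scale)

lemma cs_sum_le:
  assumes "q \<in> cs" "\<And>a. a \<in> A \<Longrightarrow> q (f a) \<le> B" "B \<ge> 0"
  shows "q (sum f A) \<le> B"
  using assms(2)
proof (induction A rule: infinite_finite_induct)
  case (insert x F)
  then show ?case using cs_ultra[OF assms(1), of "f x" "sum f F"] by fastforce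
qed (use assms in \<open>auto simp: seminorm_0\<close>)

lemma tendsto_cs:
  assumes "q \<in> cs" "(f \<longlongrightarrow> l) F"
  shows "((\<lambda>x. q (f x)) \<longlongrightarrow> q l) F"
  using continuous_on_tendsto_compose[OF cs_continuous[OF assms(1)] assms(2)] by simp

end

subsection \<open>Blocks\<close>

lemma tendsto_fun_iff:
  fixes f :: "'a \<Rightarrow> 'i \<Rightarrow> 'b::topological_space"
  shows "(f \<longlongrightarrow> l) F \<longleftrightarrow> (\<forall>i. ((\<lambda>x. f x i) \<longlongrightarrow> l i) F)"
proof -
  have "(f \<longlongrightarrow> l) F \<longleftrightarrow> limitin (product_topology (\<lambda>i. euclidean) UNIV) f l F"
    by (simp add: euclidean_product_topology)
  then show ?thesis by (simp add: limitin_componentwise)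
qed

lemma compact_PiE_UNIV:
  fixes S :: "'i \<Rightarrow> ('b::topological_space) set"
  assumes "\<And>i. compact (S i)"
  shows "compact (Pi\<^sub>E UNIV S)"
  using compactin_PiE[of "\<lambda>_. euclidean" UNIV S] assms by (simp add: euclidean_product_topology)

lemma compact_blocks:
  assumes "\<And>i. compact (V i)"
  shows "compact (blocks V \<beta>)"
proof -
  \<comment> \<open>The pinned entries are factors {undefined}, which makes the set of blocks a full
    product of compact sets.\<close>
  have 1: "Pi\<^sub>E {..\<beta> i} (\<lambda>_. V i) = Pi\<^sub>E UNIV (\<lambda>j. if j \<le> \<beta> i then V i else {undefined})" for i
    by (auto simp: PiE_def Pi_def extensional_def split: if_splits)
  have 2: "blocks V \<beta> = Pi\<^sub>E UNIV (\<lambda>i. Pi\<^sub>E {..\<beta> i} (\<lambda>_. V i))"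
    by (auto simp: blocks_def PiE_def Pi_def)
  show ?thesis unfolding 2 1 by (intro compact_PiE_UNIV) (use assms in auto)
qed

lemma in_blocks_iff: "x \<in> blocks V \<beta> \<longleftrightarrow> (\<forall>i. (\<forall>j\<le>\<beta> i. x i j \<in> V i) \<and> (\<forall>j>\<beta> i. x i j = undefined))"
  by (auto simp: blocks_def PiE_iff extensional_def not_le[symmetric])

lemma distinct_choice:
  assumes "\<And>j. infinite (A j)"
  shows "\<exists>y :: nat \<Rightarrow> 'a. (\<forall>j\<le>m. y j \<in> A j) \<and> inj_on y {..m}"
proof (induction m)
  case 0
  have "A 0 \<noteq> {}" using assms[of 0] by auto
  then obtain a where "a \<in> A 0" by blast
  then show ?case by (intro exI[of _ "\<lambda>_. a"]) auto
next
  case (Suc m)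
  then obtain y where y: "\<forall>j\<le>m. y j \<in> A j" "inj_on y {..m}" by blast
  have "infinite (A (Suc m) - y ` {..m})" using assms[of "Suc m"] by simp
  then have "A (Suc m) - y ` {..m} \<noteq> {}" by (metis finite.emptyI)
  then obtain a where a: "a \<in> A (Suc m)" "a \<notin> y ` {..m}" by blast
  have "inj_on (y(Suc m := a)) {..Suc m}"
    using y(2) a(2) by (auto simp: inj_on_def atMost_Suc)
  moreover have "\<forall>j\<le>Suc m. (y(Suc m := a)) j \<in> A j"
    using y(1) a(1) by (auto simp: le_Suc_eq)
  ultimately show ?case by blast
qed

text \<open>As no point of \<open>V i\<close> is isolated, every ball about it meets
  \<open>V i\<close> in infinitely many points, so the entries of a block can be perturbed to be
  pairwise distinct.\<close>

lemma distinct_blocks_dense: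
  fixes V :: "'n::finite \<Rightarrow> 'a::metric_space set"
  assumes V: "cartesian V" and x: "x \<in> blocks V \<beta>"
  obtains y :: "nat \<Rightarrow> 'n \<Rightarrow> nat \<Rightarrow> 'a" where "\<And>m. y m \<in> distinct_blocks V \<beta>" "y \<longlonglongrightarrow> x"
proof -
  have inf: "infinite (V i \<inter> ball a e)" if "a \<in> V i" "e > 0" for i a e
  proof -
    have "a islimpt V i" using V that(1) unfolding cartesian_def by (auto simp: isolated_in_islimpt_iff)
    then show ?thesis using that(2) by (simp add: islimpt_eq_infinite_ball)
  qed
  have "\<exists>y. (\<forall>j\<le>\<beta> i. y j \<in> V i \<inter> ball (x i j) (inverse (real (Suc m)))) \<and> inj_on y {..\<beta> i}" for i m
  proof -
    \<comment> \<open>The minimum makes the family of infinite sets total; only entries up to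
      \<open>\<beta> i\<close> matter.\<close>
    let ?A = "\<lambda>j. V i \<inter> ball (x i (min j (\<beta> i))) (inverse (real (Suc m)))"
    have "infinite (?A j)" for j using x by (intro inf) (auto simp: in_blocks_iff)
    then obtain y where "(\<forall>j\<le>\<beta> i. y j \<in> ?A j) \<and> inj_on y {..\<beta> i}" using distinct_choice[of ?A "\<beta> i"] by blast
    then show ?thesis by (intro exI[of _ y]) (auto simp: min_def)
  qed
  then have "\<forall>i m. \<exists>y. (\<forall>j\<le>\<beta> i. y j \<in> V i \<inter> ball (x i j) (inverse (real (Suc m)))) \<and> inj_on y {..\<beta> i}"
    by blast
  then obtain Y where Y': "\<forall>i m. (\<forall>j\<le>\<beta> i. Y i m j \<in> V i \<inter> ball (x i j) (inverse (real (Suc m)))) \<and> inj_on (Y i m) {..\<beta> i}"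
    unfolding choice_iff by blast
  then have Y: "\<And>i m j. j \<le> \<beta> i \<Longrightarrow> Y i m j \<in> V i \<inter> ball (x i j) (inverse (real (Suc m)))"
    "\<And>i m. inj_on (Y i m) {..\<beta> i}" by blast+
  define y where "y m i j = (if j \<le> \<beta> i then Y i m j else x i j)" for m i j
  have "inj_on (y m i) {..\<beta> i}" for m i
    using Y(2)[of i m] by (auto simp: inj_on_def y_def)
  then have "y m \<in> distinct_blocks V \<beta>" for m
    using Y(1) x by (auto simp: distinct_blocks_def in_blocks_iff y_def)
  moreover have "y \<longlonglongrightarrow> x"
    unfolding tendsto_fun_iff
  proof (intro allI)
    fix i j
    have "(\<lambda>m. dist (y m i j) (x i j)) \<longlonglongrightarrow> 0"
    proof (rule Lim_null_comparison[OF always_eventually LIMSEQ_inverse_real_of_nat], intro allI)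
      fix m show "norm (dist (y m i j) (x i j)) \<le> inverse (real (Suc m))"
      proof (cases "j \<le> \<beta> i")
        case True
        then have "dist (Y i m j) (x i j) < inverse (real (Suc m))"
          using Y(1)[of j i m] by (simp only: Int_iff mem_ball dist_commute)
        then show ?thesis using True by (simp only: y_def if_True real_norm_def abs_of_nonneg zero_le_dist less_imp_le)
      qed (simp add: y_def)
    qed
    then show "(\<lambda>m. y m i j) \<longlonglongrightarrow> x i j" by (rule tendsto_dist_iff[THEN iffD2])
  qed
  ultimately show ?thesis using that by blast
qed

lemma continuous_eq_on_blocks:
  fixes V :: "'n::finite \<Rightarrow> 'a::metric_space set" and g h :: "_ \<Rightarrow> 'e::t2_space"
  assumes V: "cartesian V" and "continuous_on (blocks V \<beta>) g" "continuous_on (blocks V \<beta>) h"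
    and eq: "\<And>y. y \<in> distinct_blocks V \<beta> \<Longrightarrow> g y = h y" and x: "x \<in> blocks V \<beta>"
  shows "g x = h x"
proof -
  obtain y where y: "\<And>m. y m \<in> distinct_blocks V \<beta>" "y \<longlonglongrightarrow> x"
    using distinct_blocks_dense[OF V x] by blast
  have yb: "\<forall>\<^sub>F m in sequentially. y m \<in> blocks V \<beta>" using y(1) by (auto simp: distinct_blocks_def)
  have "(\<lambda>m. g (y m)) \<longlonglongrightarrow> g x" "(\<lambda>m. h (y m)) \<longlonglongrightarrow> h x"
    using continuous_on_tendsto_compose[OF _ y(2) x yb] assms by auto
  then show ?thesis using eq[OF y(1)] LIMSEQ_unique by auto
qed

lemma divided_difference_dcoef:
  "divided_difference sc \<beta> f x = (\<Sum>j | j \<le> \<beta>. sc (\<Prod>i\<in>UNIV. dcoef (x i) {..\<beta> i} (j i)) (f (\<lambda>i. x i (j i))))"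
  by (simp add: divided_difference_def dcoef_def)

lemma divided_difference_cong:
  assumes "\<And>i j. j \<le> \<beta> i \<Longrightarrow> x i j = y i j" "\<And>j. j \<le> \<beta> \<Longrightarrow> f (\<lambda>i. x i (j i)) = g (\<lambda>i. y i (j i))"
  shows "divided_difference sc \<beta> f x = divided_difference sc \<beta> g y"
  unfolding divided_difference_dcoef
proof (intro sum.cong refl)
  fix j assume "j \<in> {j. j \<le> \<beta>}"
  then have j: "j \<le> \<beta>" by simp
  then have "dcoef (x i) {..\<beta> i} (j i) = dcoef (y i) {..\<beta> i} (j i)" for i
    unfolding dcoef_def using assms(1) by (intro prod.cong refl) (auto simp: le_fun_def)
  then show "sc (\<Prod>i\<in>UNIV. dcoef (x i) {..\<beta> i} (j i)) (f (\<lambda>i. x i (j i))) =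
      sc (\<Prod>i\<in>UNIV. dcoef (y i) {..\<beta> i} (j i)) (g (\<lambda>i. y i (j i)))"
    using assms(2)[OF j] by simp
qed

subsection \<open>Multilinear functionals\<close>

context lcs
begin

text \<open>The tensor product of the one-variable functionals attached to the polynomials
  \<open>P i\<close>, applied to f; the box given by the degrees makes the sum finite.\<close>

definition functional :: "(('n::finite \<Rightarrow> 'p padic) \<Rightarrow> 'e) \<Rightarrow> ('n \<Rightarrow> 'p padic poly) \<Rightarrow> 'e" where
  "functional f P = (\<Sum>\<mu> | \<mu> \<le> (\<lambda>i. degree (P i)). sc (\<Prod>i\<in>UNIV. coeff (P i) (\<mu> i)) (f (\<lambda>i. of_nat (\<mu> i))))"

text \<open>Enlarging the box adds vanishing coefficients only. A common box is needed to compare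
  polynomials of different degrees.\<close>

lemma functional_box:
  assumes "\<And>i. degree (P i) \<le> N i"
  shows "functional f P = (\<Sum>\<mu> | \<mu> \<le> N. sc (\<Prod>i\<in>UNIV. coeff (P i) (\<mu> i)) (f (\<lambda>i. of_nat (\<mu> i))))"
  unfolding functional_def
proof (rule sum.mono_neutral_left[OF finite_multiindices_le])
  show "{\<mu>. \<mu> \<le> (\<lambda>i. degree (P i))} \<subseteq> {\<mu>. \<mu> \<le> N}" using assms by (auto simp: le_fun_def intro: order_trans)
  show "\<forall>\<mu>\<in>{\<mu>. \<mu> \<le> N} - {\<mu>. \<mu> \<le> (\<lambda>i. degree (P i))}. sc (\<Prod>i\<in>UNIV. coeff (P i) (\<mu> i)) (f (\<lambda>i. of_nat (\<mu> i))) = 0"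
  proof
    fix \<mu> assume "\<mu> \<in> {\<mu>. \<mu> \<le> N} - {\<mu>. \<mu> \<le> (\<lambda>i. degree (P i))}"
    then obtain i where "degree (P i) < \<mu> i" by (auto simp: le_fun_def not_le)
    then have "(\<Prod>i\<in>UNIV. coeff (P i) (\<mu> i)) = 0" by (intro prod_zero) (auto intro: coeff_eq_0)
    then show "sc (\<Prod>i\<in>UNIV. coeff (P i) (\<mu> i)) (f (\<lambda>i. of_nat (\<mu> i))) = 0" by simp
  qed
qed

lemma functional_update:
  assumes "\<And>j. degree (P j) \<le> N j" "degree A \<le> N i"
  shows "functional f (P(i := A)) = (\<Sum>\<mu> | \<mu> \<le> N.
    sc (coeff A (\<mu> i) * (\<Prod>j\<in>UNIV - {i}. coeff (P j) (\<mu> j))) (f (\<lambda>i. of_nat (\<mu> i))))"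
proof -
  have "(\<Prod>j\<in>UNIV. coeff ((P(i := A)) j) (\<mu> j)) = coeff A (\<mu> i) * (\<Prod>j\<in>UNIV - {i}. coeff (P j) (\<mu> j))" for \<mu>
    by (subst prod.remove[of UNIV i]) auto
  moreover have "functional f (P(i := A)) =
      (\<Sum>\<mu> | \<mu> \<le> N. sc (\<Prod>j\<in>UNIV. coeff ((P(i := A)) j) (\<mu> j)) (f (\<lambda>i. of_nat (\<mu> i))))"
    using assms by (intro functional_box) auto
  ultimately show ?thesis by (simp only:)
qed

lemma functional_add:
  "functional f (P(i := A + B)) = functional f (P(i := A)) + functional f (P(i := B))"
proof -
  define N where "N j = max (degree (P j)) (max (degree A) (degree B))" for j
  have N: "degree (P j) \<le> N j" "degree A \<le> N j" "degree B \<le> N j" for j by (auto simp: N_def)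
  then have "degree (A + B) \<le> N j" for j by (meson degree_add_le)
  then show ?thesis
    using N by (simp add: functional_update[of P N] distrib_right scale_left_distrib sum.distrib del: fun_upd_apply)
qed

lemma functional_smult: "functional f (P(i := smult c A)) = sc c (functional f (P(i := A)))"
proof -
  define N where "N j = max (degree (P j)) (degree A)" for j
  have N: "degree (P j) \<le> N j" "degree A \<le> N j" for j by (auto simp: N_def)
  then have "degree (smult c A) \<le> N j" for j by (meson degree_smult_le order_trans)
  then show ?thesis
    using N by (simp add: functional_update[of P N] scale_sum_right mult.assoc del: fun_upd_apply)
qed

lemma functional_zero: "functional f (P(i := 0)) = 0"
  using functional_smult[of f P i 0 0] by (simp del: fun_upd_apply)

lemma functional_smult_all: "functional f (\<lambda>i. smult (d i) (P i)) = sc (\<Prod>i\<in>UNIV. d i) (functional f P)"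
proof -
  have "functional f (\<lambda>i. smult (d i) (P i)) = (\<Sum>\<mu> | \<mu> \<le> (\<lambda>i. degree (P i)).
      sc (\<Prod>i\<in>UNIV. coeff (smult (d i) (P i)) (\<mu> i)) (f (\<lambda>i. of_nat (\<mu> i))))"
    by (rule functional_box) (rule degree_smult_le)
  then show ?thesis by (simp add: functional_def prod.distrib scale_sum_right)
qed

text \<open>The functional is linear in each slot, and the set where q is at most M is closed under
  integral combinations by the ultrametric inequality. So the slots pass from generators to spans
  one at a time, without loss of a constant.\<close>

lemma functional_span_bound:
  assumes q: "q \<in> cs" and M: "M \<ge> 0"
    and G: "\<And>P. (\<And>i. P i \<in> G i) \<Longrightarrow> q (functional f P) \<le> M"
    and P: "\<And>i :: 'n::finite. P i \<in> integral_span (G i)"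
  shows "q (functional f P) \<le> M"
proof -
  have "\<forall>P. (\<forall>i\<in>I. P i \<in> integral_span (G i)) \<longrightarrow> (\<forall>i. i \<notin> I \<longrightarrow> P i \<in> G i) \<longrightarrow> q (functional f P) \<le> M"
    if "finite I" for I :: "'n set"
    using that
  proof (induction I)
    case empty
    then show ?case using G by blast
  next
    case (insert i I)
    show ?case
    proof (intro allI impI)
      fix P assume P: "\<forall>j\<in>insert i I. P j \<in> integral_span (G j)" "\<forall>j. j \<notin> insert i I \<longrightarrow> P j \<in> G j"
      have "q (functional f (P(i := A))) \<le> M" if "A \<in> integral_span (G i)" for A
        using that
      proof induction
        case zero
        then show ?case using M seminorm_0[OF q] by (simp only: functional_zero)
      next
        case (base A)
        have "\<forall>j\<in>I. (P(i := A)) j \<in> integral_span (G j)" using P(1) insert.hyps by auto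
        moreover have "\<forall>j. j \<notin> I \<longrightarrow> (P(i := A)) j \<in> G j" using P(2) base by auto
        ultimately show ?case using insert.IH by blast
      next
        case (add A B)
        then show ?case
            using cs_ultra[OF q, of "functional f (P(i := A))" "functional f (P(i := B))"]
            unfolding functional_add by linarith
      next
        case (smult A c)
        have "padic_norm c * q (functional f (P(i := A))) \<le> 1 * M"
          using smult.hyps(2) cs_nonneg[OF q] by (intro mult_mono smult.IH) (simp_all add: padic_integers_def)
        then show ?case by (simp add: functional_smult cs_scale[OF q] del: fun_upd_apply)
      qed
      from this[of "P i"] P(1) show "q (functional f P) \<le> M" by simp
    qed
  qed
  from this[of UNIV] P show ?thesis by simp
qed

text \<open>Both sides are sums over the same grid of points. The enumerations \<open>e i\<close>
  may be arbitrary, so that a shifted grid can keep the enumeration of the original one.\<close>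

lemma functional_nat_difference:
  fixes \<beta> :: "'n::finite \<Rightarrow> nat"
  assumes e: "\<And>i. bij_betw (e i) {..\<beta> i} (S i)" and x: "\<And>i j. j \<le> \<beta> i \<Longrightarrow> x i j = of_nat (e i j)"
  shows "functional f (\<lambda>i. nat_difference (S i)) = divided_difference sc \<beta> f x"
proof -
  let ?P = "\<lambda>i. nat_difference (S i) :: 'p padic poly"
  have S: "finite (S i)" for i using e[of i] bij_betw_finite by blast
  define N where "N i = max (degree (?P i)) (Max (S i))" for i
  have SN: "m \<le> N i" if "m \<in> S i" for i m using Max_ge[OF S that] by (simp add: N_def)
  have "functional f ?P = (\<Sum>\<mu> | \<mu> \<le> N. sc (\<Prod>i\<in>UNIV. coeff (?P i) (\<mu> i)) (f (\<lambda>i. of_nat (\<mu> i))))"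
    by (rule functional_box) (simp add: N_def)
  also have "\<dots> = (\<Sum>\<mu>\<in>Pi UNIV S. sc (\<Prod>i\<in>UNIV. coeff (?P i) (\<mu> i)) (f (\<lambda>i. of_nat (\<mu> i))))"
  proof (rule sum.mono_neutral_right[OF finite_multiindices_le])
    show "Pi UNIV S \<subseteq> {\<mu>. \<mu> \<le> N}" using SN by (auto simp: le_fun_def)
    show "\<forall>\<mu>\<in>{\<mu>. \<mu> \<le> N} - Pi UNIV S. sc (\<Prod>i\<in>UNIV. coeff (?P i) (\<mu> i)) (f (\<lambda>i. of_nat (\<mu> i))) = 0"
    proof
      fix \<mu> assume "\<mu> \<in> {\<mu>. \<mu> \<le> N} - Pi UNIV S"
      then obtain i where "\<mu> i \<notin> S i" by auto
      then have "(\<Prod>i\<in>UNIV. coeff (?P i) (\<mu> i)) = 0" by (intro prod_zero) (auto simp: coeff_nat_difference S)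
      then show "sc (\<Prod>i\<in>UNIV. coeff (?P i) (\<mu> i)) (f (\<lambda>i. of_nat (\<mu> i))) = 0" by simp
    qed
  qed
  also have "\<dots> = (\<Sum>j | j \<le> \<beta>. sc (\<Prod>i\<in>UNIV. dcoef of_nat (S i) (e i (j i))) (f (\<lambda>i. of_nat (e i (j i)))))"
  proof (rule sum.reindex_bij_witness[of _ "\<lambda>j i. e i (j i)" "\<lambda>\<mu> i. inv_into {..\<beta> i} (e i) (\<mu> i)"])
    fix \<mu> assume \<mu>: "\<mu> \<in> Pi UNIV S"
    then have m: "\<mu> i \<in> e i ` {..\<beta> i}" for i using e[of i] by (auto simp: bij_betw_def)
    show "(\<lambda>i. e i (inv_into {..\<beta> i} (e i) (\<mu> i))) = \<mu>" using f_inv_into_f[OF m] by auto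
    show "(\<lambda>i. inv_into {..\<beta> i} (e i) (\<mu> i)) \<in> {j. j \<le> \<beta>}" using inv_into_into[OF m] by (auto simp: le_fun_def)
    show "sc (\<Prod>i\<in>UNIV. dcoef of_nat (S i) (e i (inv_into {..\<beta> i} (e i) (\<mu> i))))
        (f (\<lambda>i. of_nat (e i (inv_into {..\<beta> i} (e i) (\<mu> i))))) = sc (\<Prod>i\<in>UNIV. coeff (?P i) (\<mu> i)) (f (\<lambda>i. of_nat (\<mu> i)))"
      using \<mu> by (simp add: f_inv_into_f[OF m] coeff_nat_difference S Pi_iff)
  next
    fix j assume "j \<in> {j. j \<le> \<beta>}"
    then have j: "j i \<le> \<beta> i" for i by (auto simp: le_fun_def)
    show "(\<lambda>i. inv_into {..\<beta> i} (e i) (e i (j i))) = j"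
      using j e by (auto simp: bij_betw_def)
    show "(\<lambda>i. e i (j i)) \<in> Pi UNIV S" using j e by (fastforce simp: bij_betw_def)
  qed
  also have "\<dots> = divided_difference sc \<beta> f x"
    unfolding divided_difference_dcoef
  proof (intro sum.cong refl)
    fix j assume "j \<in> {j. j \<le> \<beta>}"
    then have j: "j i \<le> \<beta> i" for i by (auto simp: le_fun_def)
    have "dcoef of_nat (S i) (e i (j i)) = dcoef (x i) {..\<beta> i} (j i)" for i
    proof -
      have inj: "inj_on (e i) {..\<beta> i}" and im: "S i = e i ` {..\<beta> i}" using e[of i] by (auto simp: bij_betw_def)
      have "S i - {e i (j i)} = e i ` ({..\<beta> i} - {j i})"
        using inj_on_image_set_diff[OF inj, of "{..\<beta> i}" "{j i}"] j[of i] im by auto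
      moreover have "inj_on (e i) ({..\<beta> i} - {j i})" using inj by (rule inj_on_subset) auto
      ultimately show ?thesis unfolding dcoef_def
        using j[of i] by (intro prod.reindex_cong[of "e i"]) (auto simp: x)
    qed
    then show "sc (\<Prod>i\<in>UNIV. dcoef of_nat (S i) (e i (j i))) (f (\<lambda>i. of_nat (e i (j i)))) =
      sc (\<Prod>i\<in>UNIV. dcoef (x i) {..\<beta> i} (j i)) (f (\<lambda>i. x i (j i)))" using j by (simp add: x)
  qed
  finally show ?thesis .
qed

lemma mahler_coeff_functional: "mahler_coeff sc f \<nu> = functional f (\<lambda>i. delta ^ \<nu> i)"
proof -
  have deg: "degree ((delta :: 'p padic poly) ^ n) \<le> n" for n using degree_power_le[of "delta :: 'p padic poly" n] by simp
  have "functional f (\<lambda>i. delta ^ \<nu> i) =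
      (\<Sum>\<mu> | \<mu> \<le> \<nu>. sc (\<Prod>i\<in>UNIV. coeff (delta ^ \<nu> i) (\<mu> i)) (f (\<lambda>i. of_nat (\<mu> i))))"
    using deg by (intro functional_box) auto
  also have "\<dots> = mahler_coeff sc f \<nu>"
    unfolding mahler_coeff_def
  proof (intro sum.cong refl arg_cong2[of _ _ _ _ sc])
    fix \<mu> assume "\<mu> \<in> {\<mu>. \<mu> \<le> \<nu>}"
    then have \<mu>: "\<mu> i \<le> \<nu> i" for i by (auto simp: le_fun_def)
    have "(\<Prod>i\<in>UNIV. coeff ((delta :: 'p padic poly) ^ \<nu> i) (\<mu> i)) = (\<Prod>i\<in>UNIV. of_nat (\<nu> i choose \<mu> i) * (- 1) ^ (\<nu> i - \<mu> i))"
      using \<mu> by (intro prod.cong refl) (subst coeff_linear_poly_power, auto)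
    also have "\<dots> = of_nat (\<Prod>i\<in>UNIV. \<nu> i choose \<mu> i) * (- 1) ^ (\<Sum>i\<in>UNIV. \<nu> i - \<mu> i)"
      by (simp add: prod.distrib power_sum)
    also have "(\<Sum>i\<in>UNIV. \<nu> i - \<mu> i) = sum \<nu> UNIV - sum \<mu> UNIV" using \<mu> by (intro sum_subtractf_nat)
    finally show "(\<Prod>i\<in>UNIV. coeff ((delta :: 'p padic poly) ^ \<nu> i) (\<mu> i)) =
       (- 1) ^ (sum \<nu> UNIV - sum \<mu> UNIV) * of_nat (\<Prod>i\<in>UNIV. \<nu> i choose \<mu> i)" by (simp add: mult.commute)
  qed
  finally show ?thesis ..
qed

end

subsection \<open>Decay of Mahler coefficients\<close>

definition weight_factor :: "nat \<Rightarrow> nat \<Rightarrow> real" where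
  "weight_factor a n = (if n = 0 then 1 else real n ^ a)"

lemma weight_eq_prod: "weight \<alpha> \<nu> = (\<Prod>i\<in>UNIV. weight_factor (\<alpha> i) (\<nu> i))"
  by (simp add: weight_def weight_factor_def)

lemma weight_factor_pos: "weight_factor a n > 0"
  by (simp add: weight_factor_def)

lemma weight_pos: "weight \<alpha> \<nu> > 0"
  unfolding weight_eq_prod by (intro prod_pos) (simp add: weight_factor_pos)

text \<open>Provides the power of p that is comparable with n / a up to a factor p; its p-adic norm
  then compensates the real size of n.\<close>

lemma prime_power_bracket:
  assumes "0 < a" "a \<le> n" "1 < (p :: nat)"
  obtains s where "a * p ^ s \<le> n" "n < a * p ^ Suc s"
proof -
  have ex: "\<exists>m. n < a * p ^ m"
  proof
    have "n < p ^ n" using power_gt_expt[of p n] assms(3) by simp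
    also have "\<dots> \<le> a * p ^ n" using assms(1) by simp
    finally show "n < a * p ^ n" .
  qed
  define m where "m = (LEAST m. n < a * p ^ m)"
  have m: "n < a * p ^ m" unfolding m_def by (rule LeastI_ex[OF ex])
  have "m \<noteq> 0" using m assms(2) by (cases m) auto
  then obtain s where s: "m = Suc s" using not0_implies_Suc by blast
  have "\<not> n < a * p ^ s" using not_less_Least[of s "\<lambda>m. n < a * p ^ m"] s by (simp add: m_def)
  then show ?thesis using that[of s] m s by (simp add: not_less)
qed

text \<open>With q = p^s and a q \<le> n < a p q, the power (T - 1)^n is divisible by q^a, and n^a
  q^-a is at most (a p)^a. For a = 0 or n < a, order 0 and the trivial bound (a + 1)^a suffice,
  whence the a + 1 in the constant.\<close>

lemma delta_power_decay:
  "\<exists>k\<le>a. \<exists>d. \<exists>P\<in>difference_span k. (delta :: 'p::prime_card padic poly) ^ n = smult d P \<and>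
     weight_factor a n * padic_norm d \<le> (real (a + 1) * CARD('p)) ^ a"
proof (cases "0 < a \<and> a \<le> n")
  case True
  then obtain s where s: "a * CARD('p) ^ s \<le> n" "n < a * CARD('p) ^ Suc s"
    using prime_power_bracket[of a n "CARD('p)"] CARD_gt_1[where ?'p = 'p] by auto
  let ?d = "of_nat (CARD('p) ^ s) ^ a :: 'p padic"
  obtain P where P: "P \<in> difference_span a" "delta ^ n = smult ?d P"
    using delta_power_integral_span[of "CARD('p) ^ s" a n, where ?'p = 'p] s(1) CARD_gt_1[where ?'p = 'p] by auto
  have "?d = of_nat CARD('p) ^ (s * a)" by (simp add: power_mult)
  then have "padic_norm ?d = 1 / real CARD('p) ^ (s * a)" by (simp only: padic_norm_p_power)
  then have "weight_factor a n * padic_norm ?d = real n ^ a / (real CARD('p) ^ s) ^ a"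
    using True by (simp add: weight_factor_def power_mult)
  also have "\<dots> = (real n / real CARD('p) ^ s) ^ a" by (simp add: power_divide)
  also have "\<dots> \<le> (real (a + 1) * CARD('p)) ^ a"
  proof (rule power_mono)
    have "real n \<le> real (a * CARD('p) ^ Suc s)" using s(2) by (simp only: of_nat_le_iff)
    also have "\<dots> \<le> (real (a + 1) * CARD('p)) * real CARD('p) ^ s"
      using CARD_gt_1[where ?'p = 'p] by (simp add: distrib_right)
    finally show "real n / real CARD('p) ^ s \<le> real (a + 1) * CARD('p)"
      using CARD_gt_1[where ?'p = 'p] by (simp add: divide_le_eq)
  qed simp
  finally show ?thesis using P by blast
next
  case False
  have "delta ^ n * 1 \<in> integral_span (nat_differences 0 :: 'p padic poly set)"
    by (intro delta_power_mult_integral_span one_in_integral_span)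
  moreover have "weight_factor a n * padic_norm (1 :: 'p padic) \<le> (real (a + 1) * CARD('p)) ^ a"
  proof -
    have c: "real (a + 1) \<le> real (a + 1) * CARD('p)" using CARD_gt_1[where ?'p = 'p] by simp
    have "weight_factor a n \<le> real (a + 1) ^ a"
      using False unfolding weight_factor_def by (auto intro: power_mono)
    also have "\<dots> \<le> (real (a + 1) * CARD('p)) ^ a" using c by (intro power_mono) auto
    finally show ?thesis by simp
  qed
  ultimately show ?thesis
    by (intro exI[of _ 0] conjI exI[of _ 1] bexI[of _ "delta ^ n"]) auto
qed

text \<open>The factor \<open>2 ^ a\<close> pays for spending up to half of the exponent on
  smallness in \<open>delta_power_small_decay\<close>; the rest is the bound of
  \<open>delta_power_decay\<close>.\<close>

definition decay_const :: "nat \<Rightarrow> nat \<Rightarrow> real" where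
  "decay_const p a = 2 ^ a * (real (a + 1) * real p) ^ a"

lemma delta_power_decay':
  "\<exists>k\<le>a. \<exists>d. \<exists>P\<in>difference_span k. (delta :: 'p::prime_card padic poly) ^ n = smult d P \<and>
     weight_factor a n * padic_norm d \<le> decay_const CARD('p) a"
proof -
  have "1 * (real (a + 1) * CARD('p)) ^ a \<le> decay_const CARD('p) a"
    unfolding decay_const_def by (intro mult_right_mono) auto
  then show ?thesis using delta_power_decay[of a n, where ?'p = 'p] by (force intro: order_trans)
qed

text \<open>Of the n factors T - 1, fewer than half, namely p^r t, produce the small generators. The
  remaining m \<ge> n / 2 produce the decay, at the cost n^a \<le> 2^a m^a.\<close>

lemma delta_power_small_decay:
  assumes n: "n > 2 * (CARD('p::prime_card) ^ r * t)"
  shows "\<exists>k\<le>a. \<exists>d. \<exists>P\<in>integral_span (small_differences r t k). (delta :: 'p padic poly) ^ n = smult d P \<and>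
     weight_factor a n * padic_norm d \<le> decay_const CARD('p) a"
proof -
  define m where "m = n - CARD('p) ^ r * t"
  have m: "n = CARD('p) ^ r * t + m" "n \<le> 2 * m" "m > 0" using n by (auto simp: m_def)
  obtain k d P where k: "k \<le> a" "P \<in> difference_span k" "(delta :: 'p padic poly) ^ m = smult d P"
    "weight_factor a m * padic_norm d \<le> (real (a + 1) * CARD('p)) ^ a"
    using delta_power_decay[of a m, where ?'p = 'p] by blast
  have "delta ^ n = smult d (delta ^ (CARD('p) ^ r * t) * P)" by (simp add: m(1) power_add k(3))
  moreover have "delta ^ (CARD('p) ^ r * t) * P \<in> integral_span (small_differences r t k)"
    by (rule delta_power_small[OF k(2)])
  moreover have "weight_factor a n * padic_norm d \<le> decay_const CARD('p) a"
  proof -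
    have "real n ^ a \<le> (2 * real m) ^ a" using m(2) by (intro power_mono) auto
    then have "weight_factor a n \<le> 2 ^ a * weight_factor a m"
      using m by (simp add: weight_factor_def power_mult_distrib)
    then have "weight_factor a n * padic_norm d \<le> 2 ^ a * (weight_factor a m * padic_norm d)"
      by (metis mult.assoc mult_right_mono padic_norm_nonneg)
    also have "\<dots> \<le> decay_const CARD('p) a" unfolding decay_const_def using k(4) by (intro mult_left_mono) auto
    finally show ?thesis .
  qed
  ultimately show ?thesis using k(1) by blast
qed

abbreviation weight_norm :: "('n::finite \<Rightarrow> nat) \<Rightarrow> ('e \<Rightarrow> real) \<Rightarrow> (('n \<Rightarrow> nat) \<Rightarrow> 'e) \<Rightarrow> real" where
  "weight_norm \<alpha> \<equiv> weighted_seminorm (weight \<alpha>)"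

context lcs
begin

abbreviation mahler :: "(('n::finite \<Rightarrow> 'p padic) \<Rightarrow> 'e) \<Rightarrow> ('n \<Rightarrow> nat) \<Rightarrow> 'e" where
  "mahler \<equiv> mahler_coeff sc"

text \<open>The weight and the scalars \<open>d i\<close> both factor over the coordinates, so
  one-variable estimates multiply; what remains is a functional on spans, bounded by its values on
  generators.\<close>

lemma weighted_mahler_bound:
  fixes \<nu> :: "'n::finite \<Rightarrow> nat"
  assumes q: "q \<in> cs" and M: "M \<ge> 0"
    and P: "\<And>i. (delta :: 'p padic poly) ^ \<nu> i = smult (d i) (P i)" "\<And>i. P i \<in> integral_span (G i)"
    and d: "\<And>i. weight_factor (\<alpha> i) (\<nu> i) * padic_norm (d i) \<le> c (\<alpha> i)"
    and G: "\<And>P. (\<And>i. P i \<in> G i) \<Longrightarrow> q (functional f P) \<le> M"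
  shows "weight \<alpha> \<nu> * q (mahler f \<nu>) \<le> (\<Prod>i\<in>UNIV. c (\<alpha> i)) * M"
proof -
  have "mahler f \<nu> = sc (\<Prod>i\<in>UNIV. d i) (functional f P)"
    unfolding mahler_coeff_functional P(1) by (rule functional_smult_all)
  then have "weight \<alpha> \<nu> * q (mahler f \<nu>) =
      (\<Prod>i\<in>UNIV. weight_factor (\<alpha> i) (\<nu> i) * padic_norm (d i)) * q (functional f P)"
    by (simp add: cs_scale[OF q] padic_norm_prod weight_eq_prod prod.distrib)
  also have "\<dots> \<le> (\<Prod>i\<in>UNIV. c (\<alpha> i)) * M"
  proof (rule mult_mono)
    show "(\<Prod>i\<in>UNIV. weight_factor (\<alpha> i) (\<nu> i) * padic_norm (d i)) \<le> (\<Prod>i\<in>UNIV. c (\<alpha> i))"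
      using d by (intro prod_mono) (simp add: weight_factor_pos less_imp_le padic_norm_nonneg)
    show "q (functional f P) \<le> M" by (rule functional_span_bound[OF q M G P(2)])
    show "0 \<le> (\<Prod>i\<in>UNIV. c (\<alpha> i))"
      using d by (intro prod_nonneg) (meson mult_nonneg_nonneg order_trans padic_norm_nonneg weight_factor_pos less_imp_le)
  qed (rule cs_nonneg[OF q])
  finally show ?thesis .
qed

lemma nat_difference_block:
  fixes S :: "'n::finite \<Rightarrow> nat set"
  assumes "\<And>i. finite (S i)" "\<And>i. card (S i) = Suc (\<beta> i)"
  shows "\<exists>e x. (\<forall>i. bij_betw (e i) {..\<beta> i} (S i)) \<and> (\<forall>i. \<forall>j\<le>\<beta> i. x i j = of_nat (e i j)) \<and>
    x \<in> distinct_blocks (\<lambda>_. padic_integers :: 'p padic set) \<beta> \<and>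
    functional f (\<lambda>i. nat_difference (S i)) = divided_difference sc \<beta> f x"
proof -
  have "\<exists>h. bij_betw h {..\<beta> i} (S i)" for i
    using ex_bij_betw_nat_finite[OF assms(1), of i] by (simp add: assms(2) atLeast0LessThan lessThan_Suc_atMost)
  then obtain e where e: "\<And>i. bij_betw (e i) {..\<beta> i} (S i)" by metis
  define x :: "'n \<Rightarrow> nat \<Rightarrow> 'p padic" where "x i j = (if j \<le> \<beta> i then of_nat (e i j) else undefined)" for i j
  have "inj_on (x i) {..\<beta> i}" for i
    using e[of i] by (auto simp: bij_betw_def inj_on_def x_def)
  then have "x \<in> distinct_blocks padic_cube \<beta>"
    by (auto simp: distinct_blocks_def in_blocks_iff x_def)
  moreover have "functional f (\<lambda>i. nat_difference (S i)) = divided_difference sc \<beta> f x"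
    using e by (intro functional_nat_difference) (auto simp: x_def)
  moreover have "\<forall>i. \<forall>j\<le>\<beta> i. x i j = of_nat (e i j)" by (simp add: x_def)
  ultimately show ?thesis using e by blast
qed

text \<open>This estimate, applied to differences of functions, gives the continuity of the
  coefficient map. The orders \<open>k i\<close> depend on the coordinate and on \<nu>, so all
  \<beta> \<le> \<alpha> have to be controlled.\<close>

lemma mahler_coeff_bound:
  fixes f :: "('n::finite \<Rightarrow> 'p padic) \<Rightarrow> 'e"
  assumes q: "q \<in> cs" and M: "M \<ge> 0"
    and f: "\<And>\<beta> x. \<beta> \<le> \<alpha> \<Longrightarrow> x \<in> distinct_blocks padic_cube \<beta> \<Longrightarrow> q (divided_difference sc \<beta> f x) \<le> M"
  shows "weight \<alpha> \<nu> * q (mahler f \<nu>) \<le> (\<Prod>i\<in>UNIV. decay_const CARD('p) (\<alpha> i)) * M"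
proof -
  let ?A = "\<lambda>i k d P. k \<le> \<alpha> i \<and> P \<in> difference_span k \<and> (delta :: 'p padic poly) ^ \<nu> i = smult d P \<and>
     weight_factor (\<alpha> i) (\<nu> i) * padic_norm d \<le> decay_const CARD('p) (\<alpha> i)"
  have "\<forall>i. \<exists>k d P. ?A i k d P"
    using delta_power_decay'[where ?'p = 'p] by meson
  then obtain k d P where k: "\<forall>i. ?A i (k i) (d i) (P i)"
    unfolding choice_iff by blast
  show ?thesis
  proof (rule weighted_mahler_bound[OF q M, where G = "\<lambda>i. nat_differences (k i)"])
    fix P assume "\<And>i. (P i :: 'p padic poly) \<in> nat_differences (k i)"
    then have "\<forall>i. \<exists>S. finite S \<and> card S = Suc (k i) \<and> P i = nat_difference S" by blast
    then obtain S where S: "\<forall>i. finite (S i) \<and> card (S i) = Suc (k i) \<and> P i = nat_difference (S i)"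
      unfolding choice_iff by blast
    then have P: "P = (\<lambda>i. nat_difference (S i))" by auto
    have "finite (S i)" "card (S i) = Suc (k i)" for i using S by auto
    from nat_difference_block[of S k f, OF this] obtain x where
      "x \<in> distinct_blocks (\<lambda>_. padic_integers :: 'p padic set) k"
      "functional f (\<lambda>i. nat_difference (S i)) = divided_difference sc k f x" by blast
    then show "q (functional f P) \<le> M" using f[of k x] k by (simp add: P le_fun_def)
  qed (use k in blast)+
qed

section \<open>Uniform continuity of difference quotients and convergence of the coefficients to
  zero\<close>

lemma cs_bounded_on_blocks:
  fixes g :: "('n::finite \<Rightarrow> nat \<Rightarrow> 'p padic) \<Rightarrow> 'e"
  assumes q: "q \<in> cs" and g: "continuous_on (blocks padic_cube \<beta>) g"
  shows "\<exists>M\<ge>0. \<forall>x\<in>blocks padic_cube \<beta>. q (g x) \<le> M"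
proof -
  let ?K = "blocks (\<lambda>_. padic_integers :: 'p padic set) \<beta>"
  have "compact ((\<lambda>x. q (g x)) ` ?K)"
    by (intro compact_continuous_image compact_blocks compact_padic_integers
        continuous_on_compose2[OF cs_continuous[OF q] g]) auto
  then have "bounded ((\<lambda>x. q (g x)) ` ?K)" by (rule compact_imp_bounded)
  then obtain M where M: "\<And>x. x \<in> ?K \<Longrightarrow> \<bar>q (g x)\<bar> \<le> M" by (auto simp: bounded_iff)
  show ?thesis by (rule exI[of _ "max M 0"]) (use M in \<open>auto simp: le_max_iff_disj abs_le_iff\<close>)
qed

text \<open>Entries beyond \<open>b\<close> stay, since in a block they are pinned to
  \<open>undefined\<close>.\<close>

definition shift_block :: "'n \<Rightarrow> nat \<Rightarrow> 'p padic \<Rightarrow> ('n \<Rightarrow> nat \<Rightarrow> 'p padic) \<Rightarrow> 'n \<Rightarrow> nat \<Rightarrow> 'p padic" where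
  "shift_block i b h x = x(i := \<lambda>j. if j \<le> b then h + x i j else x i j)"

lemma shift_block_in_blocks:
  "x \<in> blocks padic_cube \<beta> \<Longrightarrow> h \<in> padic_integers \<Longrightarrow> shift_block i (\<beta> i) h x \<in> blocks padic_cube \<beta>"
  by (auto simp: in_blocks_iff shift_block_def intro: padic_integers_add)

text \<open>Counterexamples for ever larger r would accumulate, by compactness, at some block l.
  Their shifts converge to l as well because p^r tends to 0, which contradicts continuity at
  l.\<close>

lemma shift_block_small:
  fixes g :: "('n::finite \<Rightarrow> nat \<Rightarrow> 'p padic) \<Rightarrow> 'e"
  assumes q: "q \<in> cs" and g: "continuous_on (blocks padic_cube \<beta>) g" and \<epsilon>: "\<epsilon> > 0"
  shows "\<exists>R. \<forall>r\<ge>R. \<forall>x\<in>blocks padic_cube \<beta>.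
    q (g (shift_block i (\<beta> i) (of_nat CARD('p) ^ r) x) - g x) < \<epsilon>"
proof (rule ccontr)
  let ?K = "blocks (\<lambda>_. padic_integers :: 'p padic set) \<beta>"
  let ?h = "\<lambda>r. of_nat CARD('p) ^ r :: 'p padic"
  have h: "?h r \<in> padic_integers" for r using of_nat_integer[of "CARD('p) ^ r"] by simp
  assume "\<not> ?thesis"
  then have "\<forall>R. \<exists>r x. r \<ge> R \<and> x \<in> ?K \<and> \<not> q (g (shift_block i (\<beta> i) (?h r) x) - g x) < \<epsilon>" by blast
  then obtain r x where rx: "\<And>R. r R \<ge> R" "\<And>R. x R \<in> ?K"
    "\<And>R. \<not> q (g (shift_block i (\<beta> i) (?h (r R)) (x R)) - g (x R)) < \<epsilon>" by metis
  have "seq_compact ?K" by (intro compact_imp_seq_compact compact_blocks compact_padic_integers)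
  then obtain l \<sigma> where l: "l \<in> ?K" "strict_mono \<sigma>" "(x \<circ> \<sigma>) \<longlonglongrightarrow> l"
    using rx(2) by (metis seq_compactE)
  have lx: "(\<lambda>m. x (\<sigma> m)) \<longlonglongrightarrow> l" using l(3) by (simp add: o_def)
  then have lxij: "(\<lambda>m. x (\<sigma> m) i' j) \<longlonglongrightarrow> l i' j" for i' j by (simp add: tendsto_fun_iff)
  have "filterlim (\<lambda>m. r (\<sigma> m)) sequentially sequentially"
  proof (rule filterlim_at_top_mono[OF filterlim_subseq[OF l(2)]])
    show "\<forall>\<^sub>F m in sequentially. \<sigma> m \<le> r (\<sigma> m)" using rx(1) by simp
  qed
  then have h0: "(\<lambda>m. ?h (r (\<sigma> m))) \<longlonglongrightarrow> 0" by (rule filterlim_compose[OF p_power_tendsto_0])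
  define y where "y m = shift_block i (\<beta> i) (?h (r (\<sigma> m))) (x (\<sigma> m))" for m
  have ly: "y \<longlonglongrightarrow> l"
    unfolding tendsto_fun_iff
  proof (intro allI)
    fix i' j
    show "(\<lambda>m. y m i' j) \<longlonglongrightarrow> l i' j"
      using tendsto_add[OF h0 lxij[of i' j]] lxij[of i' j]
      by (cases "i' = i"; cases "j \<le> \<beta> i") (simp_all add: y_def shift_block_def)
  qed
  have "y m \<in> ?K" for m unfolding y_def by (intro shift_block_in_blocks rx(2) h)
  then have "(\<lambda>m. g (y m)) \<longlonglongrightarrow> g l" by (intro continuous_on_tendsto_compose[OF g ly l(1)]) simp
  moreover have "(\<lambda>m. g (x (\<sigma> m))) \<longlonglongrightarrow> g l"
    using rx(2) by (intro continuous_on_tendsto_compose[OF g lx l(1)]) simp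
  ultimately have "(\<lambda>m. g (y m) - g (x (\<sigma> m))) \<longlonglongrightarrow> g l - g l" by (rule tendsto_diff)
  then have "(\<lambda>m. g (y m) - g (x (\<sigma> m))) \<longlonglongrightarrow> 0" by simp
  then have "\<forall>\<^sub>F m in sequentially. q (g (y m) - g (x (\<sigma> m)) - 0) < \<epsilon>"
    using q \<epsilon> unfolding tendsto_cs_iff by blast
  then show False using rx(3) by (auto simp: y_def eventually_sequentially)
qed

lemma functional_diff: "functional f (P(i := A - B)) = functional f (P(i := A)) - functional f (P(i := B))"
  using functional_add[of f P i "A - B" B] by (simp only: diff_add_cancel eq_diff_eq)

text \<open>One large coordinate suffices: in it the generators are small differences, in the others
  ordinary ones. The functional is then either an increment of a difference quotient under a shift
  or carries a factor p^t, and in both cases is at most \<delta>.\<close>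

lemma mahler_coeff_decay:
  fixes f :: "('n::finite \<Rightarrow> 'p padic) \<Rightarrow> 'e"
  assumes f: "C_alpha sc padic_cube \<alpha> f" and q: "q \<in> cs" and \<epsilon>: "\<epsilon> > 0"
  shows "\<exists>N. \<forall>\<nu>. (\<exists>i. N \<le> \<nu> i) \<longrightarrow> weight \<alpha> \<nu> * q (mahler f \<nu>) < \<epsilon>"
proof -
  let ?K = "blocks (\<lambda>_. padic_integers :: 'p padic set)" and ?D = "distinct_blocks (\<lambda>_. padic_integers :: 'p padic set)"
  let ?C = "(\<Prod>i\<in>UNIV. decay_const CARD('p) (\<alpha> i))"
  have C: "?C > 0" using CARD_gt_1[where ?'p = 'p] by (intro prod_pos) (auto simp: decay_const_def)
  define \<delta> where "\<delta> = \<epsilon> / (2 * ?C)"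
  have \<delta>: "\<delta> > 0" "?C * \<delta> < \<epsilon>" using C \<epsilon> by (auto simp: \<delta>_def)
  have fin: "finite {\<beta>. \<beta> \<le> \<alpha>}" by (rule finite_multiindices_le)
  have "\<forall>\<beta>. \<exists>g. \<beta> \<le> \<alpha> \<longrightarrow> extends_divided_difference sc padic_cube \<beta> f g"
    using f by (auto simp: C_alpha_def)
  then obtain g where "\<forall>\<beta>. \<beta> \<le> \<alpha> \<longrightarrow> extends_divided_difference sc padic_cube \<beta> f (g \<beta>)"
    unfolding choice_iff by blast
  then have g: "continuous_on (?K \<beta>) (g \<beta>)" "\<And>x. x \<in> ?D \<beta> \<Longrightarrow> g \<beta> x = divided_difference sc \<beta> f x"
    if "\<beta> \<le> \<alpha>" for \<beta> using that by (auto simp: extends_divided_difference_def)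
  have "\<forall>\<beta>. \<exists>M. \<beta> \<le> \<alpha> \<longrightarrow> M \<ge> 0 \<and> (\<forall>x\<in>?K \<beta>. q (g \<beta> x) \<le> M)"
  proof
    fix \<beta>
    show "\<exists>M. \<beta> \<le> \<alpha> \<longrightarrow> M \<ge> 0 \<and> (\<forall>x\<in>?K \<beta>. q (g \<beta> x) \<le> M)"
      using cs_bounded_on_blocks[OF q g(1)] by (cases "\<beta> \<le> \<alpha>") auto
  qed
  then obtain M' where M': "\<forall>\<beta>. \<beta> \<le> \<alpha> \<longrightarrow> M' \<beta> \<ge> 0 \<and> (\<forall>x\<in>?K \<beta>. q (g \<beta> x) \<le> M' \<beta>)"
    unfolding choice_iff by blast
  define M where "M = (\<Sum>\<beta> | \<beta> \<le> \<alpha>. M' \<beta>)"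
  have M0: "M \<ge> 0" unfolding M_def using M' by (intro sum_nonneg) auto
  have M: "q (g \<beta> x) \<le> M" if "\<beta> \<le> \<alpha>" "x \<in> ?K \<beta>" for \<beta> x
  proof -
    have "M' \<beta> \<le> M" unfolding M_def using M' that(1) by (intro member_le_sum fin) auto
    then show ?thesis using M' that by (meson order_trans)
  qed
  obtain t where t: "1 / real CARD('p) ^ t * M \<le> \<delta>"
  proof -
    have "(\<lambda>t. 1 / real CARD('p) ^ t * M) \<longlonglongrightarrow> 0 * M"
      by (intro tendsto_mult inverse_p_power_tendsto_0 tendsto_const)
    then have "\<forall>\<^sub>F t in sequentially. 1 / real CARD('p) ^ t * M < \<delta>"
      using \<delta>(1) by (intro order_tendstoD(2)) auto
    then show ?thesis using that by (auto simp: eventually_sequentially intro: less_imp_le)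
  qed
  have "\<forall>\<beta> i. \<exists>R. \<beta> \<le> \<alpha> \<longrightarrow> (\<forall>r\<ge>R. \<forall>x\<in>?K \<beta>. q (g \<beta> (shift_block i (\<beta> i) (of_nat CARD('p) ^ r) x) - g \<beta> x) < \<delta>)"
    using shift_block_small[OF q g(1) \<delta>(1)] by blast
  then obtain R where R: "\<forall>\<beta> i. \<beta> \<le> \<alpha> \<longrightarrow> (\<forall>r\<ge>R \<beta> i. \<forall>x\<in>?K \<beta>. q (g \<beta> (shift_block i (\<beta> i) (of_nat CARD('p) ^ r) x) - g \<beta> x) < \<delta>)"
    unfolding choice_iff by blast
  \<comment> \<open>The orders \<open>k\<close> below depend on \<nu> and cannot be prescribed, so
    one r, like one M and one t, has to serve all \<beta> \<le> \<alpha> and all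
    coordinates.\<close>
  define r where "r = (\<Sum>\<beta> | \<beta> \<le> \<alpha>. \<Sum>i\<in>UNIV. R \<beta> i)"
  have r: "q (g \<beta> (shift_block i (\<beta> i) (of_nat CARD('p) ^ r) x) - g \<beta> x) \<le> \<delta>" if "\<beta> \<le> \<alpha>" "x \<in> ?K \<beta>" for \<beta> i x
  proof -
    have "R \<beta> i \<le> (\<Sum>i\<in>UNIV. R \<beta> i)" by (intro member_le_sum) auto
    also have "\<dots> \<le> r" unfolding r_def using that(1) by (intro member_le_sum[of \<beta> _ "\<lambda>\<beta>. \<Sum>i\<in>UNIV. R \<beta> i"] fin) auto
    finally show ?thesis using R that by (auto intro: less_imp_le)
  qed
  define N where "N = Suc (2 * (CARD('p) ^ r * t))"
  have "weight \<alpha> \<nu> * q (mahler f \<nu>) < \<epsilon>" if i0: "N \<le> \<nu> i0" for \<nu> i0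
  proof -
    define G :: "'n \<Rightarrow> nat \<Rightarrow> 'p padic poly set" where
      "G i k = (if i = i0 then small_differences r t k else nat_differences k)" for i k
    let ?A = "\<lambda>i k d P. k \<le> \<alpha> i \<and> P \<in> integral_span (G i k) \<and> (delta :: 'p padic poly) ^ \<nu> i = smult d P \<and>
       weight_factor (\<alpha> i) (\<nu> i) * padic_norm d \<le> decay_const CARD('p) (\<alpha> i)"
    have "\<exists>k d P. ?A i k d P" for i
    proof (cases "i = i0")
      case True
      then show ?thesis using delta_power_small_decay[of r t "\<nu> i" "\<alpha> i", where ?'p = 'p] i0
        by (simp add: G_def N_def Suc_le_eq) meson
    next
      case False
      then show ?thesis using delta_power_decay'[of "\<alpha> i" "\<nu> i", where ?'p = 'p] by (simp add: G_def) meson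
    qed
    then have "\<forall>i. \<exists>k d P. ?A i k d P" by blast
    then obtain k d P where k: "\<forall>i. ?A i (k i) (d i) (P i)" unfolding choice_iff by blast
    have k\<alpha>: "k \<le> \<alpha>" using k by (simp add: le_fun_def)
    have "weight \<alpha> \<nu> * q (mahler f \<nu>) \<le> ?C * \<delta>"
    proof (rule weighted_mahler_bound[OF q less_imp_le[OF \<delta>(1)], where G = "\<lambda>i. G i (k i)"])
      fix P assume P: "\<And>i. P i \<in> G i (k i)"
      let ?h = "CARD('p) ^ r"
      let ?R = "\<lambda>i S. finite S \<and> card S = Suc (k i) \<and> (i \<noteq> i0 \<longrightarrow> P i = nat_difference S) \<and>
          (i = i0 \<longrightarrow> P i = (monom 1 ?h - 1) * nat_difference S \<or> P i = smult (of_nat CARD('p) ^ t) (nat_difference S))"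
      have "\<forall>i. \<exists>S. ?R i S"
      proof
        fix i
        show "\<exists>S. ?R i S"
          using P[of i] unfolding G_def by (cases "i = i0") auto
      qed
      then obtain S where S: "\<forall>i. ?R i (S i)"
        unfolding choice_iff by blast
      define B where "B = (\<lambda>i. nat_difference (S i) :: 'p padic poly)"
      have PB: "P = B(i0 := P i0)"
      proof
        show "P i = (B(i0 := P i0)) i" for i using S by (cases "i = i0") (auto simp: B_def)
      qed
      have "finite (S i)" "card (S i) = Suc (k i)" for i using S by auto
      from nat_difference_block[of S k f, OF this] obtain e x where e': "\<forall>i. bij_betw (e i) {..k i} (S i)"
        and xe': "\<forall>i. \<forall>j\<le>k i. x i j = of_nat (e i j)" and x: "x \<in> ?D k"
        and Bx: "functional f B = divided_difference sc k f x" unfolding B_def by blast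
      have e: "bij_betw (e i) {..k i} (S i)" for i using e' by blast
      have xe: "x i j = of_nat (e i j)" if "j \<le> k i" for i j using xe' that by blast
      have xK: "x \<in> ?K k" using x by (simp add: distinct_blocks_def)
      have Bg: "functional f B = g k x" using Bx g(2)[OF k\<alpha> x] by simp
      consider "P i0 = (monom 1 ?h - 1) * B i0" | "P i0 = smult (of_nat CARD('p) ^ t) (B i0)"
        using S unfolding B_def by blast
      then show "q (functional f P) \<le> \<delta>"
      proof cases
        case 1
        let ?x = "shift_block i0 (k i0) (of_nat CARD('p) ^ r) x"
        \<comment> \<open>Multiplying slot \<open>i0\<close> by T^(p^r) - 1 subtracts the original
          grid from the translated one, so the points and their enumeration are translated in this
          coordinate alone.\<close>
        let ?S = "S(i0 := (+) ?h ` S i0)" and ?e = "e(i0 := \<lambda>j. ?h + e i0 j)"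
        have bij: "bij_betw (?e i) {..k i} (?S i)" for i
        proof (cases "i = i0")
          case True
          have "bij_betw ((+) ?h) (S i0) ((+) ?h ` S i0)" by (simp add: bij_betw_def)
          from bij_betw_trans[OF e this] show ?thesis using True by (simp add: o_def)
        qed (use e in simp)
        have "P i0 = nat_difference ((+) ?h ` S i0) - B i0"
          using 1 by (simp add: B_def left_diff_distrib nat_difference_shift)
        then have "functional f P = functional f (B(i0 := nat_difference ((+) ?h ` S i0))) - functional f (B(i0 := B i0))"
          by (subst PB) (simp only: functional_diff)
        also have "B(i0 := nat_difference ((+) ?h ` S i0)) = (\<lambda>i. nat_difference (?S i))" by (auto simp: B_def)
        also have "functional f \<dots> = divided_difference sc k f ?x"
          using bij by (rule functional_nat_difference) (auto simp: shift_block_def xe)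
        also have "\<dots> = g k ?x"
        proof (rule g(2)[OF k\<alpha>, symmetric])
          have "of_nat CARD('p) ^ r \<in> (padic_integers :: 'p padic set)"
            using of_nat_integer[of ?h] by simp
          then have "?x \<in> ?K k" by (intro shift_block_in_blocks xK)
          moreover have "inj_on (?x i) {..k i}" for i
            using x by (auto simp: distinct_blocks_def shift_block_def inj_on_def)
          ultimately show "?x \<in> ?D k" by (simp add: distinct_blocks_def)
        qed
        finally show ?thesis using r[OF k\<alpha> xK, of i0] by (simp add: Bg)
      next
        case 2
        have "functional f P = sc (of_nat CARD('p) ^ t) (functional f (B(i0 := B i0)))"
          by (subst PB) (simp only: 2 functional_smult)
        then have "q (functional f P) = 1 / real CARD('p) ^ t * q (g k x)"
          by (simp add: Bg cs_scale[OF q] padic_norm_p_power)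
        also have "\<dots> \<le> 1 / real CARD('p) ^ t * M" using M[OF k\<alpha> xK] by (intro mult_left_mono) auto
        finally show ?thesis using t by simp
      qed
    qed (use k in blast)+
    then show ?thesis using \<delta>(2) by linarith
  qed
  then show ?thesis by blast
qed

end

subsection \<open>Weighted null families\<close>

context lcs
begin

lemma vector_space_pointwise: "vector_space (pointwise sc :: 'p padic \<Rightarrow> ('x \<Rightarrow> 'e) \<Rightarrow> 'x \<Rightarrow> 'e)"
  by unfold_locales (simp_all add: pointwise_def fun_eq_iff scale_right_distrib scale_left_distrib)

context
  fixes w :: "'x \<Rightarrow> real"
  assumes w_pos: "\<And>x. w x > 0"
begin

lemma c0_spaceD:
  "g \<in> c0_space sc w \<Longrightarrow> q \<in> cs \<Longrightarrow> \<epsilon> > 0 \<Longrightarrow> \<exists>\<Phi>. finite \<Phi> \<and> (\<forall>x. x \<notin> \<Phi> \<longrightarrow> w x * q (g x) < \<epsilon>)"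
  by (simp add: c0_space_def)

lemma c0_bdd_above:
  assumes "g \<in> c0_space sc w" "q \<in> cs"
  shows "bdd_above (range (\<lambda>x. w x * q (g x)))"
proof -
  obtain \<Phi> where \<Phi>: "finite \<Phi>" "\<forall>x. x \<notin> \<Phi> \<longrightarrow> w x * q (g x) < 1"
    using c0_spaceD[OF assms, of 1] by auto
  have "finite ((\<lambda>x. w x * q (g x)) ` \<Phi>)" using \<Phi> by simp
  then obtain M where M: "\<forall>y\<in>(\<lambda>x. w x * q (g x)) ` \<Phi>. y \<le> M"
    using bdd_above_finite unfolding bdd_above_def by metis
  have "w x * q (g x) \<le> max M 1" for x
    using M \<Phi>(2)[rule_format, of x] by (cases "x \<in> \<Phi>") (auto simp: le_max_iff_disj)
  then show ?thesis by (intro bdd_aboveI[of _ "max M 1"]) auto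
qed

lemma weighted_seminorm_upper:
  assumes "g \<in> c0_space sc w" "q \<in> cs"
  shows "w x * q (g x) \<le> weighted_seminorm w q g"
  unfolding weighted_seminorm_def using c0_bdd_above[OF assms] by (intro cSUP_upper) auto

lemma weighted_seminorm_least:
  assumes "\<And>x. w x * q (g x) \<le> M"
  shows "weighted_seminorm w q g \<le> M"
  unfolding weighted_seminorm_def using assms by (intro cSUP_least) auto

lemma c0_space_add:
  assumes "g \<in> c0_space sc w" "h \<in> c0_space sc w"
  shows "g + h \<in> c0_space sc w"
  unfolding c0_space_def mem_Collect_eq
proof (intro ballI allI impI)
  fix q and \<epsilon> :: real assume q: "q \<in> cs" and \<epsilon>: "\<epsilon> > 0"
  obtain \<Phi> where \<Phi>: "finite \<Phi>" "\<forall>x. x \<notin> \<Phi> \<longrightarrow> w x * q (g x) < \<epsilon>"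
    using c0_spaceD[OF assms(1) q \<epsilon>] by blast
  obtain \<Psi> where \<Psi>: "finite \<Psi>" "\<forall>x. x \<notin> \<Psi> \<longrightarrow> w x * q (h x) < \<epsilon>"
    using c0_spaceD[OF assms(2) q \<epsilon>] by blast
  have "w x * q ((g + h) x) < \<epsilon>" if "x \<notin> \<Phi> \<union> \<Psi>" for x
  proof -
    have "w x * q (g x + h x) \<le> w x * max (q (g x)) (q (h x))"
      using cs_ultra[OF q] w_pos[of x] by simp
    also have "\<dots> < \<epsilon>" using \<Phi>(2) \<Psi>(2) that by (simp add: max_def)
    finally show ?thesis by simp
  qed
  then show "\<exists>\<Phi>. finite \<Phi> \<and> (\<forall>x. x \<notin> \<Phi> \<longrightarrow> w x * q ((g + h) x) < \<epsilon>)"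
    using \<Phi>(1) \<Psi>(1) by (intro exI[of _ "\<Phi> \<union> \<Psi>"]) auto
qed

lemma c0_space_scale:
  assumes "g \<in> c0_space sc w"
  shows "pointwise sc c g \<in> c0_space sc w"
  unfolding c0_space_def mem_Collect_eq
proof (intro ballI allI impI)
  fix q and \<epsilon> :: real assume q: "q \<in> cs" and \<epsilon>: "\<epsilon> > 0"
  have pos: "padic_norm c + 1 > 0" using padic_norm_nonneg[of c] by linarith
  then obtain \<Phi> where \<Phi>: "finite \<Phi>" "\<forall>x. x \<notin> \<Phi> \<longrightarrow> w x * q (g x) < \<epsilon> / (padic_norm c + 1)"
    using c0_spaceD[OF assms q divide_pos_pos[OF \<epsilon>]] by blast
  have "w x * q (pointwise sc c g x) < \<epsilon>" if "x \<notin> \<Phi>" for x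
  proof -
    have "w x * q (pointwise sc c g x) = padic_norm c * (w x * q (g x))"
      by (simp add: pointwise_def cs_scale[OF q])
    also have "\<dots> \<le> (padic_norm c + 1) * (w x * q (g x))"
      using cs_nonneg[OF q] w_pos[of x] by (intro mult_right_mono mult_nonneg_nonneg) (auto simp: less_imp_le)
    also have "\<dots> < \<epsilon>" using \<Phi>(2) that pos by (simp add: field_simps)
    finally show ?thesis .
  qed
  then show "\<exists>\<Phi>. finite \<Phi> \<and> (\<forall>x. x \<notin> \<Phi> \<longrightarrow> w x * q (pointwise sc c g x) < \<epsilon>)" using \<Phi>(1) by blast
qed

lemma seminormed_c0: "seminormed (pointwise sc) (c0_space sc w) (weighted_seminorm w ` cs)"
proof -
  interpret V: vector_space "pointwise sc :: 'p padic \<Rightarrow> ('x \<Rightarrow> 'e) \<Rightarrow> 'x \<Rightarrow> 'e" by (rule vector_space_pointwise)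
  have z: "(0 :: 'x \<Rightarrow> 'e) \<in> c0_space sc w" by (auto simp: c0_space_def seminorm_0 intro!: exI[of _ "{}"])
  show ?thesis
  proof
    show "V.subspace (c0_space sc w)"
      unfolding V.subspace_def using z c0_space_add c0_space_scale by blast
    fix Q :: "('x \<Rightarrow> 'e) \<Rightarrow> real" and g assume Q: "Q \<in> weighted_seminorm w ` cs" and g: "g \<in> c0_space sc w"
    then obtain q where q: "q \<in> cs" "Q = weighted_seminorm w q" by blast
    have "0 \<le> w undefined * q (g undefined)" using w_pos[of undefined] cs_nonneg[OF q(1)] by simp
    then show Q0: "0 \<le> Q g" unfolding q(2) using weighted_seminorm_upper[OF g q(1)] by (rule order_trans)
    show "Q (pointwise sc c g) = padic_norm c * Q g" for c
    proof (rule antisym)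
      show "Q (pointwise sc c g) \<le> padic_norm c * Q g"
        unfolding q(2)
      proof (rule weighted_seminorm_least)
        fix x
        have "w x * q (pointwise sc c g x) = padic_norm c * (w x * q (g x))"
          by (simp add: pointwise_def cs_scale[OF q(1)])
        also have "\<dots> \<le> padic_norm c * weighted_seminorm w q g"
          using weighted_seminorm_upper[OF g q(1)] by (intro mult_left_mono padic_norm_nonneg)
        finally show "w x * q (pointwise sc c g x) \<le> padic_norm c * weighted_seminorm w q g" .
      qed
      \<comment> \<open>The supremum is handled as a least upper bound, so the reverse inequality is
        proved after division by the norm of c, and c = 0 is treated apart.\<close>
      show "padic_norm c * Q g \<le> Q (pointwise sc c g)"
      proof (cases "c = 0")
        case True
        then have p0: "pointwise sc c g = 0" by (simp add: pointwise_def fun_eq_iff)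
        have "0 \<le> w undefined * q ((0 :: 'x \<Rightarrow> 'e) undefined)" using w_pos[of undefined] cs_nonneg[OF q(1)] by simp
        then have "0 \<le> Q 0" unfolding q(2) using weighted_seminorm_upper[OF z q(1)] by (rule order_trans)
        then show ?thesis using True p0 by simp
      next
        case False
        then have c: "padic_norm c > 0" using padic_norm_nonneg[of c] by (simp add: order_less_le padic_norm_eq_0_iff)
        have "Q g \<le> Q (pointwise sc c g) / padic_norm c"
          unfolding q(2)
        proof (rule weighted_seminorm_least)
          fix x
          have "padic_norm c * (w x * q (g x)) = w x * q (pointwise sc c g x)"
            by (simp add: pointwise_def cs_scale[OF q(1)])
          also have "\<dots> \<le> weighted_seminorm w q (pointwise sc c g)"
            by (intro weighted_seminorm_upper c0_space_scale g q(1))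
          finally show "w x * q (g x) \<le> weighted_seminorm w q (pointwise sc c g) / padic_norm c"
            using c by (simp add: field_simps)
        qed
        then show ?thesis using c by (simp add: field_simps)
      qed
    qed
    fix h assume h: "h \<in> c0_space sc w"
    show "Q (g + h) \<le> max (Q g) (Q h)"
      unfolding q(2)
    proof (rule weighted_seminorm_least)
      fix x
      have "w x * q ((g + h) x) \<le> w x * max (q (g x)) (q (h x))"
        using cs_ultra[OF q(1)] w_pos[of x] by simp
      also have "\<dots> = max (w x * q (g x)) (w x * q (h x))"
        using w_pos[of x] by (simp add: max_mult_distrib_left)
      also have "\<dots> \<le> max (weighted_seminorm w q g) (weighted_seminorm w q h)"
        by (intro max.mono weighted_seminorm_upper g h q(1))
      finally show "w x * q ((g + h) x) \<le> max (weighted_seminorm w q g) (weighted_seminorm w q h)" .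
    qed
  qed
qed

lemma c0_separated:
  assumes "g \<in> c0_space sc w" "g \<noteq> 0"
  shows "\<exists>Q\<in>weighted_seminorm w ` cs. Q g > 0"
proof -
  obtain x where "g x \<noteq> 0" using assms(2) by (auto simp: fun_eq_iff)
  then obtain q where q: "q \<in> cs" "q (g x) > 0" using cs_separated by blast
  then have "0 < w x * q (g x)" using w_pos by simp
  also have "\<dots> \<le> weighted_seminorm w q g" using assms(1) q(1) by (rule weighted_seminorm_upper)
  finally show ?thesis using q(1) by blast
qed

lemma weighted_seminorm_mono:
  assumes "g \<in> c0_space sc w" "r \<in> cs" "\<And>y. q y \<le> r y"
  shows "weighted_seminorm w q g \<le> weighted_seminorm w r g"
proof (rule weighted_seminorm_least)
  fix x
  have "w x * q (g x) \<le> w x * r (g x)" using assms(3) w_pos[of x] by simp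
  also have "\<dots> \<le> weighted_seminorm w r g" using assms(1,2) by (rule weighted_seminorm_upper)
  finally show "w x * q (g x) \<le> weighted_seminorm w r g" .
qed

end

subsection \<open>Mahler series\<close>

abbreviation binomial_diffs :: "('n::finite \<Rightarrow> nat) \<Rightarrow> ('n \<Rightarrow> nat) \<Rightarrow> ('n \<Rightarrow> nat \<Rightarrow> 'p padic) \<Rightarrow> 'p padic" where
  "binomial_diffs \<beta> \<nu> x \<equiv> \<Prod>i\<in>UNIV. binomial_diff (\<beta> i) (\<nu> i) (x i)"

text \<open>Summing over boxes turns the multiple series into a sequence, to which sequential
  completeness applies. With the order \<beta> as a parameter, the same partial sums yield the
  series and all its difference quotients.\<close>

definition mahler_partial :: "('n::finite \<Rightarrow> nat) \<Rightarrow> (('n \<Rightarrow> nat) \<Rightarrow> 'e) \<Rightarrow> nat \<Rightarrow> ('n \<Rightarrow> nat \<Rightarrow> 'p padic) \<Rightarrow> 'e" where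
  "mahler_partial \<beta> b N x = (\<Sum>\<nu> | \<nu> \<le> (\<lambda>_. N). sc (binomial_diffs \<beta> \<nu> x) (b \<nu>))"

definition diff_series :: "('n::finite \<Rightarrow> nat) \<Rightarrow> (('n \<Rightarrow> nat) \<Rightarrow> 'e) \<Rightarrow> ('n \<Rightarrow> nat \<Rightarrow> 'p padic) \<Rightarrow> 'e" where
  "diff_series \<beta> b x = lim (\<lambda>N. mahler_partial \<beta> b N x)"

text \<open>For order 0 only entry 0 of each block is read, so x is passed as a constant block; the
  value 0 off the cube is required by \<open>C_alpha_space\<close>.\<close>

definition mahler_series :: "(('n::finite \<Rightarrow> nat) \<Rightarrow> 'e) \<Rightarrow> ('n \<Rightarrow> 'p padic) \<Rightarrow> 'e" where
  "mahler_series b x = (if x \<in> Pi UNIV padic_cube then diff_series (\<lambda>_. 0) b (\<lambda>i _. x i) else 0)"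

lemma mahler_term_le:
  assumes q: "q \<in> cs" and \<beta>: "\<beta> \<le> \<alpha>" and x: "\<And>i j. j \<le> \<beta> i \<Longrightarrow> x i j \<in> padic_integers"
  shows "q (sc (binomial_diffs \<beta> \<nu> x) v) \<le> weight \<alpha> \<nu> * q v"
proof -
  have "padic_norm (binomial_diffs \<beta> \<nu> x) \<le> weight \<alpha> \<nu>"
    unfolding padic_norm_prod weight_eq_prod
  proof (intro prod_mono conjI padic_norm_nonneg)
    fix i
    have "padic_norm (binomial_diff (\<beta> i) (\<nu> i) (x i)) \<le> real (\<nu> i) ^ \<beta> i"
      using x by (intro padic_norm_binomial_diff_le)
    \<comment> \<open>For \<open>\<nu> i = 0\<close> the left side is 0 or 1 and the weight is 1 by
      convention; otherwise powers of \<open>\<nu> i\<close> grow with the exponent.\<close>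
    also have "\<dots> \<le> weight_factor (\<alpha> i) (\<nu> i)"
      using \<beta> by (auto simp: weight_factor_def le_fun_def power_0_left intro!: power_increasing)
    finally show "padic_norm (binomial_diff (\<beta> i) (\<nu> i) (x i)) \<le> weight_factor (\<alpha> i) (\<nu> i)" .
  qed
  then show ?thesis using cs_nonneg[OF q] by (simp add: cs_scale[OF q] mult_right_mono)
qed

text \<open>The box contains the finite set outside which the weighted terms are below \<epsilon>,
  and sums of such terms obey the same bound by the ultrametric inequality. N does not depend on x,
  so the convergence is uniform.\<close>

lemma mahler_partial_tail:
  fixes \<alpha> :: "'n::finite \<Rightarrow> nat"
  assumes q: "q \<in> cs" and b: "b \<in> c0_space sc (weight \<alpha>)" and \<beta>: "\<beta> \<le> \<alpha>" and \<epsilon>: "\<epsilon> > 0"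
  shows "\<exists>N. \<forall>n\<ge>N. \<forall>x. (\<forall>i. \<forall>j\<le>\<beta> i. x i j \<in> padic_integers) \<longrightarrow>
    q (mahler_partial \<beta> b n x - mahler_partial \<beta> b N x) \<le> \<epsilon>"
proof -
  obtain \<Phi> where \<Phi>: "finite \<Phi>" "\<forall>\<nu>. \<nu> \<notin> \<Phi> \<longrightarrow> weight \<alpha> \<nu> * q (b \<nu>) < \<epsilon>"
    using c0_spaceD[OF weight_pos b q \<epsilon>] by blast
  define N where "N = (\<Sum>\<nu>\<in>\<Phi>. \<Sum>i\<in>UNIV. \<nu> i)"
  have N: "\<nu> \<le> (\<lambda>_. N)" if "\<nu> \<in> \<Phi>" for \<nu>
  proof (rule le_funI)
    fix i
    have "\<nu> i \<le> (\<Sum>i\<in>UNIV. \<nu> i)" by (intro member_le_sum) auto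
    also have "\<dots> \<le> N" unfolding N_def using that \<Phi>(1) by (intro member_le_sum[of \<nu> _ "\<lambda>\<nu>. \<Sum>i\<in>UNIV. \<nu> i"]) auto
    finally show "\<nu> i \<le> N" .
  qed
  show ?thesis
  proof (intro exI[of _ N] allI impI)
    fix n and x :: "'n \<Rightarrow> nat \<Rightarrow> 'p padic" assume n: "N \<le> n" and x: "\<forall>i. \<forall>j\<le>\<beta> i. x i j \<in> padic_integers"
    have sub: "{\<nu> :: 'n \<Rightarrow> nat. \<nu> \<le> (\<lambda>_. N)} \<subseteq> {\<nu>. \<nu> \<le> (\<lambda>_. n)}" using n by (auto simp: le_fun_def intro: order_trans)
    have "mahler_partial \<beta> b n x - mahler_partial \<beta> b N x =
       (\<Sum>\<nu>\<in>{\<nu>. \<nu> \<le> (\<lambda>_. n)} - {\<nu>. \<nu> \<le> (\<lambda>_. N)}. sc (binomial_diffs \<beta> \<nu> x) (b \<nu>))"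
      unfolding mahler_partial_def by (rule sum_diff[symmetric, OF finite_multiindices_le sub])
    also have "q \<dots> \<le> \<epsilon>"
    proof (rule cs_sum_le[OF q])
      fix \<nu> :: "'n \<Rightarrow> nat" assume "\<nu> \<in> {\<nu>. \<nu> \<le> (\<lambda>_. n)} - {\<nu>. \<nu> \<le> (\<lambda>_. N)}"
      then have "\<nu> \<notin> \<Phi>" using N by blast
      then have "weight \<alpha> \<nu> * q (b \<nu>) \<le> \<epsilon>" using \<Phi>(2) by (auto intro: less_imp_le)
      then show "q (sc (binomial_diffs \<beta> \<nu> x) (b \<nu>)) \<le> \<epsilon>"
        using mahler_term_le[OF q \<beta>, of x \<nu> "b \<nu>"] x by (auto intro: order_trans)
    qed (use \<epsilon> in simp)
    finally show "q (mahler_partial \<beta> b n x - mahler_partial \<beta> b N x) \<le> \<epsilon>" .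
  qed
qed

lemma mahler_partial_le:
  fixes \<alpha> :: "'n::finite \<Rightarrow> nat"
  assumes q: "q \<in> cs" and b: "b \<in> c0_space sc (weight \<alpha>)" and \<beta>: "\<beta> \<le> \<alpha>"
    and x: "\<And>i j. j \<le> \<beta> i \<Longrightarrow> x i j \<in> padic_integers"
  shows "q (mahler_partial \<beta> b N x) \<le> weight_norm \<alpha> q b"
  unfolding mahler_partial_def
proof (rule cs_sum_le[OF q])
  fix \<nu>
  have "q (sc (binomial_diffs \<beta> \<nu> x) (b \<nu>)) \<le> weight \<alpha> \<nu> * q (b \<nu>)"
    using x by (rule mahler_term_le[OF q \<beta>])
  also have "\<dots> \<le> weight_norm \<alpha> q b" by (rule weighted_seminorm_upper[OF weight_pos b q])
  finally show "q (sc (binomial_diffs \<beta> \<nu> x) (b \<nu>)) \<le> weight_norm \<alpha> q b" .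
next
  have "0 \<le> weight \<alpha> (\<lambda>_. 0) * q (b (\<lambda>_. 0))"
    by (intro mult_nonneg_nonneg cs_nonneg[OF q] less_imp_le[OF weight_pos])
  then show "0 \<le> weight_norm \<alpha> q b" using weighted_seminorm_upper[OF weight_pos b q] by (rule order_trans)
qed

text \<open>Comparison with one fixed late term suffices: the ultrametric inequality passes the
  bound to all pairs.\<close>

lemma convergent_if_cs_Cauchy:
  assumes complete: "sequentially_complete TYPE('e)"
    and X: "\<And>q \<epsilon>. q \<in> cs \<Longrightarrow> \<epsilon> > 0 \<Longrightarrow> \<exists>N. \<forall>n\<ge>N. q (X n - X N) \<le> \<epsilon>"
  shows "convergent X"
proof -
  have "\<exists>N. \<forall>m\<ge>N. \<forall>n\<ge>N. X m - X n \<in> U" if U: "open U" "0 \<in> U" for U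
  proof -
    obtain q \<epsilon> where q: "q \<in> cs" "\<epsilon> > 0" "\<forall>y. q (y - 0) < \<epsilon> \<longrightarrow> y \<in> U"
      using open_contains_cs_ball[OF U] by blast
    obtain N where N: "\<forall>n\<ge>N. q (X n - X N) \<le> \<epsilon> / 2" using X[OF q(1), of "\<epsilon> / 2"] q(2) by auto
    have "X m - X n \<in> U" if "m \<ge> N" "n \<ge> N" for m n
    proof -
      have "q (X m - X n) \<le> max (q (X m - X N)) (q (X N - X n))" using seminorm_diff_ultra[OF q(1)] by simp
      also have "\<dots> \<le> \<epsilon> / 2"
        using N that seminorm_minus_commute[OF q(1), of "X N" "X n"] by (intro max.boundedI) auto
      finally show ?thesis using q by simp
    qed
    then show ?thesis by blast
  qed
  then show ?thesis using complete unfolding sequentially_complete_def by blast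
qed

context
  fixes \<alpha> :: "'n::finite \<Rightarrow> nat"
  assumes complete: "sequentially_complete TYPE('e)"
begin

lemma mahler_partial_tendsto:
  assumes b: "b \<in> c0_space sc (weight \<alpha>)" and \<beta>: "\<beta> \<le> \<alpha>"
    and x: "\<And>i j. j \<le> \<beta> i \<Longrightarrow> x i j \<in> padic_integers"
  shows "(\<lambda>N. mahler_partial \<beta> b N x) \<longlonglongrightarrow> diff_series \<beta> b x"
proof -
  have "convergent (\<lambda>N. mahler_partial \<beta> b N x)"
  proof (rule convergent_if_cs_Cauchy[OF complete])
    fix q and \<epsilon> :: real assume "q \<in> cs" "\<epsilon> > 0"
    from mahler_partial_tail[OF this(1) b \<beta> this(2)] x
    show "\<exists>N. \<forall>n\<ge>N. q (mahler_partial \<beta> b n x - mahler_partial \<beta> b N x) \<le> \<epsilon>" by blast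
  qed
  then show ?thesis unfolding diff_series_def by (simp add: convergent_LIMSEQ_iff)
qed

lemma diff_series_le:
  assumes b: "b \<in> c0_space sc (weight \<alpha>)" and \<beta>: "\<beta> \<le> \<alpha>"
    and x: "\<And>i j. j \<le> \<beta> i \<Longrightarrow> x i j \<in> padic_integers" and q: "q \<in> cs"
  shows "q (diff_series \<beta> b x) \<le> weight_norm \<alpha> q b"
proof (rule LIMSEQ_le_const2)
  show "(\<lambda>N. q (mahler_partial \<beta> b N x)) \<longlonglongrightarrow> q (diff_series \<beta> b x)"
    using x by (intro tendsto_cs q mahler_partial_tendsto b \<beta>)
  show "\<exists>N. \<forall>n\<ge>N. q (mahler_partial \<beta> b n x) \<le> weight_norm \<alpha> q b"
    using mahler_partial_le[OF q b \<beta>] x by blast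
qed

lemma diff_series_diff:
  assumes b: "b \<in> c0_space sc (weight \<alpha>)" and c: "c \<in> c0_space sc (weight \<alpha>)" and \<beta>: "\<beta> \<le> \<alpha>"
    and x: "\<And>i j. j \<le> \<beta> i \<Longrightarrow> x i j \<in> padic_integers"
  shows "diff_series \<beta> (b - c) x = diff_series \<beta> b x - diff_series \<beta> c x"
proof -
  interpret C: seminormed "pointwise sc" "c0_space sc (weight \<alpha>)" "weight_norm \<alpha> ` cs"
    by (rule seminormed_c0) (rule weight_pos)
  have "(\<lambda>N. mahler_partial \<beta> (b - c) N x) \<longlonglongrightarrow> diff_series \<beta> (b - c) x"
    using x by (intro mahler_partial_tendsto C.S_closed b c \<beta>)
  moreover have "(\<lambda>N. mahler_partial \<beta> b N x - mahler_partial \<beta> c N x) \<longlonglongrightarrow> diff_series \<beta> b x - diff_series \<beta> c x"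
    using x by (intro tendsto_diff mahler_partial_tendsto b c \<beta>)
  moreover have "mahler_partial \<beta> (b - c) N x = mahler_partial \<beta> b N x - mahler_partial \<beta> c N x" for N
    by (simp add: mahler_partial_def scale_right_diff_distrib sum_subtractf)
  ultimately show ?thesis using LIMSEQ_unique by simp
qed

text \<open>A uniform limit of continuous functions: the tail estimate holds on all blocks at once,
  and the maximum of three small terms is small.\<close>

lemma continuous_on_diff_series:
  assumes b: "b \<in> c0_space sc (weight \<alpha>)" and \<beta>: "\<beta> \<le> \<alpha>"
  shows "continuous_on (blocks padic_cube \<beta>) (diff_series \<beta> b)"
  unfolding continuous_on_def
proof
  let ?K = "blocks (\<lambda>_. padic_integers :: 'p padic set) \<beta>"
  fix x assume xK: "x \<in> ?K"
  have K: "y i j \<in> padic_integers" if "y \<in> ?K" "j \<le> \<beta> i" for y i j using that by (simp add: in_blocks_iff)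
  show "(diff_series \<beta> b \<longlongrightarrow> diff_series \<beta> b x) (at x within ?K)"
    unfolding tendsto_cs_iff
  proof (intro ballI allI impI)
    fix q and \<epsilon> :: real assume q: "q \<in> cs" and \<epsilon>: "\<epsilon> > 0"
    obtain N where "\<forall>n\<ge>N. \<forall>x. (\<forall>i. \<forall>j\<le>\<beta> i. x i j \<in> padic_integers) \<longrightarrow>
        q (mahler_partial \<beta> b n x - mahler_partial \<beta> b N x) \<le> \<epsilon> / 2"
      using mahler_partial_tail[OF q b \<beta> half_gt_zero[OF \<epsilon>]] by blast
    then have N: "q (mahler_partial \<beta> b n y - mahler_partial \<beta> b N y) \<le> \<epsilon> / 2" if "n \<ge> N" "y \<in> ?K" for n y
      using that K by simp
    have lim: "q (diff_series \<beta> b y - mahler_partial \<beta> b N y) \<le> \<epsilon> / 2" if y: "y \<in> ?K" for y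
    proof (rule LIMSEQ_le_const2)
      show "(\<lambda>n. q (mahler_partial \<beta> b n y - mahler_partial \<beta> b N y)) \<longlonglongrightarrow> q (diff_series \<beta> b y - mahler_partial \<beta> b N y)"
        using K[OF y] by (intro tendsto_cs q tendsto_diff tendsto_const mahler_partial_tendsto b \<beta>)
      show "\<exists>M. \<forall>n\<ge>M. q (mahler_partial \<beta> b n y - mahler_partial \<beta> b N y) \<le> \<epsilon> / 2" using N y by blast
    qed
    have coord: "continuous_on ?K (\<lambda>z. z i j)" for i j
      by (intro continuous_on_product_then_coordinatewise[of ?K "\<lambda>z. z i"]
          continuous_on_product_then_coordinatewise[of ?K "\<lambda>z. z"] continuous_on_id)
    have "continuous_on ?K (mahler_partial \<beta> b N)"
      unfolding mahler_partial_def
      by (intro continuous_on_sum continuous_on_const continuous_on_scale continuous_on_prod'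
          continuous_on_binomial_diff coord)
    then have "(mahler_partial \<beta> b N \<longlongrightarrow> mahler_partial \<beta> b N x) (at x within ?K)"
      using xK by (simp add: continuous_on_def)
    then have "\<forall>\<^sub>F y in at x within ?K. q (mahler_partial \<beta> b N y - mahler_partial \<beta> b N x) < \<epsilon>"
      using q \<epsilon> unfolding tendsto_cs_iff by blast
    moreover have "\<forall>\<^sub>F y in at x within ?K. y \<in> ?K" by (simp add: eventually_at_filter)
    ultimately show "\<forall>\<^sub>F y in at x within ?K. q (diff_series \<beta> b y - diff_series \<beta> b x) < \<epsilon>"
    proof eventually_elim
      case (elim y)
      let ?s = "diff_series \<beta> b" and ?p = "mahler_partial \<beta> b N"
      have "q (?s y - ?s x) \<le> max (q (?s y - ?p y)) (q (?p y - ?s x))" using seminorm_diff_ultra[OF q] by simp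
      moreover have "q (?p y - ?s x) \<le> max (q (?p y - ?p x)) (q (?p x - ?s x))" using seminorm_diff_ultra[OF q] by simp
      moreover have "q (?p x - ?s x) \<le> \<epsilon> / 2" using lim[OF xK] seminorm_minus_commute[OF q] by simp
      ultimately show ?case using elim lim[of y] \<epsilon> by linarith
    qed
  qed
qed

text \<open>Over a product index set the sum of products factors into one-variable divided
  differences, which \<open>binomial_diff_eq\<close> evaluates.\<close>

lemma divided_difference_gbinomial:
  assumes "x \<in> distinct_blocks (\<lambda>_. padic_integers :: 'p padic set) \<beta>"
  shows "(\<Sum>j | j \<le> \<beta>. (\<Prod>i\<in>UNIV. dcoef (x i) {..\<beta> i} (j i)) * (\<Prod>i\<in>UNIV. x i (j i) gchoose \<nu> i))
    = (\<Prod>i\<in>UNIV. binomial_diff (\<beta> i) (\<nu> i) (x (i :: 'n)))"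
proof -
  have "{j. j \<le> \<beta>} = Pi\<^sub>E UNIV (\<lambda>i. {..\<beta> i})" by (auto simp: le_fun_def)
  then have "(\<Sum>j | j \<le> \<beta>. (\<Prod>i\<in>UNIV. dcoef (x i) {..\<beta> i} (j i)) * (\<Prod>i\<in>UNIV. x i (j i) gchoose \<nu> i)) =
     (\<Prod>i\<in>UNIV. \<Sum>j\<le>\<beta> i. dcoef (x i) {..\<beta> i} j * (x i j gchoose \<nu> i))"
    by (simp add: prod_sum_PiE prod.distrib)
  also have "\<dots> = (binomial_diffs \<beta> \<nu> x)"
    using assms by (intro prod.cong refl binomial_diff_eq) (auto simp: distinct_blocks_def)
  finally show ?thesis .
qed

lemma mahler_series_tendsto:
  assumes b: "b \<in> c0_space sc (weight \<alpha>)" and x: "\<And>i. x i \<in> padic_integers"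
  shows "(\<lambda>N. \<Sum>\<nu> | \<nu> \<le> (\<lambda>_. N). sc (\<Prod>i\<in>UNIV. x i gchoose \<nu> i) (b \<nu>)) \<longlonglongrightarrow> mahler_series b x"
  using mahler_partial_tendsto[OF b, of "\<lambda>_. 0" "\<lambda>i _. x i"] x
  by (simp add: mahler_partial_def mahler_series_def le_fun_def Pi_iff)

text \<open>At fixed distinct points a divided difference is a finite combination of values, so it
  can be interchanged with the limit of the partial sums.\<close>

lemma extends_mahler_series:
  assumes b: "b \<in> c0_space sc (weight \<alpha>)" and \<beta>: "\<beta> \<le> \<alpha>"
  shows "extends_divided_difference sc padic_cube \<beta> (mahler_series b) (diff_series \<beta> b)"
  unfolding extends_divided_difference_def
proof (intro conjI ballI continuous_on_diff_series b \<beta>)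
  fix x assume x: "x \<in> distinct_blocks (\<lambda>_. padic_integers :: 'p padic set) \<beta>"
  have xZ: "x i j \<in> padic_integers" if "j \<le> \<beta> i" for i j
    using x that by (simp add: distinct_blocks_def in_blocks_iff)
  have "(\<lambda>N. \<Sum>j | j \<le> \<beta>. sc (\<Prod>i\<in>UNIV. dcoef (x i) {..\<beta> i} (j i))
      (\<Sum>\<nu> | \<nu> \<le> (\<lambda>_. N). sc (\<Prod>i\<in>UNIV. x i (j i) gchoose \<nu> i) (b \<nu>))) \<longlonglongrightarrow> divided_difference sc \<beta> (mahler_series b) x"
    unfolding divided_difference_dcoef
    by (intro tendsto_sum tendsto_scale tendsto_const mahler_series_tendsto b xZ) (auto simp: le_fun_def)
  moreover have "(\<Sum>j | j \<le> \<beta>. sc (\<Prod>i\<in>UNIV. dcoef (x i) {..\<beta> i} (j i))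
      (\<Sum>\<nu> | \<nu> \<le> (\<lambda>_. N). sc (\<Prod>i\<in>UNIV. x i (j i) gchoose \<nu> i) (b \<nu>))) = mahler_partial \<beta> b N x" for N
    unfolding mahler_partial_def divided_difference_gbinomial[OF x, symmetric] scale_sum_left
    by (subst sum.swap) (simp add: scale_sum_right)
  ultimately show "diff_series \<beta> b x = divided_difference sc \<beta> (mahler_series b) x"
    using mahler_partial_tendsto[OF b \<beta>, of x] xZ LIMSEQ_unique by auto
qed

lemma mahler_series_in_C_alpha_space:
  assumes "b \<in> c0_space sc (weight \<alpha>)"
  shows "mahler_series b \<in> C_alpha_space sc \<alpha>"
  unfolding C_alpha_space_def C_alpha_def mem_Collect_eq
  using extends_mahler_series[OF assms] by (auto simp: mahler_series_def)

end

end

text \<open>The identity (l choose m)(m choose n) = (l choose n)((l - n) choose (m - n)) reduces the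
  sum to the expansion of (1 - 1)^(l - n). This is the duality between Mahler coefficients and
  binomial functions.\<close>

lemma coeff_delta_power_binomial:
  "(\<Sum>m\<le>l. coeff ((delta :: 'p::prime_card padic poly) ^ l) m * (of_nat m gchoose n)) = (if n = l then 1 else 0)"
proof -
  have "(\<Sum>m\<le>l. coeff ((delta :: 'p padic poly) ^ l) m * (of_nat m gchoose n)) =
     (\<Sum>m\<le>l. of_nat ((l choose m) * (m choose n)) * (- 1) ^ (l - m))"
  proof (intro sum.cong refl)
    fix m assume "m \<in> {..l}"
    then have "coeff ((delta :: 'p padic poly) ^ l) m = of_nat (l choose m) * (- 1) ^ (l - m)"
      by (subst coeff_linear_poly_power) auto
    then show "coeff ((delta :: 'p padic poly) ^ l) m * (of_nat m gchoose n) =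
        of_nat ((l choose m) * (m choose n)) * (- 1) ^ (l - m)" by (simp add: binomial_gbinomial)
  qed
  also have "\<dots> = (if n = l then 1 else 0)"
  proof (cases "n \<le> l")
    case False
    then show ?thesis by (auto intro!: sum.neutral simp: binomial_eq_0)
  next
    case True
    have "(\<Sum>m\<le>l. of_nat ((l choose m) * (m choose n)) * (- 1) ^ (l - m)) =
        (\<Sum>m\<in>{n..l}. of_nat ((l choose m) * (m choose n)) * (- 1) ^ (l - m) :: 'p padic)"
      by (intro sum.mono_neutral_right) (auto simp: binomial_eq_0)
    also have "\<dots> = (\<Sum>k\<le>l - n. of_nat (l choose n) * (of_nat ((l - n) choose k) * 1 ^ k * (- 1) ^ (l - n - k)))"
    proof (rule sum.reindex_bij_witness[of _ "\<lambda>k. k + n" "\<lambda>m. m - n"])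
      fix m assume m: "m \<in> {n..l}"
      then have "(l choose m) * (m choose n) = (l choose n) * ((l - n) choose (m - n))"
        by (intro choose_mult) auto
      then show "of_nat (l choose n) * (of_nat ((l - n) choose (m - n)) * 1 ^ (m - n) * (- 1) ^ (l - n - (m - n))) =
          (of_nat ((l choose m) * (m choose n)) * (- 1) ^ (l - m) :: 'p padic)" using m by simp
    qed (use True in auto)
    also have "\<dots> = of_nat (l choose n) * (1 + - 1) ^ (l - n)"
      by (subst binomial_ring) (simp add: sum_distrib_left)
    also have "\<dots> = (if n = l then 1 else 0)" using True by auto
    finally show ?thesis .
  qed
  finally show ?thesis .
qed

context lcs
begin

subsection \<open>The coefficients determine the function\<close>

lemma mahler_coeff_add: "mahler (f + g) = mahler f + mahler g"
  by (simp add: mahler_coeff_def fun_eq_iff scale_right_distrib sum.distrib)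

lemma mahler_coeff_scale: "mahler (pointwise sc c f) = pointwise sc c (mahler f)"
  by (simp add: mahler_coeff_def pointwise_def fun_eq_iff scale_sum_right mult_ac)

lemma divided_difference_add: "divided_difference sc \<beta> (f + g) x = divided_difference sc \<beta> f x + divided_difference sc \<beta> g x"
  by (simp add: divided_difference_def scale_right_distrib sum.distrib)

lemma divided_difference_scale: "divided_difference sc \<beta> (pointwise sc c f) x = sc c (divided_difference sc \<beta> f x)"
  by (simp add: divided_difference_def pointwise_def scale_sum_right mult_ac)

lemma vector_subspace_C_alpha_space: "module.subspace (pointwise sc) (C_alpha_space sc \<alpha>)"
proof -
  interpret V: vector_space "pointwise sc :: 'p padic \<Rightarrow> (('n \<Rightarrow> 'p padic) \<Rightarrow> 'e) \<Rightarrow> ('n \<Rightarrow> 'p padic) \<Rightarrow> 'e"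
    by (rule vector_space_pointwise)
  show ?thesis
    unfolding V.subspace_def
  proof (intro conjI ballI allI)
    show "0 \<in> C_alpha_space sc \<alpha>"
      by (auto simp: C_alpha_space_def C_alpha_def extends_divided_difference_def divided_difference_def
          intro!: exI[of _ "\<lambda>_. 0"])
  next
    fix f g assume fg: "f \<in> C_alpha_space sc \<alpha>" "g \<in> C_alpha_space sc \<alpha>"
    show "f + g \<in> C_alpha_space sc \<alpha>"
      unfolding C_alpha_space_def C_alpha_def mem_Collect_eq
    proof (intro conjI allI impI)
      fix \<beta> assume "\<beta> \<le> \<alpha>"
      then obtain f' g' where "extends_divided_difference sc padic_cube \<beta> f f'"
        "extends_divided_difference sc padic_cube \<beta> g g'"
        using fg unfolding C_alpha_space_def C_alpha_def by blast
      then show "\<exists>h. extends_divided_difference sc padic_cube \<beta> (f + g) h"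
        by (intro exI[of _ "\<lambda>x. f' x + g' x"])
           (auto simp: extends_divided_difference_def divided_difference_add intro: continuous_on_add)
    qed (use fg in \<open>auto simp: C_alpha_space_def\<close>)
  next
    fix c f assume f: "f \<in> C_alpha_space sc \<alpha>"
    show "pointwise sc c f \<in> C_alpha_space sc \<alpha>"
      unfolding C_alpha_space_def C_alpha_def mem_Collect_eq
    proof (intro conjI allI impI)
      fix \<beta> assume "\<beta> \<le> \<alpha>"
      then obtain f' where "extends_divided_difference sc padic_cube \<beta> f f'"
        using f unfolding C_alpha_space_def C_alpha_def by blast
      then show "\<exists>h. extends_divided_difference sc padic_cube \<beta> (pointwise sc c f) h"
        by (intro exI[of _ "\<lambda>x. sc c (f' x)"])
           (auto simp: extends_divided_difference_def divided_difference_scale intro: continuous_on_scale continuous_on_const)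
    qed (use f in \<open>auto simp: C_alpha_space_def pointwise_def\<close>)
  qed
qed

text \<open>The case \<beta> = 0 of differentiability: blocks then have one entry per coordinate,
  and the continuous extension is f itself up to the identification \<open>c\<close>.\<close>

lemma C_alpha_space_continuous:
  assumes f: "f \<in> C_alpha_space sc \<alpha>" and y: "\<And>i. y i \<in> padic_integers"
    and lim: "\<And>i. (\<lambda>k. Y k i) \<longlonglongrightarrow> y i" and Y: "\<And>k i. Y k i \<in> padic_integers"
  shows "(\<lambda>k. f (Y k)) \<longlonglongrightarrow> f y"
proof -
  let ?K = "blocks padic_cube (\<lambda>_. 0)"
  define c :: "('a \<Rightarrow> 'p padic) \<Rightarrow> 'a \<Rightarrow> nat \<Rightarrow> 'p padic" where "c x i j = (if j = 0 then x i else undefined)" for x i j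
  have "(\<lambda>_. 0) \<le> \<alpha>" by (simp add: le_fun_def)
  then obtain g where g: "continuous_on ?K g" "\<forall>x\<in>distinct_blocks padic_cube (\<lambda>_. 0). g x = divided_difference sc (\<lambda>_. 0) f x"
    using f by (auto simp: C_alpha_space_def C_alpha_def extends_divided_difference_def)
  have cD: "c x \<in> distinct_blocks padic_cube (\<lambda>_. 0)" if "\<And>i. x i \<in> padic_integers" for x
    using that by (auto simp: distinct_blocks_def in_blocks_iff c_def)
  have gf: "g (c x) = f x" if x: "\<And>i. x i \<in> padic_integers" for x
  proof -
    have "{j. j \<le> (\<lambda>_ :: 'a. 0 :: nat)} = {\<lambda>_. 0}" by (auto simp: le_fun_def)
    then show ?thesis using g(2) cD[OF x] by (simp add: divided_difference_def c_def)
  qed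
  have "(\<lambda>k. g (c (Y k))) \<longlonglongrightarrow> g (c y)"
  proof (rule continuous_on_tendsto_compose[OF g(1)])
    show "(\<lambda>k. c (Y k)) \<longlonglongrightarrow> c y"
      unfolding tendsto_fun_iff using lim by (auto simp: c_def)
  qed (use cD y Y in \<open>auto simp: distinct_blocks_def\<close>)
  then show ?thesis by (simp add: gf y Y)
qed

text \<open>The coefficient at \<nu> is the value of f at \<nu> plus a combination of values at
  smaller multi-indices, so f vanishes at natural points by induction on the sum of the entries.
  These points are dense in the cube, and f is continuous.\<close>

lemma mahler_coeff_eq_0_imp:
  assumes f: "f \<in> C_alpha_space sc \<alpha>" and 0: "mahler f = 0"
  shows "f = 0"
proof -
  have nat0: "f (\<lambda>i. of_nat (\<nu> i)) = 0" for \<nu>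
  proof (induction "sum \<nu> UNIV" arbitrary: \<nu> rule: less_induct)
    case less
    let ?t = "\<lambda>\<mu>. sc ((- 1) ^ (sum \<nu> UNIV - sum \<mu> UNIV) * of_nat (\<Prod>i\<in>UNIV. \<nu> i choose \<mu> i)) (f (\<lambda>i. of_nat (\<mu> i)))"
    have "?t \<mu> = 0" if "\<mu> \<in> {\<mu>. \<mu> \<le> \<nu>} - {\<nu>}" for \<mu>
    proof -
      have le: "\<mu> i \<le> \<nu> i" for i using that by (auto simp: le_fun_def)
      have "\<mu> \<noteq> \<nu>" using that by blast
      then obtain i where "\<mu> i \<noteq> \<nu> i" by (auto simp: fun_eq_iff)
      then have "\<mu> i < \<nu> i" using le[of i] by simp
      then have "sum \<mu> UNIV < sum \<nu> UNIV" by (intro sum_strict_mono_ex1) (auto simp: le)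
      then show ?thesis using less by simp
    qed
    then have "(\<Sum>\<mu>\<in>{\<mu>. \<mu> \<le> \<nu>} - {\<nu>}. ?t \<mu>) = 0" by (rule sum.neutral[rule_format])
    then have "mahler f \<nu> = ?t \<nu>"
      unfolding mahler_coeff_def by (subst sum.remove[OF finite_multiindices_le, of \<nu>]) auto
    then show ?case using 0 by simp
  qed
  have "f y = 0" for y
  proof (cases "y \<in> Pi UNIV padic_cube")
    case False
    then show ?thesis using f by (simp add: C_alpha_space_def)
  next
    case True
    then have y: "y i \<in> padic_integers" for i by auto
    have "\<exists>m. (\<lambda>k. of_nat (m k)) \<longlonglongrightarrow> y i" for i using padic_integer_limit_of_nat[OF y] by blast
    then obtain m where m: "\<And>i. (\<lambda>k. of_nat (m i k)) \<longlonglongrightarrow> y i" by metis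
    have "(\<lambda>k. f (\<lambda>i. of_nat (m i k))) \<longlonglongrightarrow> f y"
      by (rule C_alpha_space_continuous[OF f y m]) simp
    then show ?thesis unfolding nat0 using LIMSEQ_unique tendsto_const by blast
  qed
  then show ?thesis by (simp add: fun_eq_iff)
qed

lemma mahler_coeff_in_c0:
  fixes \<alpha> :: "'n::finite \<Rightarrow> nat"
  assumes f: "f \<in> C_alpha_space sc \<alpha>"
  shows "mahler f \<in> c0_space sc (weight \<alpha>)"
  unfolding c0_space_def mem_Collect_eq
proof (intro ballI allI impI)
  fix q and \<epsilon> :: real assume q: "q \<in> cs" and \<epsilon>: "\<epsilon> > 0"
  have "C_alpha sc padic_cube \<alpha> f" using f by (simp add: C_alpha_space_def)
  then obtain N where N: "\<forall>\<nu>. (\<exists>i. N \<le> \<nu> i) \<longrightarrow> weight \<alpha> \<nu> * q (mahler f \<nu>) < \<epsilon>"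
    using mahler_coeff_decay[OF _ q \<epsilon>] by blast
  have "weight \<alpha> \<nu> * q (mahler f \<nu>) < \<epsilon>" if "\<nu> \<notin> {\<nu>. \<nu> \<le> (\<lambda>_. N)}" for \<nu>
    using N that by (auto simp: le_fun_def not_le intro: less_imp_le)
  then show "\<exists>\<Phi>. finite \<Phi> \<and> (\<forall>\<nu>. \<nu> \<notin> \<Phi> \<longrightarrow> weight \<alpha> \<nu> * q (mahler f \<nu>) < \<epsilon>)"
    using finite_multiindices_le[of "\<lambda>_ :: 'n. N"] by blast
qed

text \<open>A coefficient involves finitely many values, so it is the limit of the coefficients of
  the partial sums. By duality these equal b \<kappa> as soon as the box contains \<kappa>.\<close>

lemma mahler_coeff_mahler_series:
  fixes \<alpha> :: "'n::finite \<Rightarrow> nat"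
  assumes complete: "sequentially_complete TYPE('e)" and b: "b \<in> c0_space sc (weight \<alpha>)"
  shows "mahler (mahler_series b) = b"
proof
  fix \<kappa> :: "'n \<Rightarrow> nat"
  let ?c = "\<lambda>\<mu>. \<Prod>i\<in>UNIV. coeff ((delta :: 'p padic poly) ^ \<kappa> i) (\<mu> i)"
  let ?S = "\<lambda>N. \<Sum>\<mu> | \<mu> \<le> \<kappa>. sc (?c \<mu>) (\<Sum>\<nu> | \<nu> \<le> (\<lambda>_. N). sc (\<Prod>i\<in>UNIV. of_nat (\<mu> i) gchoose \<nu> i) (b \<nu>))"
  have deg: "degree ((delta :: 'p padic poly) ^ n) \<le> n" for n using degree_power_le[of "delta :: 'p padic poly" n] by simp
  have "mahler (mahler_series b) \<kappa> = (\<Sum>\<mu> | \<mu> \<le> \<kappa>. sc (?c \<mu>) (mahler_series b (\<lambda>i. of_nat (\<mu> i))))"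
    unfolding mahler_coeff_functional using deg by (intro functional_box) auto
  moreover have "?S
      \<longlonglongrightarrow> (\<Sum>\<mu> | \<mu> \<le> \<kappa>. sc (?c \<mu>) (mahler_series b (\<lambda>i. of_nat (\<mu> i))))"
    by (intro tendsto_sum tendsto_scale tendsto_const mahler_series_tendsto[OF complete b]) simp
  moreover have "\<forall>\<^sub>F N in sequentially.
      ?S N = b \<kappa>"
    unfolding eventually_sequentially
  proof (intro exI allI impI)
    fix N assume N: "sum \<kappa> UNIV \<le> N"
    have \<kappa>N: "\<kappa> \<le> (\<lambda>_. N)"
    proof (rule le_funI)
      fix i
      have "\<kappa> i \<le> sum \<kappa> UNIV" by (intro member_le_sum) auto
      then show "\<kappa> i \<le> N" using N by simp
    qed
    have box: "{\<mu>. \<mu> \<le> \<kappa>} = Pi\<^sub>E UNIV (\<lambda>i. {..\<kappa> i})" by (auto simp: le_fun_def)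
    have "(\<Sum>\<mu> | \<mu> \<le> \<kappa>. ?c \<mu> * (\<Prod>i\<in>UNIV. of_nat (\<mu> i) gchoose \<nu> i)) = (if \<nu> = \<kappa> then 1 else 0)" for \<nu>
    proof -
      have "(\<Sum>\<mu> | \<mu> \<le> \<kappa>. ?c \<mu> * (\<Prod>i\<in>UNIV. of_nat (\<mu> i) gchoose \<nu> i)) =
          (\<Prod>i\<in>UNIV. \<Sum>m\<le>\<kappa> i. coeff ((delta :: 'p padic poly) ^ \<kappa> i) m * (of_nat m gchoose \<nu> i))"
        unfolding box by (simp add: prod_sum_PiE prod.distrib)
      also have "\<dots> = (\<Prod>i\<in>UNIV. if \<nu> i = \<kappa> i then 1 else 0)"
        by (simp only: coeff_delta_power_binomial)
      also have "\<dots> = (if \<nu> = \<kappa> then 1 else 0)"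
        by (auto simp: fun_eq_iff intro!: prod_zero)
      finally show ?thesis .
    qed
    note delta = this
    have "?S N =
      (\<Sum>\<nu> | \<nu> \<le> (\<lambda>_. N). sc (\<Sum>\<mu> | \<mu> \<le> \<kappa>. ?c \<mu> * (\<Prod>i\<in>UNIV. of_nat (\<mu> i) gchoose \<nu> i)) (b \<nu>))"
      unfolding scale_sum_left scale_sum_right by (subst sum.swap) simp
    also have "\<dots> = (\<Sum>\<nu> | \<nu> \<le> (\<lambda>_. N). if \<nu> = \<kappa> then b \<nu> else 0)"
      unfolding delta by (intro sum.cong) auto
    also have "\<dots> = b \<kappa>" using \<kappa>N by (subst sum.delta) (auto simp: finite_multiindices_le)
    finally show "?S N = b \<kappa>" .
  qed
  ultimately show "mahler (mahler_series b) \<kappa> = b \<kappa>"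
    using LIMSEQ_unique[OF _ tendsto_eventually] by simp
qed

subsection \<open>Extended difference quotients and the compact-open topology\<close>

text \<open>By uniqueness, the extension on V is the restriction of the one on the cube, so every
  generator of the topology is governed by data on the cube.\<close>

lemma extended_difference_eq:
  fixes V :: "'n::finite \<Rightarrow> 'p padic set"
  assumes V: "cartesian V" "Pi UNIV V \<subseteq> Pi UNIV padic_cube"
    and g: "extends_divided_difference sc padic_cube \<beta> f g"
  shows "extended_difference sc V \<beta> (restriction V f) = (\<lambda>x. if x \<in> blocks V \<beta> then g x else 0)"
    and "continuous_on (blocks V \<beta>) g" and "blocks V \<beta> \<subseteq> blocks padic_cube \<beta>"
proof -
  \<comment> \<open>If one factor of V is empty, the inclusion of products says nothing about the
    others. The block x shows that no factor is empty and supplies the remaining coordinates of a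
    point of the product.\<close>
  have sub: "V i \<subseteq> padic_integers" if "x \<in> blocks V \<beta>" for x i
  proof
    fix a assume a: "a \<in> V i"
    have "(\<lambda>i. x i 0)(i := a) \<in> Pi UNIV V" using that a by (auto simp: in_blocks_iff)
    then have "(\<lambda>i. x i 0)(i := a) \<in> Pi UNIV padic_cube" using V(2) by blast
    then have "((\<lambda>i. x i 0)(i := a)) i \<in> padic_integers" by blast
    then show "a \<in> padic_integers" by simp
  qed
  show bl: "blocks V \<beta> \<subseteq> blocks padic_cube \<beta>"
  proof
    fix x assume x: "x \<in> blocks V \<beta>"
    then show "x \<in> blocks padic_cube \<beta>" using sub[OF x] unfolding in_blocks_iff by blast
  qed
  have dbl: "distinct_blocks V \<beta> \<subseteq> distinct_blocks padic_cube \<beta>"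
    using bl by (auto simp: distinct_blocks_def)
  show cont: "continuous_on (blocks V \<beta>) g"
    using g bl continuous_on_subset by (auto simp: extends_divided_difference_def)
  have dd: "divided_difference sc \<beta> (restriction V f) x = divided_difference sc \<beta> f x" if "x \<in> distinct_blocks V \<beta>" for x
  proof (rule divided_difference_cong)
    fix j assume "j \<le> \<beta>"
    then have "(\<lambda>i. x i (j i)) \<in> Pi UNIV V" using that by (auto simp: distinct_blocks_def in_blocks_iff le_fun_def)
    then show "restriction V f (\<lambda>i. x i (j i)) = f (\<lambda>i. x i (j i))" by (simp add: restriction_def)
  qed simp
  let ?h = "\<lambda>x. if x \<in> blocks V \<beta> then g x else 0"
  have ext: "extends_divided_difference sc V \<beta> (restriction V f) ?h"
    unfolding extends_divided_difference_def
  proof (intro conjI ballI)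
    show "continuous_on (blocks V \<beta>) ?h" using cont by (subst continuous_on_cong[OF refl, of _ _ g]) auto
    fix x assume x: "x \<in> distinct_blocks V \<beta>"
    then have "x \<in> blocks V \<beta>" by (simp add: distinct_blocks_def)
    then show "?h x = divided_difference sc \<beta> (restriction V f) x"
      using g x dbl dd by (auto simp: extends_divided_difference_def)
  qed
  show "extended_difference sc V \<beta> (restriction V f) = ?h"
    unfolding extended_difference_def
  proof (rule the_equality)
    show "extends_divided_difference sc V \<beta> (restriction V f) ?h \<and> (\<forall>x. x \<notin> blocks V \<beta> \<longrightarrow> ?h x = 0)"
      using ext by simp
    fix h assume h: "extends_divided_difference sc V \<beta> (restriction V f) h \<and> (\<forall>x. x \<notin> blocks V \<beta> \<longrightarrow> h x = 0)"
    show "h = ?h"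
    proof
      fix x
      show "h x = ?h x"
      proof (cases "x \<in> blocks V \<beta>")
        case True
        then show ?thesis
          using h ext continuous_eq_on_blocks[OF V(1), of \<beta> h ?h x]
          unfolding extends_divided_difference_def by simp
      qed (use h in simp)
    qed
  qed
qed

text \<open>Finitely many balls in U with centres in C cover C. By the ultrametric inequality, a
  sufficiently small ball about c stays inside the covering ball that contains c.\<close>

lemma compact_subset_open_cs:
  assumes C: "compact C" "C \<subseteq> U" and U: "open U"
  shows "\<exists>q\<in>cs. \<exists>\<epsilon>>0. \<forall>c\<in>C. \<forall>y. q (y - c) < \<epsilon> \<longrightarrow> y \<in> U"
proof -
  have "\<forall>c. \<exists>q \<epsilon>. c \<in> C \<longrightarrow> q \<in> cs \<and> \<epsilon> > 0 \<and> (\<forall>y. q (y - c) < \<epsilon> \<longrightarrow> y \<in> U)"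
    using open_contains_cs_ball[OF U] C(2) by blast
  then obtain q \<epsilon> where q: "\<forall>c. c \<in> C \<longrightarrow> q c \<in> cs \<and> \<epsilon> c > 0 \<and> (\<forall>y. q c (y - c) < \<epsilon> c \<longrightarrow> y \<in> U)"
    unfolding choice_iff by blast
  let ?B = "\<lambda>c. {y. q c (y - c) < \<epsilon> c}"
  have cov: "C \<subseteq> (\<Union>c\<in>C. ?B c)"
  proof
    fix c assume c: "c \<in> C"
    then have "c \<in> ?B c" using q seminorm_0[of "q c"] by simp
    then show "c \<in> (\<Union>c\<in>C. ?B c)" using c by blast
  qed
  have op: "open (?B c)" if "c \<in> C" for c using q that by (intro open_cs_ball) blast
  obtain D where D: "D \<subseteq> C" "finite D" "C \<subseteq> (\<Union>c\<in>D. ?B c)"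
    by (rule compactE_image[OF C(1) op cov])
  obtain r where r: "r \<in> cs" "\<forall>s\<in>q ` D. \<forall>x. s x \<le> r x"
    using finite_le_cs[of "q ` D"] D q by blast
  \<comment> \<open>The 1 keeps the minimum defined when \<open>D\<close> is empty.\<close>
  define \<delta> where "\<delta> = Min (insert 1 (\<epsilon> ` D))"
  have \<delta>: "\<delta> > 0" "\<And>c. c \<in> D \<Longrightarrow> \<delta> \<le> \<epsilon> c" using D q unfolding \<delta>_def by (auto simp: Min_gr_iff)
  have "y \<in> U" if c: "c \<in> C" and y: "r (y - c) < \<delta>" for c y
  proof -
    obtain d where d: "d \<in> D" "q d (c - d) < \<epsilon> d" using c D(3) by blast
    then have dC: "d \<in> C" "q d \<in> cs" using D q by auto
    have "q d (y - c) \<le> r (y - c)" using r(2) d(1) by blast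
    then have "q d (y - c) < \<epsilon> d" using y \<delta>(2)[OF d(1)] by linarith
    then have "q d (y - d) < \<epsilon> d"
      using seminorm_diff_ultra[OF dC(2), of y c d] d(2) by (auto intro: le_less_trans)
    then show ?thesis using q dC(1) by blast
  qed
  then show ?thesis using r(1) \<delta>(1) by blast
qed

lemma topspace_compact_open_topology: "topspace (compact_open_topology X) = (continuous_maps X :: ('x::topological_space \<Rightarrow> 'e) set)"
proof -
  have "(continuous_maps X :: ('x \<Rightarrow> 'e) set) = {g \<in> continuous_maps X. g ` {} \<subseteq> UNIV}" by simp
  then have "(continuous_maps X :: ('x \<Rightarrow> 'e) set) \<in> {{g \<in> continuous_maps X. g ` K \<subseteq> U} | K U. compact K \<and> K \<subseteq> X \<and> open U}"
    by (intro CollectI exI[of _ "{}"] exI[of _ UNIV]) simp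
  then show ?thesis
    unfolding compact_open_topology_def topology_generated_by_topspace by blast
qed

text \<open>X is covered by finitely many compact pieces on which \<open>h\<^sub>0\<close> is nearly
  constant. Forcing h to map each piece near that value makes h uniformly close to
  \<open>h\<^sub>0\<close>.\<close>

lemma compact_open_neighbourhood:
  fixes h\<^sub>0 :: "'x::topological_space \<Rightarrow> 'e"
  assumes X: "compact X" and h0: "h\<^sub>0 \<in> continuous_maps X" and q: "q \<in> cs" and \<delta>: "\<delta> > 0"
  shows "\<exists>W. openin (compact_open_topology X) W \<and> h\<^sub>0 \<in> W \<and> (\<forall>h\<in>W. \<forall>x\<in>X. q (h x - h\<^sub>0 x) < \<delta>)"
proof -
  have cont: "continuous_on X h\<^sub>0" using h0 by (simp add: continuous_maps_def)
  \<comment> \<open>The non-strict inequality makes \<open>K a\<close> compact; the strict one makes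
    \<open>B a\<close> relatively open, as the covering argument requires.\<close>
  define K where "K a = {x \<in> X. q (h\<^sub>0 x - h\<^sub>0 a) \<le> \<delta> / 2}" for a
  define B where "B a = {x \<in> X. q (h\<^sub>0 x - h\<^sub>0 a) < \<delta> / 2}" for a
  have cq: "continuous_on X (\<lambda>x. q (h\<^sub>0 x - h\<^sub>0 a))" for a
    by (intro continuous_on_compose2[OF cs_continuous[OF q]] continuous_on_diff cont continuous_on_const) auto
  have Kc: "compact (K a)" for a
  proof -
    have "closedin (top_of_set X) {x \<in> X. (\<lambda>x. q (h\<^sub>0 x - h\<^sub>0 a)) x \<in> {..\<delta> / 2}}"
      using continuous_closedin_preimage[OF cq, of "{..\<delta> / 2}" a] by (simp add: vimage_def Int_def)
    then show ?thesis unfolding K_def using X closedin_compact by fastforce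
  qed
  have "openin (top_of_set X) (B a)" for a
    using continuous_openin_preimage_gen[OF cq, of "{..<\<delta> / 2}" a] by (simp add: B_def vimage_def Int_def)
  then obtain T where T: "\<forall>a. open (T a) \<and> B a = X \<inter> T a" unfolding openin_open choice_iff by (metis Int_commute)
  have cov: "X \<subseteq> (\<Union>a\<in>X. T a)"
  proof
    fix a assume a: "a \<in> X"
    then have "a \<in> B a" using \<delta> q by (simp add: B_def seminorm_0)
    then show "a \<in> (\<Union>a\<in>X. T a)" using T a by blast
  qed
  have op: "open (T a)" if "a \<in> X" for a using T by blast
  obtain D where D: "D \<subseteq> X" "finite D" "X \<subseteq> (\<Union>a\<in>D. T a)"
    by (rule compactE_image[OF X op cov])
  define N where "N a = {h \<in> continuous_maps X. h ` K a \<subseteq> {y. q (y - h\<^sub>0 a) < \<delta>}}" for a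
  have N: "openin (compact_open_topology X) (N a)" for a
    unfolding compact_open_topology_def N_def
  proof (rule topology_generated_by_Basis, intro CollectI exI conjI refl)
    show "compact (K a)" by (rule Kc)
    show "K a \<subseteq> X" by (auto simp: K_def)
    show "open {y. q (y - h\<^sub>0 a) < \<delta>}" by (rule open_cs_ball[OF q])
  qed (rule refl)
  \<comment> \<open>The whole space is included so that the intersection is open even if
    \<open>D\<close> is empty.\<close>
  let ?W = "\<Inter>(insert (topspace (compact_open_topology X)) (N ` D))"
  have "openin (compact_open_topology X) ?W" using D(2) N by (intro openin_Inter) auto
  moreover have "h\<^sub>0 \<in> ?W" using h0 \<delta> by (auto simp: N_def K_def topspace_compact_open_topology)
  moreover have "q (h x - h\<^sub>0 x) < \<delta>" if h: "h \<in> ?W" and x: "x \<in> X" for h x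
  proof -
    obtain a where a: "a \<in> D" "x \<in> B a" using x D(3) T by blast
    then have "x \<in> K a" by (auto simp: B_def K_def)
    then have "q (h x - h\<^sub>0 a) < \<delta>" using h a(1) by (auto simp: N_def)
    moreover have "q (h\<^sub>0 a - h\<^sub>0 x) < \<delta>"
      using a(2) \<delta> seminorm_minus_commute[OF q, of "h\<^sub>0 a" "h\<^sub>0 x"] by (simp add: B_def)
    ultimately show ?thesis using seminorm_diff_ultra[OF q, of "h x" "h\<^sub>0 a" "h\<^sub>0 x"] by (auto intro: le_less_trans)
  qed
  ultimately show ?thesis by blast
qed

end

subsection \<open>The topology of the space of differentiable functions\<close>

context lcs
begin

lemma seminormed_C_alpha:
  fixes \<alpha> :: "'n::finite \<Rightarrow> nat"
  shows "seminormed (pointwise sc) (C_alpha_space sc \<alpha>)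
    ((\<lambda>q f. q (mahler f)) ` weight_norm \<alpha> ` cs)"
proof -
  interpret C: seminormed "pointwise sc" "c0_space sc (weight \<alpha>)" "weight_norm \<alpha> ` cs"
    by (rule seminormed_c0) (rule weight_pos)
  interpret V: vector_space "pointwise sc :: 'p padic \<Rightarrow> (('n \<Rightarrow> 'p padic) \<Rightarrow> 'e) \<Rightarrow> ('n \<Rightarrow> 'p padic) \<Rightarrow> 'e"
    by (rule vector_space_pointwise)
  show ?thesis
  proof
    show "V.subspace (C_alpha_space sc \<alpha>)" by (rule vector_subspace_C_alpha_space)
  qed (use C.nonneg C.scale_eq C.ultra in
      \<open>auto simp: mahler_coeff_scale mahler_coeff_add mahler_coeff_in_c0\<close>)
qed

context
  fixes \<alpha> :: "'n::finite \<Rightarrow> nat"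
  assumes complete: "sequentially_complete TYPE('e)"
begin

text \<open>The weighted seminorms pulled back along the coefficient map. The remaining work is to
  show that they define the topology generated by the extended difference quotients.\<close>

abbreviation "mahler_seminorms \<equiv> (\<lambda>q f. q (mahler f)) ` weight_norm \<alpha> ` cs"

abbreviation "mahler_topology \<equiv> seminorm_topology (C_alpha_space sc \<alpha>) mahler_seminorms"

interpretation S: seminormed "pointwise sc" "C_alpha_space sc \<alpha>" mahler_seminorms
  by (rule seminormed_C_alpha)

lemma mahler_series_mahler_coeff:
  assumes f: "f \<in> C_alpha_space sc \<alpha>"
  shows "mahler_series (mahler f) = f"
proof -
  let ?F = "mahler_series (mahler f)"
  have F: "?F \<in> C_alpha_space sc \<alpha>"
    by (intro mahler_series_in_C_alpha_space complete mahler_coeff_in_c0 f)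
  have "mahler ?F = mahler f"
    by (rule mahler_coeff_mahler_series[OF complete mahler_coeff_in_c0[OF f]])
  moreover have "mahler ((?F - f) + f) = mahler (?F - f) + mahler f"
    by (rule mahler_coeff_add)
  ultimately have "mahler (?F - f) = 0" by simp
  then have "?F - f = 0" using mahler_coeff_eq_0_imp[OF S.S_closed(3)[OF F f]] by blast
  then show ?thesis by simp
qed

lemma bij_betw_mahler_coeff: "bij_betw (mahler) (C_alpha_space sc \<alpha>) (c0_space sc (weight \<alpha>))"
  by (rule bij_betw_byWitness[of _ mahler_series])
    (auto simp: mahler_series_mahler_coeff mahler_coeff_mahler_series[OF complete] mahler_coeff_in_c0
      mahler_series_in_C_alpha_space[OF complete])

lemma extended_difference_mahler:
  assumes f: "f \<in> C_alpha_space sc \<alpha>" and \<beta>: "\<beta> \<le> \<alpha>"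
    and V: "cartesian V" "Pi UNIV V \<subseteq> Pi UNIV padic_cube"
  shows "extended_difference sc V \<beta> (restriction V f) =
      (\<lambda>x. if x \<in> blocks V \<beta> then diff_series \<beta> (mahler f) x else 0)"
    and "extended_difference sc V \<beta> (restriction V f) \<in> continuous_maps (blocks V \<beta>)"
    and "blocks V \<beta> \<subseteq> blocks padic_cube \<beta>"
proof -
  have ext: "extends_divided_difference sc padic_cube \<beta> f (diff_series \<beta> (mahler f))"
    using extends_mahler_series[OF complete mahler_coeff_in_c0[OF f] \<beta>] by (simp add: mahler_series_mahler_coeff f)
  note * = extended_difference_eq[OF V ext]
  show "extended_difference sc V \<beta> (restriction V f) =
      (\<lambda>x. if x \<in> blocks V \<beta> then diff_series \<beta> (mahler f) x else 0)" by (rule *(1))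
  show "blocks V \<beta> \<subseteq> blocks padic_cube \<beta>" by (rule *(3))
  show "extended_difference sc V \<beta> (restriction V f) \<in> continuous_maps (blocks V \<beta>)"
    unfolding *(1) continuous_maps_def mem_Collect_eq
    by (subst continuous_on_cong[OF refl, of _ _ "diff_series \<beta> (mahler f)"]) (use *(2) in auto)
qed

lemma mahler_coeff_diff: "mahler (f - g) = mahler f - mahler g"
  using mahler_coeff_add[of "f - g" g] by simp

lemma divided_difference_diff: "divided_difference sc \<beta> (f - g) x = divided_difference sc \<beta> f x - divided_difference sc \<beta> g x"
  using divided_difference_add[of \<beta> "f - g" g x] by simp

text \<open>On a subbasic set the image of \<open>K\<close> is a compact part of \<open>U\<close>,
  so one seminorm gives a uniform margin \<epsilon>. By \<open>diff_series_le\<close> the difference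
  quotients move by at most the weighted norm of the change of coefficients.\<close>

lemma continuous_map_extended_difference:
  assumes \<beta>: "\<beta> \<le> \<alpha>" and V: "cartesian V" "Pi UNIV V \<subseteq> Pi UNIV padic_cube"
  shows "continuous_map mahler_topology (compact_open_topology (blocks V \<beta>))
    (\<lambda>f. extended_difference sc V \<beta> (restriction V f))"
proof -
  let ?E = "\<lambda>f. extended_difference sc V \<beta> (restriction V f)"
  note E = extended_difference_mahler[OF _ \<beta> V]
  have img: "?E ` C_alpha_space sc \<alpha> \<subseteq> topspace (compact_open_topology (blocks V \<beta>))"
    unfolding topspace_compact_open_topology using E(2) by blast
  have "openin mahler_topology (?E -` W \<inter> C_alpha_space sc \<alpha>)"
    if W: "W = {g \<in> continuous_maps (blocks V \<beta>). g ` K \<subseteq> U}" and K: "compact K" "K \<subseteq> blocks V \<beta>" and U: "open U"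
    for W K U
    unfolding S.openin_seminorm_topology
  proof (intro conjI ballI)
    fix f assume "f \<in> ?E -` W \<inter> C_alpha_space sc \<alpha>"
    then have f: "f \<in> C_alpha_space sc \<alpha>" "?E f ` K \<subseteq> U" using W by auto
    have "continuous_on K (?E f)"
      using E(2)[OF f(1)] K(2) continuous_on_subset by (auto simp: continuous_maps_def)
    then have "compact (?E f ` K)" using K(1) by (rule compact_continuous_image)
    then obtain q \<epsilon> where q: "q \<in> cs" "\<epsilon> > 0" "\<forall>c\<in>?E f ` K. \<forall>y. q (y - c) < \<epsilon> \<longrightarrow> y \<in> U"
      using compact_subset_open_cs[OF _ f(2) U] by blast
    let ?Q = "\<lambda>f. weight_norm \<alpha> q (mahler f)"
    have "S.seminorm_ball {?Q} f \<epsilon> \<subseteq> ?E -` W \<inter> C_alpha_space sc \<alpha>"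
    proof
      fix g assume "g \<in> S.seminorm_ball {?Q} f \<epsilon>"
      then have g: "g \<in> C_alpha_space sc \<alpha>" "?Q (g - f) < \<epsilon>" by (auto simp: S.seminorm_ball_def)
      have "?E g x \<in> U" if x: "x \<in> K" for x
      proof -
        have xV: "x \<in> blocks V \<beta>" using x K by blast
        then have xZ: "x i j \<in> padic_integers" if "j \<le> \<beta> i" for i j
          using subsetD[OF E(3)[OF f(1)] xV] that unfolding in_blocks_iff by blast
        have "?E g x - ?E f x = diff_series \<beta> (mahler g) x - diff_series \<beta> (mahler f) x"
          unfolding E(1)[OF f(1)] E(1)[OF g(1)] using xV by simp
        also have "\<dots> = diff_series \<beta> (mahler (g - f)) x"
          unfolding mahler_coeff_diff
          using xZ by (intro diff_series_diff[OF complete, where \<alpha> = \<alpha>, symmetric] mahler_coeff_in_c0 f g \<beta>)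
        also have "q \<dots> \<le> ?Q (g - f)"
          using xZ by (intro diff_series_le[OF complete] mahler_coeff_in_c0 S.S_closed f g \<beta> q)
        finally have "q (?E g x - ?E f x) < \<epsilon>" using g(2) by linarith
        then show ?thesis using q(3) x by blast
      qed
      then show "g \<in> ?E -` W \<inter> C_alpha_space sc \<alpha>" using g(1) E(2)[OF g(1)] W by auto
    qed
    then show "\<exists>F \<epsilon>. finite F \<and> F \<subseteq> mahler_seminorms \<and> \<epsilon> > 0 \<and> S.seminorm_ball F f \<epsilon> \<subseteq> ?E -` W \<inter> C_alpha_space sc \<alpha>"
      using q by (intro exI[of _ "{?Q}"] exI[of _ \<epsilon>]) auto
  qed auto
  then show ?thesis
    using img
    unfolding compact_open_topology_def topology_generated_by_topspace
    by (subst continuous_on_generated_topo_iff) (auto simp: S.topspace_seminorm_topology)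
qed

lemma openin_mahler_topology_if:
  assumes "openin (C_alpha_topology sc \<alpha>) U"
  shows "openin mahler_topology U"
proof -
  have "generate_topology_on {{f \<in> C_alpha_space sc \<alpha>. extended_difference sc V \<beta> (restriction V f) \<in> W} | V \<beta> W.
        \<beta> \<le> \<alpha> \<and> cartesian V \<and>
        openin (top_of_set (Pi UNIV padic_cube)) (Pi UNIV V) \<and>
        openin (compact_open_topology (blocks V \<beta>)) W} U"
    using assms by (simp add: C_alpha_topology_def openin_topology_generated_by)
  then show ?thesis
  proof induction
    case (Basis s)
    then obtain V \<beta> W where s: "s = {f \<in> C_alpha_space sc \<alpha>. extended_difference sc V \<beta> (restriction V f) \<in> W}"
      and \<beta>: "\<beta> \<le> \<alpha>" and V: "cartesian V" "openin (top_of_set (Pi UNIV padic_cube)) (Pi UNIV V)"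
      and W: "openin (compact_open_topology (blocks V \<beta>)) W" by blast
    have "Pi UNIV V \<subseteq> Pi UNIV padic_cube" using openin_subset[OF V(2)] by simp
    from openin_continuous_map_preimage[OF continuous_map_extended_difference[OF \<beta> V(1) this] W]
    show ?case by (simp add: s S.topspace_seminorm_topology)
  qed auto
qed

text \<open>Generators with V the whole cube suffice: for each of the finitely many \<beta> \<le>
  \<alpha>, require the extended differences to be uniformly within \<delta>, and apply
  \<open>mahler_coeff_bound\<close> to g - f.\<close>

lemma C_alpha_topology_neighbourhood:
  assumes f: "f \<in> C_alpha_space sc \<alpha>" and q: "q \<in> cs" and \<epsilon>: "\<epsilon> > 0"
  shows "\<exists>N. openin (C_alpha_topology sc \<alpha>) N \<and> f \<in> N \<and> N \<subseteq> C_alpha_space sc \<alpha> \<and>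
    (\<forall>g\<in>N. weight_norm \<alpha> q (mahler (g - f)) < \<epsilon>)"
proof -
  let ?Z = "\<lambda>_ :: 'n. padic_integers :: 'p padic set"
  let ?E = "\<lambda>\<beta> f. extended_difference sc ?Z \<beta> (restriction ?Z f)"
  let ?C = "(\<Prod>i\<in>UNIV. decay_const CARD('p) (\<alpha> i))"
  have C: "?C > 0" using CARD_gt_1[where ?'p = 'p] by (intro prod_pos) (auto simp: decay_const_def)
  \<comment> \<open>The 2 keeps the inequality strict after passing to the supremum.\<close>
  define \<delta> where "\<delta> = \<epsilon> / (2 * ?C)"
  have \<delta>: "\<delta> > 0" "?C * \<delta> < \<epsilon>" using C \<epsilon> by (auto simp: \<delta>_def)
  note E = extended_difference_mahler[OF _ _ cartesian_padic_integers subset_refl]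
  let ?P = "\<lambda>\<beta> W. openin (compact_open_topology (blocks ?Z \<beta>)) W \<and> ?E \<beta> f \<in> W \<and>
      (\<forall>h\<in>W. \<forall>x\<in>blocks ?Z \<beta>. q (h x - ?E \<beta> f x) < \<delta>)"
  have "\<exists>W. \<beta> \<le> \<alpha> \<longrightarrow> ?P \<beta> W" for \<beta>
    using compact_open_neighbourhood[OF compact_blocks E(2)[OF f] q \<delta>(1)] compact_padic_integers by blast
  then have "\<forall>\<beta>. \<exists>W. \<beta> \<le> \<alpha> \<longrightarrow> ?P \<beta> W" by blast
  then obtain W where W: "\<forall>\<beta>. \<beta> \<le> \<alpha> \<longrightarrow> ?P \<beta> (W \<beta>)"
    unfolding choice_iff by blast
  define N where "N = (\<Inter>\<beta>\<in>{\<beta>. \<beta> \<le> \<alpha>}. {g \<in> C_alpha_space sc \<alpha>. ?E \<beta> g \<in> W \<beta>})"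
  have "openin (C_alpha_topology sc \<alpha>) {g \<in> C_alpha_space sc \<alpha>. ?E \<beta> g \<in> W \<beta>}" if "\<beta> \<le> \<alpha>" for \<beta>
    unfolding C_alpha_topology_def
  proof (rule topology_generated_by_Basis, intro CollectI exI conjI)
    show "openin (top_of_set (Pi UNIV ?Z)) (Pi UNIV ?Z)" by (rule openin_subtopology_self)
  qed (use that W cartesian_padic_integers in auto)
  then have "openin (C_alpha_topology sc \<alpha>) N"
    unfolding N_def using finite_multiindices_le[of \<alpha>] by (intro openin_Inter) auto
  moreover have "f \<in> N" using f W by (auto simp: N_def)
  moreover have "N \<subseteq> C_alpha_space sc \<alpha>" by (auto simp: N_def)
  moreover have "weight_norm \<alpha> q (mahler (g - f)) < \<epsilon>" if g: "g \<in> N" for g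
  proof -
    have gC: "g \<in> C_alpha_space sc \<alpha>" using g by (auto simp: N_def)
    have dd: "?E \<beta> h x = divided_difference sc \<beta> h x"
      if "h \<in> C_alpha_space sc \<alpha>" "\<beta> \<le> \<alpha>" "x \<in> distinct_blocks ?Z \<beta>" for h \<beta> x
    proof -
      have "x \<in> blocks ?Z \<beta>" using that(3) by (simp add: distinct_blocks_def)
      then show ?thesis
        using extends_mahler_series[OF complete mahler_coeff_in_c0[OF that(1)] that(2)] that(3)
        by (simp add: E(1)[OF that(1,2)] extends_divided_difference_def mahler_series_mahler_coeff[OF that(1)])
    qed
    have "weight \<alpha> \<nu> * q (mahler (g - f) \<nu>) \<le> ?C * \<delta>" for \<nu>
    proof (rule mahler_coeff_bound[OF q less_imp_le[OF \<delta>(1)]])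
      fix \<beta> x assume \<beta>: "\<beta> \<le> \<alpha>" and x: "x \<in> distinct_blocks ?Z \<beta>"
      have "q (?E \<beta> g x - ?E \<beta> f x) < \<delta>"
        using W \<beta> x g by (auto simp: N_def distinct_blocks_def)
      then show "q (divided_difference sc \<beta> (g - f) x) \<le> \<delta>"
        by (simp add: divided_difference_diff dd[OF gC \<beta> x] dd[OF f \<beta> x])
    qed
    then have "weight_norm \<alpha> q (mahler (g - f)) \<le> ?C * \<delta>"
      by (rule weighted_seminorm_least[OF weight_pos])
    then show ?thesis using \<delta>(2) by linarith
  qed
  ultimately show ?thesis by blast
qed

lemma openin_C_alpha_topology_if:
  assumes "openin mahler_topology U"
  shows "openin (C_alpha_topology sc \<alpha>) U"
proof -
  show ?thesis
  proof (subst openin_subopen, intro ballI)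
    fix f assume f: "f \<in> U"
    then have fC: "f \<in> C_alpha_space sc \<alpha>" using openin_subset[OF assms] by (auto simp: S.topspace_seminorm_topology)
    obtain F \<epsilon> where F: "finite F" "F \<subseteq> mahler_seminorms" "\<epsilon> > 0" "S.seminorm_ball F f \<epsilon> \<subseteq> U"
      using assms f unfolding S.openin_seminorm_topology by blast
    have "mahler_seminorms = (\<lambda>q f. weight_norm \<alpha> q (mahler f)) ` cs"
      by (simp add: image_image)
    then obtain G where G: "finite G" "G \<subseteq> cs" "F = (\<lambda>q f. weight_norm \<alpha> q (mahler f)) ` G"
      using finite_subset_image[of F _ cs] F(1,2) by metis
    obtain q where q: "q \<in> cs" "\<forall>r\<in>G. \<forall>x. r x \<le> q x" using finite_le_cs[OF G(1,2)] by blast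
    obtain N where N: "openin (C_alpha_topology sc \<alpha>) N" "f \<in> N" "N \<subseteq> C_alpha_space sc \<alpha>"
      "\<forall>g\<in>N. weight_norm \<alpha> q (mahler (g - f)) < \<epsilon>"
      using C_alpha_topology_neighbourhood[OF fC q(1) F(3)] by blast
    have "N \<subseteq> S.seminorm_ball F f \<epsilon>"
    proof
      fix g assume g: "g \<in> N"
      have gC: "g \<in> C_alpha_space sc \<alpha>" using g N(3) by blast
      have "weight_norm \<alpha> r (mahler (g - f)) < \<epsilon>" if r: "r \<in> G" for r
      proof -
        have "weight_norm \<alpha> r (mahler (g - f)) \<le> weight_norm \<alpha> q (mahler (g - f))"
          using q(2) r by (intro weighted_seminorm_mono[OF weight_pos] mahler_coeff_in_c0 S.S_closed gC fC q(1)) blast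
        then show ?thesis using N(4) g by fastforce
      qed
      then show "g \<in> S.seminorm_ball F f \<epsilon>" using gC by (auto simp: S.seminorm_ball_def G(3))
    qed
    then show "\<exists>T. openin (C_alpha_topology sc \<alpha>) T \<and> f \<in> T \<and> T \<subseteq> U" using N F(4) by blast
  qed
qed

lemma C_alpha_topology_eq: "C_alpha_topology sc \<alpha> = mahler_topology"
  unfolding topology_eq using openin_mahler_topology_if openin_C_alpha_topology_if by blast

end

end

theorem proposition6p11:
  fixes sc :: "'p::prime_card padic \<Rightarrow> 'e::{topological_ab_group_add, t2_space} \<Rightarrow> 'e"
    and \<alpha> :: "'n::finite \<Rightarrow> nat"
  assumes "locally_convex sc" and "sequentially_complete TYPE('e)"
  shows "tvs_isomorphism (pointwise sc) (C_alpha_topology sc \<alpha>)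
           (pointwise sc) (c0_topology sc (weight \<alpha>)) (mahler_coeff sc)"
proof -
  interpret lcs sc by unfold_locales (rule assms(1))
  \<comment> \<open>Both topologies are given by seminorms, and those of the source are the
    pullbacks of those of the target.\<close>
  show ?thesis
    unfolding C_alpha_topology_eq[OF assms(2)] c0_topology_def
    by (rule tvs_isomorphism_seminorm_topology)
      (simp_all add: seminormed_C_alpha seminormed_c0[OF weight_pos] c0_separated[OF weight_pos, simplified]
        bij_betw_mahler_coeff[OF assms(2)] mahler_coeff_add mahler_coeff_scale)
qed

end
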